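(* Let $\mathbb{Z}_3\subset A_5$ be a cyclic subgroup of order 3, acting on Bring's curve $\mathcal{B}$ by even permutations of coordinates. The quotient curve $\mathcal{B}/_{\mathbb{Z}_3}$ is biholomorphic to the algebraic curve defined by the affine equation $$y^2 = 432x^6+648x^5+945x^4+1350x^3+945x^2+648x +432.$$
   Context: Bring's curve $\mathcal{B}\subset\mathbb{CP}^4$ is the genus-4 curve defined by $\sum_{i=1}^5 x_i=\sum_{i=1}^5 x_i^2=\sum_{i=1}^5 x_i^3=0$. The group $A_5$ acts on $\mathcal{B}$ by even permutations of the five homogeneous coordinates (it is the automorphism group of the dessin d'enfant $I_4$, the icosahedron of genus 4, embedded in $\mathcal{B}$); e.g. one may take $\mathbb{Z}_3=\langle(123)\rangle$. For a subgroup $G\subset A_5$, $\mathcal{B}/_G$ denotes the quotient compact Riemann surface. The curve given by an affine equation $y^2=P(x)$ means the compact Riemann surface (smooth projective model) of that affine curve over $\mathbb{C}$. *)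

theory Defs
  imports
    "HOL-Analysis.Analysis"
    "HOL-Combinatorics.Permutations"
    "HOL-Algebra.Elementary_Groups"
begin

section \<open>Spaces with a structure sheaf of complex-valued functions\<close>

text \<open>
  Riemann surfaces are described by their structure sheaf. A space consists of a topology and
  of a predicate saying which functions are holomorphic at (that is, in some neighbourhood of) a
  given point. A function is holomorphic on an open set iff it is so at each of its points, so
  the sheaf axioms need not be imposed. Only the values near the point and inside the
  topological space are meant to matter; for the spaces built below and on the domain of a chart
  this is the case.
\<close>

record 'a cspace =
  ctop :: "'a topology"
  hol_at :: "('a \<Rightarrow> complex) \<Rightarrow> 'a \<Rightarrow> bool"

definition affine_space :: "(complex ^ 'n::finite) cspace" where
  "affine_space = \<lparr> ctop = euclidean,
     hol_at = (\<lambda>f x. \<exists>U. open U \<and> x \<in> U \<and>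
       (\<forall>y\<in>U. \<exists>D. (f has_derivative D) (at y) \<and> (\<forall>c v. D (c *s v) = c * D v))) \<rparr>"

text \<open>
  On a subset, the holomorphic functions are the local restrictions of holomorphic functions of
  the ambient space. For a complex submanifold this is its usual complex structure.
\<close>

definition sub_cspace :: "'a set \<Rightarrow> 'a cspace \<Rightarrow> 'a cspace" where
  "sub_cspace S X = \<lparr> ctop = subtopology (ctop X) S,
     hol_at = (\<lambda>f p. \<exists>W g. openin (ctop X) W \<and> p \<in> W \<and>
       (\<forall>q\<in>W \<inter> S. f q = g q) \<and> hol_at X g p) \<rparr>"

definition quotient_topology :: "'a topology \<Rightarrow> ('a \<Rightarrow> 'b) \<Rightarrow> 'b topology" where
  "quotient_topology T \<pi> =
     topology (\<lambda>V. V \<subseteq> \<pi> ` topspace T \<and> openin T {x \<in> topspace T. \<pi> x \<in> V})"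

lemma openin_quotient_topology:
  "openin (quotient_topology T \<pi>) V \<longleftrightarrow>
     V \<subseteq> \<pi> ` topspace T \<and> openin T {x \<in> topspace T. \<pi> x \<in> V}"
proof -
  have "istopology (\<lambda>V. V \<subseteq> \<pi> ` topspace T \<and> openin T {x \<in> topspace T. \<pi> x \<in> V})"
    unfolding istopology_def
  proof (intro conjI allI impI)
    fix A B
    assume A: "A \<subseteq> \<pi> ` topspace T \<and> openin T {x \<in> topspace T. \<pi> x \<in> A}"
      and B: "B \<subseteq> \<pi> ` topspace T \<and> openin T {x \<in> topspace T. \<pi> x \<in> B}"
    show "A \<inter> B \<subseteq> \<pi> ` topspace T" using A by blast
    have "{x \<in> topspace T. \<pi> x \<in> A \<inter> B}
        = {x \<in> topspace T. \<pi> x \<in> A} \<inter> {x \<in> topspace T. \<pi> x \<in> B}" by blast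
    then show "openin T {x \<in> topspace T. \<pi> x \<in> A \<inter> B}" using A B by auto
  next
    fix \<K>
    assume K: "\<forall>K\<in>\<K>. K \<subseteq> \<pi> ` topspace T \<and> openin T {x \<in> topspace T. \<pi> x \<in> K}"
    show "\<Union>\<K> \<subseteq> \<pi> ` topspace T" using K by blast
    have "{x \<in> topspace T. \<pi> x \<in> \<Union>\<K>} = (\<Union>K\<in>\<K>. {x \<in> topspace T. \<pi> x \<in> K})" by blast
    then show "openin T {x \<in> topspace T. \<pi> x \<in> \<Union>\<K>}" using K by auto
  qed
  then show ?thesis
    unfolding quotient_topology_def by (simp add: topology_inverse')
qed

lemma topspace_quotient_topology: "topspace (quotient_topology T \<pi>) = \<pi> ` topspace T"
proof (rule antisym)
  show "topspace (quotient_topology T \<pi>) \<subseteq> \<pi> ` topspace T"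
    using openin_quotient_topology openin_topspace by metis
  have "{x \<in> topspace T. \<pi> x \<in> \<pi> ` topspace T} = topspace T" by blast
  then have "openin (quotient_topology T \<pi>) (\<pi> ` topspace T)"
    by (simp add: openin_quotient_topology)
  then show "\<pi> ` topspace T \<subseteq> topspace (quotient_topology T \<pi>)"
    by (rule openin_subset)
qed

lemma quotient_map_quotient_topology: "quotient_map T (quotient_topology T \<pi>) \<pi>"
  unfolding quotient_map_def
  by (simp add: openin_quotient_topology topspace_quotient_topology)

definition quotient_cspace :: "'a cspace \<Rightarrow> ('a \<Rightarrow> 'b) \<Rightarrow> 'b cspace" where
  "quotient_cspace X \<pi> = \<lparr> ctop = quotient_topology (ctop X) \<pi>,
     hol_at = (\<lambda>f q. \<exists>V. openin (quotient_topology (ctop X) \<pi>) V \<and> q \<in> V \<and>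
       (\<forall>p\<in>topspace (ctop X). \<pi> p \<in> V \<longrightarrow> hol_at X (f \<circ> \<pi>) p)) \<rparr>"

section \<open>Riemann surfaces and biholomorphic maps\<close>

text \<open>
  A chart identifies the structure sheaf on an open set with that of an open subset of
  \<^typ>\<open>complex\<close>. Transition maps between charts in this sense are automatically holomorphic.
\<close>

definition is_chart :: "'a cspace \<Rightarrow> 'a set \<Rightarrow> ('a \<Rightarrow> complex) \<Rightarrow> bool" where
  "is_chart X U \<phi> \<longleftrightarrow>
     openin (ctop X) U \<and> open (\<phi> ` U) \<and>
     homeomorphic_map (subtopology (ctop X) U) (top_of_set (\<phi> ` U)) \<phi> \<and>
     (\<forall>p\<in>U. \<forall>f. hol_at X f p \<longleftrightarrow> (f \<circ> inv_into U \<phi>) analytic_on {\<phi> p})"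

definition riemann_surface :: "'a cspace \<Rightarrow> bool" where
  "riemann_surface X \<longleftrightarrow>
     topspace (ctop X) \<noteq> {} \<and> Hausdorff_space (ctop X) \<and> second_countable (ctop X) \<and>
     connected_space (ctop X) \<and>
     (\<forall>p\<in>topspace (ctop X). \<exists>U \<phi>. p \<in> U \<and> is_chart X U \<phi>)"

definition compact_riemann_surface :: "'a cspace \<Rightarrow> bool" where
  "compact_riemann_surface X \<longleftrightarrow> riemann_surface X \<and> compact_space (ctop X)"

definition holomorphic_map :: "'a cspace \<Rightarrow> 'b cspace \<Rightarrow> ('a \<Rightarrow> 'b) \<Rightarrow> bool" where
  "holomorphic_map X Y F \<longleftrightarrow>
     continuous_map (ctop X) (ctop Y) F \<and>
     (\<forall>p\<in>topspace (ctop X). \<forall>f. hol_at Y f (F p) \<longrightarrow> hol_at X (f \<circ> F) p)"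

definition biholomorphic :: "'a cspace \<Rightarrow> 'b cspace \<Rightarrow> bool" where
  "biholomorphic X Y \<longleftrightarrow>
     (\<exists>F G. holomorphic_map X Y F \<and> holomorphic_map Y X G \<and>
        (\<forall>p\<in>topspace (ctop X). G (F p) = p) \<and> (\<forall>q\<in>topspace (ctop Y). F (G q) = q))"

text \<open>
  The compact Riemann surface of a smooth affine curve \<^term>\<open>C\<close>: a compact Riemann surface
  containing a copy of \<^term>\<open>C\<close> as the complement of finitely many points. It is unique up to
  biholomorphism.
\<close>

definition smooth_completion :: "'a cspace \<Rightarrow> 'b cspace \<Rightarrow> bool" where
  "smooth_completion C X \<longleftrightarrow>
     compact_riemann_surface X \<and>
     (\<exists>U. openin (ctop X) U \<and> finite (topspace (ctop X) - U) \<and>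
        biholomorphic C (sub_cspace U X))"

section \<open>Projective space\<close>

text \<open>Points of projective space are lines through the origin, with the origin removed.\<close>

definition proj_pt :: "complex ^ 'n::finite \<Rightarrow> (complex ^ 'n) set" where
  "proj_pt x = {c *s x | c. c \<noteq> 0}"

definition proj_space :: "(complex ^ 'n::finite) set cspace" where
  "proj_space = quotient_cspace (sub_cspace (- {0}) affine_space) proj_pt"

section \<open>Bring's curve and its quotients\<close>

definition bring_curve :: "(complex ^ 5) set cspace" where
  "bring_curve = sub_cspace
     (proj_pt ` {x. x \<noteq> 0 \<and> (\<Sum>i\<in>UNIV. x $ i) = 0 \<and>
                    (\<Sum>i\<in>UNIV. (x $ i)\<^sup>2) = 0 \<and> (\<Sum>i\<in>UNIV. (x $ i) ^ 3) = 0})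
     proj_space"

text \<open>Like \<open>HOL-Algebra\<close>'s \<open>alt_group\<close>, but on an arbitrary set instead of \<open>{1..n}\<close>.\<close>

definition alternating_group :: "'a set \<Rightarrow> ('a \<Rightarrow> 'a) monoid" where
  "alternating_group S =
     \<lparr> carrier = {p. p permutes S \<and> evenperm p}, mult = (\<circ>), one = id \<rparr>"

definition permute_coords :: "('n \<Rightarrow> 'n) \<Rightarrow> 'a ^ 'n::finite \<Rightarrow> 'a ^ 'n" where
  "permute_coords \<sigma> x = (\<chi> i. x $ (inv_into UNIV \<sigma> i))"

text \<open>
  The quotient by a group \<^term>\<open>G\<close> of coordinate permutations: its points are the orbits, and
  its holomorphic functions pull back to the invariant holomorphic functions.
\<close>

definition orbit_cspace ::
    "(complex ^ 'n::finite) set cspace \<Rightarrow> ('n \<Rightarrow> 'n) set \<Rightarrow> (complex ^ 'n) set set cspace" where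
  "orbit_cspace X G = quotient_cspace X (\<lambda>L. (\<lambda>\<sigma>. permute_coords \<sigma> ` L) ` G)"

section \<open>The curve $y^2 = P(x)$\<close>

definition affine_double_cover :: "(complex \<Rightarrow> complex) \<Rightarrow> (complex ^ 2) cspace" where
  "affine_double_cover P = sub_cspace {v. (v $ 2)\<^sup>2 = P (v $ 1)} affine_space"

text \<open>
  For a polynomial \<^term>\<open>P\<close> of degree 6 without multiple roots, the smooth projective model of
  $y^2 = P(x)$ is the closure of its image under $(x, y) \mapsto [1 : x : x^2 : x^3 : y]$; its
  points at infinity are $[0 : 0 : 0 : 1 : \pm \sqrt{a}]$, where $a$ is the leading coefficient.
  The closure in the weighted projective plane $P(1,1,3)$, or the gluing with the affine curve
  $v^2 = u^6 P(1/u)$, are other common descriptions of the same curve.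
\<close>

definition sextic_double_cover :: "(complex \<Rightarrow> complex) \<Rightarrow> (complex ^ 5) set cspace" where
  "sextic_double_cover P = sub_cspace
     (ctop proj_space closure_of
        {proj_pt (vector [1, x, x\<^sup>2, x ^ 3, y]) | x y. y\<^sup>2 = P x})
     proj_space"

end

theory Submission
  imports Defs "HOL-Complex_Analysis.Conformal_Mappings"
    "HOL-Computational_Algebra.Fundamental_Theorem_Algebra"
begin

text \<open>
  Let the group be generated by the 3-cycle of the coordinates $x_a, x_b, x_c$, let $s, t$ be the
  other two coordinates and $\omega$ a primitive cube root of unity. The Lagrange resolvents
  $u = x_a + \omega x_b + \omega^2 x_c$ and $w = x_a + \omega^2 x_b + \omega x_c$ are multiplied by
  $\omega$ and $\omega^2$ under the cycle, and Bring's equations amount to $x_a + x_b + x_c = -(s + t)$,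
  $u w = B(s,t)$ and $u^3 + w^3 = A(s,t)$ for certain forms $A$, $B$. Hence $y = u^3 - w^3$ is
  invariant, $y^2 = A^2 - 4 B^3$, and at $t = 1$ the right-hand side is the sextic $P(s)$. The map
  $x \mapsto [t^3 : s t^2 : s^2 t : s^3 : y]$ therefore sends Bring's curve onto the sextic curve, and its
  fibres are the orbits, because $u^3$, $w^3$ and $u w$ determine $(u, w)$ up to the cycle.
  It has local holomorphic sections: $u^3 = (A + y)/2$ and $w^3 = (A - y)/2$ do not vanish
  simultaneously, so one resolvent is a local cube root and the other one is $B$ divided by it.
  Being a continuous bijection from a compact space to a Hausdorff space, the induced map on the
  quotient is a homeomorphism, and the sections make its inverse holomorphic. The quotient thus
  inherits its charts from the sextic curve.
\<close>

text \<open>The action of the cycle is free: a projective fixed point would have s = t = 0 or u = w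
  = 0, and neither occurs on Bring's curve. Hence the quotient map is an unramified triple cover,
  which is why sections exist around every point. Riemann-Hurwitz, 6 = 3 * 2, gives the quotient
  genus 2, as befits a double cover branched over six points. The forms A and B come from the power
  sums of x_a, x_b, x_c, which Bring's equations express through s and t. The sextic A^2 - 4 B^3 is
  -27 times the discriminant of the cubic with roots x_a, x_b, x_c, so its zeros mark the points
  where two of these coordinates coincide. It is palindromic because s and t enter symmetrically, so
  the curve looks the same at infinity as near x = 0. The target is defined as a closure in
  projective space and must be identified with an explicit set covered by two affine patches. That
  this set is closed is deduced from Bring's curve, of which it is the continuous image.\<close>

section \<open>Spaces with a structure sheaf\<close>

text \<open>The record \<open>cspace\<close> puts no condition on \<open>hol_at\<close>. The two
  clauses, dependence on the germ only and openness of the condition, are what the transport of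
  holomorphy along maps relies on; both survive \<open>sub_cspace\<close> and
  \<open>quotient_cspace\<close>.\<close>

definition sheaf_cspace :: "'a cspace \<Rightarrow> bool" where
  "sheaf_cspace X \<longleftrightarrow>
     (\<forall>W f g p. openin (ctop X) W \<longrightarrow> p \<in> W \<longrightarrow> (\<forall>q\<in>W. f q = g q) \<longrightarrow> hol_at X f p \<longrightarrow> hol_at X g p) \<and>
     (\<forall>f p. p \<in> topspace (ctop X) \<longrightarrow> hol_at X f p \<longrightarrow>
        (\<exists>W. openin (ctop X) W \<and> p \<in> W \<and> (\<forall>q\<in>W. hol_at X f q)))"

lemma sheaf_cspace_cong:
  assumes "sheaf_cspace X" "openin (ctop X) W" "p \<in> W" "\<And>q. q \<in> W \<Longrightarrow> f q = g q" "hol_at X f p"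
  shows "hol_at X g p"
  using assms unfolding sheaf_cspace_def by metis

lemma sheaf_cspace_open:
  assumes "sheaf_cspace X" "p \<in> topspace (ctop X)" "hol_at X f p"
  obtains W where "openin (ctop X) W" "p \<in> W" "\<And>q. q \<in> W \<Longrightarrow> hol_at X f q"
  using assms unfolding sheaf_cspace_def by metis

lemma ctop_sub_cspace [simp]: "ctop (sub_cspace S X) = subtopology (ctop X) S"
  by (simp add: sub_cspace_def)

lemma hol_at_sub_cspace:
  "hol_at (sub_cspace S X) f p \<longleftrightarrow>
     (\<exists>W g. openin (ctop X) W \<and> p \<in> W \<and> (\<forall>q\<in>W \<inter> S. f q = g q) \<and> hol_at X g p)"
  by (simp add: sub_cspace_def)

lemma ctop_quotient_cspace [simp]:
  "ctop (quotient_cspace X \<pi>) = quotient_topology (ctop X) \<pi>"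
  by (simp add: quotient_cspace_def)

lemma hol_at_quotient_cspace:
  "hol_at (quotient_cspace X \<pi>) f q \<longleftrightarrow>
     (\<exists>V. openin (quotient_topology (ctop X) \<pi>) V \<and> q \<in> V \<and>
       (\<forall>p\<in>topspace (ctop X). \<pi> p \<in> V \<longrightarrow> hol_at X (f \<circ> \<pi>) p))"
  by (simp add: quotient_cspace_def)

lemma ctop_affine_space [simp]: "ctop affine_space = euclidean"
  by (simp add: affine_space_def)

lemma sheaf_affine_space: "sheaf_cspace affine_space"
  unfolding sheaf_cspace_def
proof (intro conjI allI impI)
  fix W :: "(complex ^ 'n) set" and f g p
  assume W: "openin (ctop affine_space) W" "p \<in> W" "\<forall>q\<in>W. f q = g q" and f: "hol_at affine_space f p"
  from f obtain U where U: "open U" "p \<in> U"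
    "\<And>y. y \<in> U \<Longrightarrow> \<exists>D. (f has_derivative D) (at y) \<and> (\<forall>c v. D (c *s v) = c * D v)"
    by (auto simp: affine_space_def)
  have oW: "open W" using W by simp
  have "\<exists>D. (g has_derivative D) (at y) \<and> (\<forall>c v. D (c *s v) = c * D v)" if y: "y \<in> U \<inter> W" for y
  proof -
    obtain D where D: "(f has_derivative D) (at y)" "\<forall>c v. D (c *s v) = c * D v"
      using U(3) y by blast
    have "(g has_derivative D) (at y)"
      by (rule has_derivative_transform_within_open[OF D(1) oW]) (use y W in auto)
    then show ?thesis using D by blast
  qed
  then show "hol_at affine_space g p"
    using U oW W by (auto simp: affine_space_def intro!: exI[of _ "U \<inter> W"])
next
  fix f and p :: "complex ^ 'n"
  assume "hol_at affine_space f p"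
  then obtain U where "open U" "p \<in> U"
    "\<And>y. y \<in> U \<Longrightarrow> \<exists>D. (f has_derivative D) (at y) \<and> (\<forall>c v. D (c *s v) = c * D v)"
    by (auto simp: affine_space_def)
  then show "\<exists>W. openin (ctop affine_space) W \<and> p \<in> W \<and> (\<forall>q\<in>W. hol_at affine_space f q)"
    by (intro exI[of _ U]) (auto simp: affine_space_def)
qed

lemma sheaf_sub_cspace:
  assumes X: "sheaf_cspace X"
  shows "sheaf_cspace (sub_cspace S X)"
  unfolding sheaf_cspace_def
proof (intro conjI allI impI)
  fix W f g p
  assume W: "openin (ctop (sub_cspace S X)) W" "p \<in> W" "\<forall>q\<in>W. f q = g q"
    and f: "hol_at (sub_cspace S X) f p"
  obtain V where V: "openin (ctop X) V" "W = V \<inter> S" using W(1) by (auto simp: openin_subtopology)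
  obtain V' h where h: "openin (ctop X) V'" "p \<in> V'" "\<forall>q\<in>V' \<inter> S. f q = h q" "hol_at X h p"
    using f unfolding hol_at_sub_cspace by blast
  have "\<forall>q\<in>(V \<inter> V') \<inter> S. g q = h q"
    using W(3) h(3) unfolding V(2) by (metis IntD1 IntD2 IntI)
  moreover have "openin (ctop X) (V \<inter> V')" "p \<in> V \<inter> V'"
    using V W h by (auto simp: openin_Int)
  ultimately show "hol_at (sub_cspace S X) g p"
    unfolding hol_at_sub_cspace using h(4) by blast
next
  fix f p
  assume p: "p \<in> topspace (ctop (sub_cspace S X))" and f: "hol_at (sub_cspace S X) f p"
  obtain V' h where h: "openin (ctop X) V'" "p \<in> V'" "\<forall>q\<in>V' \<inter> S. f q = h q" "hol_at X h p"
    using f unfolding hol_at_sub_cspace by blast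
  obtain V where V: "openin (ctop X) V" "p \<in> V" "\<And>q. q \<in> V \<Longrightarrow> hol_at X h q"
    by (rule sheaf_cspace_open[OF X _ h(4)]) (use p in auto)
  show "\<exists>W. openin (ctop (sub_cspace S X)) W \<and> p \<in> W \<and> (\<forall>q\<in>W. hol_at (sub_cspace S X) f q)"
  proof (intro exI conjI ballI)
    show "openin (ctop (sub_cspace S X)) (V' \<inter> V \<inter> S)"
      using h V by (auto simp: openin_subtopology)
    show "p \<in> V' \<inter> V \<inter> S" using h V p by auto
    show "hol_at (sub_cspace S X) f q" if "q \<in> V' \<inter> V \<inter> S" for q
      unfolding hol_at_sub_cspace using that h V by blast
  qed
qed

lemma sheaf_quotient_cspace:
  assumes X: "sheaf_cspace X"
  shows "sheaf_cspace (quotient_cspace X \<pi>)"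
  unfolding sheaf_cspace_def
proof (intro conjI allI impI)
  fix W f g p
  assume W: "openin (ctop (quotient_cspace X \<pi>)) W" "p \<in> W" "\<forall>q\<in>W. f q = g q"
    and f: "hol_at (quotient_cspace X \<pi>) f p"
  obtain V where V: "openin (quotient_topology (ctop X) \<pi>) V" "p \<in> V"
    "\<And>x. x \<in> topspace (ctop X) \<Longrightarrow> \<pi> x \<in> V \<Longrightarrow> hol_at X (f \<circ> \<pi>) x"
    using f unfolding hol_at_quotient_cspace by blast
  have "hol_at X (g \<circ> \<pi>) x" if x: "x \<in> topspace (ctop X)" "\<pi> x \<in> V \<inter> W" for x
    by (rule sheaf_cspace_cong[OF X, of "{x \<in> topspace (ctop X). \<pi> x \<in> W}" _ "f \<circ> \<pi>"])
       (use W V x in \<open>auto simp: openin_quotient_topology\<close>)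
  then show "hol_at (quotient_cspace X \<pi>) g p"
    unfolding hol_at_quotient_cspace using V W by (intro exI[of _ "V \<inter> W"]) (auto simp: openin_Int)
next
  fix f p
  assume "hol_at (quotient_cspace X \<pi>) f p"
  then show "\<exists>W. openin (ctop (quotient_cspace X \<pi>)) W \<and> p \<in> W \<and>
      (\<forall>q\<in>W. hol_at (quotient_cspace X \<pi>) f q)"
    unfolding hol_at_quotient_cspace by auto
qed

lemma sheaf_proj_space: "sheaf_cspace proj_space"
  unfolding proj_space_def by (intro sheaf_quotient_cspace sheaf_sub_cspace sheaf_affine_space)

section \<open>Holomorphic maps\<close>

lemma holomorphic_map_continuous: "holomorphic_map X Y F \<Longrightarrow> continuous_map (ctop X) (ctop Y) F"
  by (simp add: holomorphic_map_def)

lemma holomorphic_map_in_topspace: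
  "holomorphic_map X Y F \<Longrightarrow> p \<in> topspace (ctop X) \<Longrightarrow> F p \<in> topspace (ctop Y)"
  by (auto simp: holomorphic_map_def continuous_map_def)

lemma holomorphic_mapD:
  "holomorphic_map X Y F \<Longrightarrow> p \<in> topspace (ctop X) \<Longrightarrow> hol_at Y f (F p) \<Longrightarrow> hol_at X (f \<circ> F) p"
  by (auto simp: holomorphic_map_def)

lemma holomorphic_map_compose:
  assumes "holomorphic_map X Y F" "holomorphic_map Y Z G"
  shows "holomorphic_map X Z (G \<circ> F)"
  unfolding holomorphic_map_def
proof (intro conjI ballI allI impI)
  show "continuous_map (ctop X) (ctop Z) (G \<circ> F)"
    using assms by (intro continuous_map_compose[of _ "ctop Y"]) (auto dest: holomorphic_map_continuous)
  fix p f assume p: "p \<in> topspace (ctop X)" and "hol_at Z f ((G \<circ> F) p)"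
  then have "hol_at Y (f \<circ> G) (F p)"
    using holomorphic_mapD[OF assms(2) holomorphic_map_in_topspace[OF assms(1) p]] by simp
  then show "hol_at X (f \<circ> (G \<circ> F)) p"
    using holomorphic_mapD[OF assms(1) p] by (simp add: o_assoc)
qed

lemma holomorphic_map_cong:
  assumes X: "sheaf_cspace X" and F: "holomorphic_map X Y F"
    and eq: "\<And>p. p \<in> topspace (ctop X) \<Longrightarrow> F p = G p"
  shows "holomorphic_map X Y G"
  unfolding holomorphic_map_def
proof (intro conjI ballI allI impI)
  show "continuous_map (ctop X) (ctop Y) G"
    using holomorphic_map_continuous[OF F] eq by (rule continuous_map_eq)
  fix p f assume p: "p \<in> topspace (ctop X)" and f: "hol_at Y f (G p)"
  show "hol_at X (f \<circ> G) p"
    by (rule sheaf_cspace_cong[OF X openin_topspace p, of "f \<circ> F"])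
       (use eq p f holomorphic_mapD[OF F p] in auto)
qed

lemma holomorphic_map_into_sub:
  assumes X: "sheaf_cspace X" and F: "holomorphic_map X Y F"
    and T: "\<And>p. p \<in> topspace (ctop X) \<Longrightarrow> F p \<in> T"
  shows "holomorphic_map X (sub_cspace T Y) F"
  unfolding holomorphic_map_def
proof (intro conjI ballI allI impI)
  show "continuous_map (ctop X) (ctop (sub_cspace T Y)) F"
    using holomorphic_map_continuous[OF F] T by (auto simp: continuous_map_in_subtopology)
  fix p f assume p: "p \<in> topspace (ctop X)" and "hol_at (sub_cspace T Y) f (F p)"
  then obtain W g where g: "openin (ctop Y) W" "F p \<in> W" "\<forall>q\<in>W \<inter> T. f q = g q" "hol_at Y g (F p)"
    unfolding hol_at_sub_cspace by blast
  show "hol_at X (f \<circ> F) p"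
    by (rule sheaf_cspace_cong[OF X, of "{x \<in> topspace (ctop X). F x \<in> W}" _ "g \<circ> F"])
       (use g T p holomorphic_mapD[OF F p g(4)] holomorphic_map_continuous[OF F] in
          \<open>auto intro: openin_continuous_map_preimage\<close>)
qed

lemma holomorphic_map_from_sub:
  assumes "holomorphic_map X Y F"
  shows "holomorphic_map (sub_cspace S X) Y F"
  unfolding holomorphic_map_def
proof (intro conjI ballI allI impI)
  show "continuous_map (ctop (sub_cspace S X)) (ctop Y) F"
    using holomorphic_map_continuous[OF assms] by (simp add: continuous_map_from_subtopology)
  fix p f assume p: "p \<in> topspace (ctop (sub_cspace S X))" and f: "hol_at Y f (F p)"
  have "hol_at X (f \<circ> F) p" using p f holomorphic_mapD[OF assms] by auto
  then show "hol_at (sub_cspace S X) (f \<circ> F) p"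
    unfolding hol_at_sub_cspace using p
    by (intro exI[of _ "topspace (ctop X)"] exI[of _ "f \<circ> F"]) auto
qed

lemma holomorphic_map_from_sub_mono:
  assumes F: "holomorphic_map (sub_cspace T X) Y F" and ST: "S \<subseteq> T"
  shows "holomorphic_map (sub_cspace S X) Y F"
  unfolding holomorphic_map_def
proof (intro conjI ballI allI impI)
  show "continuous_map (ctop (sub_cspace S X)) (ctop Y) F"
    using holomorphic_map_continuous[OF F] ST by (auto intro: continuous_map_from_subtopology_mono)
  fix p f assume p: "p \<in> topspace (ctop (sub_cspace S X))" and f: "hol_at Y f (F p)"
  have "hol_at (sub_cspace T X) (f \<circ> F) p" using p f ST holomorphic_mapD[OF F] by auto
  then show "hol_at (sub_cspace S X) (f \<circ> F) p"
    unfolding hol_at_sub_cspace using ST by blast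
qed

text \<open>A function on \<open>S \<inter> T\<close> extends locally to the ambient space, and the
  same extension serves for the nested subspace. Such nestings arise as patches of a curve.\<close>

lemma holomorphic_map_from_sub_sub:
  assumes F: "holomorphic_map (sub_cspace (S \<inter> T) X) Y F"
  shows "holomorphic_map (sub_cspace T (sub_cspace S X)) Y F"
  unfolding holomorphic_map_def
proof (intro conjI ballI allI impI)
  show "continuous_map (ctop (sub_cspace T (sub_cspace S X))) (ctop Y) F"
    using holomorphic_map_continuous[OF F] by (simp add: subtopology_subtopology)
  fix p f assume p: "p \<in> topspace (ctop (sub_cspace T (sub_cspace S X)))" and f: "hol_at Y f (F p)"
  have "hol_at (sub_cspace (S \<inter> T) X) (f \<circ> F) p" using p f holomorphic_mapD[OF F] by auto
  then obtain W g where g: "openin (ctop X) W" "p \<in> W" "\<forall>q\<in>W \<inter> (S \<inter> T). (f \<circ> F) q = g q" "hol_at X g p"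
    unfolding hol_at_sub_cspace by blast
  have "hol_at (sub_cspace S X) g p" unfolding hol_at_sub_cspace using g by blast
  then show "hol_at (sub_cspace T (sub_cspace S X)) (f \<circ> F) p"
    unfolding hol_at_sub_cspace[of T]
    by (intro exI[of _ "W \<inter> S"] exI[of _ g]) (use g p in \<open>auto simp: openin_subtopology\<close>)
qed

lemma hol_at_sub_open:
  assumes X: "sheaf_cspace X" and N: "openin (ctop X) N" "p \<in> N"
  shows "hol_at (sub_cspace N X) f p \<longleftrightarrow> hol_at X f p"
proof
  assume "hol_at (sub_cspace N X) f p"
  then obtain W g where g: "openin (ctop X) W" "p \<in> W" "\<forall>q\<in>W \<inter> N. f q = g q" "hol_at X g p"
    unfolding hol_at_sub_cspace by blast
  show "hol_at X f p"
    by (rule sheaf_cspace_cong[OF X, of "W \<inter> N" _ g]) (use g N in \<open>auto simp: openin_Int\<close>)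
next
  assume "hol_at X f p"
  then show "hol_at (sub_cspace N X) f p" unfolding hol_at_sub_cspace using N by blast
qed

lemma holomorphic_map_quotient: "holomorphic_map X (quotient_cspace X \<pi>) \<pi>"
  unfolding holomorphic_map_def
  by (auto simp: hol_at_quotient_cspace intro: quotient_imp_continuous_map quotient_map_quotient_topology)

text \<open>Holomorphy at a point of the quotient is a condition along the preimage of a whole
  neighbourhood. So \<open>f\<close> is first spread to an open \<open>W\<close> around
  \<open>F p\<close>, by the openness clause for \<open>Y\<close>, and the condition is then checked
  upstairs on the saturated set \<open>U\<close>.\<close>

lemma holomorphic_map_from_quotient:
  assumes X: "sheaf_cspace X" and Y: "sheaf_cspace Y"
    and V: "openin (quotient_topology (ctop X) \<pi>) V"
    and U: "U = {x \<in> topspace (ctop X). \<pi> x \<in> V}"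
    and F: "holomorphic_map (sub_cspace U X) Y (F \<circ> \<pi>)"
  shows "holomorphic_map (sub_cspace V (quotient_cspace X \<pi>)) Y F"
  unfolding holomorphic_map_def
proof (intro conjI ballI allI impI)
  have oU: "openin (ctop X) U" using V unfolding U by (simp add: openin_quotient_topology)
  have "quotient_map (subtopology (ctop X) U) (subtopology (quotient_topology (ctop X) \<pi>) V) \<pi>"
    by (rule quotient_map_restriction[OF quotient_map_quotient_topology]) (use U V in auto)
  from continuous_compose_quotient_map[OF this] holomorphic_map_continuous[OF F]
  show cont: "continuous_map (ctop (sub_cspace V (quotient_cspace X \<pi>))) (ctop Y) F" by simp
  fix p f assume p: "p \<in> topspace (ctop (sub_cspace V (quotient_cspace X \<pi>)))"
    and f: "hol_at Y f (F p)"
  have pV: "p \<in> V" and pq: "p \<in> topspace (quotient_topology (ctop X) \<pi>)" using p by auto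
  have "F p \<in> topspace (ctop Y)" using cont p by (auto simp: continuous_map_def)
  then obtain W where W: "openin (ctop Y) W" "F p \<in> W" "\<And>q. q \<in> W \<Longrightarrow> hol_at Y f q"
    using sheaf_cspace_open[OF Y _ f] by blast
  have "openin (subtopology (quotient_topology (ctop X) \<pi>) V)
      {x \<in> topspace (subtopology (quotient_topology (ctop X) \<pi>) V). F x \<in> W}"
    using openin_continuous_map_preimage[OF cont W(1)] by simp
  then have oV': "openin (quotient_topology (ctop X) \<pi>) {x \<in> V. F x \<in> W}" (is "openin _ ?V'")
    using V openin_trans_full[OF _ V] openin_subset[OF V]
    by (simp add: Int_absorb1)
  have hol: "hol_at (quotient_cspace X \<pi>) (f \<circ> F) p"
    unfolding hol_at_quotient_cspace
  proof (intro exI conjI ballI impI)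
    show "openin (quotient_topology (ctop X) \<pi>) ?V'" by (rule oV')
    show "p \<in> ?V'" using pV W by auto
    fix x assume x: "x \<in> topspace (ctop X)" "\<pi> x \<in> ?V'"
    then have "hol_at (sub_cspace U X) (f \<circ> (F \<circ> \<pi>)) x"
      by (intro holomorphic_mapD[OF F]) (use W U in auto)
    then show "hol_at X (f \<circ> F \<circ> \<pi>) x"
      using hol_at_sub_open[OF X oU] x U by (auto simp: o_assoc)
  qed
  show "hol_at (sub_cspace V (quotient_cspace X \<pi>)) (f \<circ> F) p"
    unfolding hol_at_sub_cspace ctop_quotient_cspace
    by (intro exI[of _ V] exI[of _ "f \<circ> F"]) (use V pV hol in auto)
qed

section \<open>Biholomorphic maps\<close>

lemma biholomorphic_imp_homeomorphic:
  assumes "biholomorphic X Y"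
  shows "ctop X homeomorphic_space ctop Y"
  using assms unfolding biholomorphic_def homeomorphic_space_def homeomorphic_maps_def holomorphic_map_def
  by blast

text \<open>The last assumption holds whenever \<^term>\<open>h\<close> has local holomorphic sections.\<close>

lemma biholomorphic_quotient:
  assumes X: "sheaf_cspace X" and Y: "sheaf_cspace Y"
    and h: "holomorphic_map X Y h" and q: "quotient_map (ctop X) (ctop Y) h"
    and fib: "\<And>p p'. p \<in> topspace (ctop X) \<Longrightarrow> p' \<in> topspace (ctop X) \<Longrightarrow> h p = h p' \<longleftrightarrow> \<pi> p = \<pi> p'"
    and desc: "\<And>f y V. openin (ctop Y) V \<Longrightarrow> y \<in> V \<Longrightarrow>
       (\<And>p. p \<in> topspace (ctop X) \<Longrightarrow> h p \<in> V \<Longrightarrow> hol_at X (f \<circ> h) p) \<Longrightarrow> hol_at Y f y"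
  shows "biholomorphic (quotient_cspace X \<pi>) Y"
proof -
  let ?T = "topspace (ctop X)"
  \<comment> \<open>Both maps choose arbitrary preimages; \<open>fib\<close> says that the result
    does not depend on the choice.\<close>
  define F where "F = h \<circ> inv_into ?T \<pi>"
  define G where "G = \<pi> \<circ> inv_into ?T h"
  have hT: "h ` ?T = topspace (ctop Y)" using q by (rule quotient_imp_surjective_map)
  have F: "F (\<pi> p) = h p" if "p \<in> ?T" for p
    using fib[of "inv_into ?T \<pi> (\<pi> p)" p] that by (simp add: F_def f_inv_into_f inv_into_into)
  have G: "G (h p) = \<pi> p" if "p \<in> ?T" for p
    using fib[of "inv_into ?T h (h p)" p] that by (simp add: G_def f_inv_into_f inv_into_into)
  have topq: "topspace (ctop (quotient_cspace X \<pi>)) = \<pi> ` ?T"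
    by (simp add: topspace_quotient_topology)
  have "holomorphic_map (sub_cspace (\<pi> ` ?T) (quotient_cspace X \<pi>)) Y F"
  proof (rule holomorphic_map_from_quotient[OF X Y])
    show "openin (quotient_topology (ctop X) \<pi>) (\<pi> ` ?T)"
      by (metis openin_topspace topspace_quotient_topology)
    show "holomorphic_map (sub_cspace ?T X) Y (F \<circ> \<pi>)"
      by (rule holomorphic_map_from_sub, rule holomorphic_map_cong[OF X h]) (simp add: F)
  qed auto
  then have holF: "holomorphic_map (quotient_cspace X \<pi>) Y F"
    unfolding holomorphic_map_def
    using hol_at_sub_open[OF sheaf_quotient_cspace[OF X], of \<pi> "\<pi> ` ?T"] topq
    by (metis ctop_sub_cspace openin_topspace subtopology_topspace)
  have "continuous_map (ctop X) (quotient_topology (ctop X) \<pi>) (G \<circ> h)"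
    using quotient_imp_continuous_map[OF quotient_map_quotient_topology]
    by (rule continuous_map_eq) (simp add: G)
  then have contG: "continuous_map (ctop Y) (quotient_topology (ctop X) \<pi>) G"
    by (rule continuous_compose_quotient_map[OF q])
  have holG: "holomorphic_map Y (quotient_cspace X \<pi>) G"
    unfolding holomorphic_map_def
  proof (intro conjI ballI allI impI)
    show "continuous_map (ctop Y) (ctop (quotient_cspace X \<pi>)) G" using contG by simp
    fix y f assume y: "y \<in> topspace (ctop Y)" and "hol_at (quotient_cspace X \<pi>) f (G y)"
    then obtain V where V: "openin (quotient_topology (ctop X) \<pi>) V" "G y \<in> V"
      "\<And>p. p \<in> ?T \<Longrightarrow> \<pi> p \<in> V \<Longrightarrow> hol_at X (f \<circ> \<pi>) p"
      unfolding hol_at_quotient_cspace by blast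
    show "hol_at Y (f \<circ> G) y"
    proof (rule desc[of "{y \<in> topspace (ctop Y). G y \<in> V}"])
      show "openin (ctop Y) {y \<in> topspace (ctop Y). G y \<in> V}"
        by (rule openin_continuous_map_preimage[OF contG V(1)])
      show "y \<in> {y \<in> topspace (ctop Y). G y \<in> V}" using y V by simp
      fix p assume p: "p \<in> ?T" "h p \<in> {y \<in> topspace (ctop Y). G y \<in> V}"
      then have "hol_at X (f \<circ> \<pi>) p" using V(3) G by auto
      then show "hol_at X (f \<circ> G \<circ> h) p"
        by (rule sheaf_cspace_cong[OF X openin_topspace p(1), rotated]) (simp add: G)
    qed
  qed
  show ?thesis
    unfolding biholomorphic_def
  proof (intro exI conjI ballI)
    show "G (F p) = p" if "p \<in> topspace (ctop (quotient_cspace X \<pi>))" for p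
      using that F G topq by auto
    show "F (G q) = q" if "q \<in> topspace (ctop Y)" for q
      using that F G hT by (metis imageE)
  qed (fact holF holG)+
qed

section \<open>Charts\<close>

definition cplx :: "complex cspace" where
  "cplx = \<lparr> ctop = euclidean, hol_at = (\<lambda>f z. f analytic_on {z}) \<rparr>"

lemma ctop_cplx [simp]: "ctop cplx = euclidean"
  by (simp add: cplx_def)

lemma hol_at_cplx [simp]: "hol_at cplx f z \<longleftrightarrow> f analytic_on {z}"
  by (simp add: cplx_def)

lemma analytic_at_transform_open:
  assumes "f analytic_on {z}" "open W" "z \<in> W" "\<And>w. w \<in> W \<Longrightarrow> f w = g w"
  shows "g analytic_on {z}"
proof -
  obtain S where S: "open S" "z \<in> S" "f holomorphic_on S" using assms(1) by (auto simp: analytic_at)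
  have "g holomorphic_on S \<inter> W"
    by (rule holomorphic_transform[of f]) (use S(3) assms(4) in \<open>auto intro: holomorphic_on_subset\<close>)
  then show ?thesis using S assms(2,3) by (auto simp: analytic_at)
qed

lemma sheaf_cplx: "sheaf_cspace cplx"
  unfolding sheaf_cspace_def
proof (intro conjI allI impI)
  fix W :: "complex set" and f g p
  assume "openin (ctop cplx) W" "p \<in> W" "\<forall>q\<in>W. f q = g q" "hol_at cplx f p"
  then show "hol_at cplx g p"
    unfolding hol_at_cplx by (auto intro: analytic_at_transform_open)
next
  fix f and p :: complex
  assume "hol_at cplx f p"
  then show "\<exists>W. openin (ctop cplx) W \<and> p \<in> W \<and> (\<forall>q\<in>W. hol_at cplx f q)"
    by (metis hol_at_cplx ctop_cplx open_openin analytic_at)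
qed

text \<open>Charts are phrased as biholomorphisms onto an open piece of \<open>cplx\<close>, so that
  they can be composed and restricted like any other biholomorphism.\<close>

definition locally_cplx :: "'a cspace \<Rightarrow> 'a \<Rightarrow> bool" where
  "locally_cplx X p \<longleftrightarrow>
     (\<exists>U D. openin (ctop X) U \<and> p \<in> U \<and> open D \<and> biholomorphic (sub_cspace U X) (sub_cspace D cplx))"

text \<open>Each direction of the equivalence in \<open>is_chart\<close> uses one of the two
  holomorphic maps. The inverse \<open>inv_into U \<phi>\<close> agrees with \<open>\<gamma>\<close>
  only on \<open>D\<close>, which is enough because analyticity at a point is local.\<close>

lemma locally_cplx_imp_chart:
  assumes X: "sheaf_cspace X" and "locally_cplx X p"
  shows "\<exists>U \<phi>. p \<in> U \<and> is_chart X U \<phi>"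
proof -
  obtain U D \<phi> \<gamma> where U: "openin (ctop X) U" "p \<in> U" and D: "open D"
    and \<phi>: "holomorphic_map (sub_cspace U X) (sub_cspace D cplx) \<phi>"
    and \<gamma>: "holomorphic_map (sub_cspace D cplx) (sub_cspace U X) \<gamma>"
    and inv: "\<forall>p\<in>topspace (ctop (sub_cspace U X)). \<gamma> (\<phi> p) = p"
      "\<forall>z\<in>topspace (ctop (sub_cspace D cplx)). \<phi> (\<gamma> z) = z"
    using assms(2) unfolding locally_cplx_def biholomorphic_def by blast
  have tU: "topspace (ctop (sub_cspace U X)) = U" using openin_subset[OF U(1)] by auto
  have tD: "topspace (ctop (sub_cspace D cplx)) = D" by simp
  have im: "\<phi> ` U = D"
    using holomorphic_map_in_topspace[OF \<phi>] holomorphic_map_in_topspace[OF \<gamma>] inv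
    unfolding tU tD by (metis image_eqI subsetI subset_antisym image_subset_iff)
  have inj: "inj_on \<phi> U" using inv(1) unfolding tU by (metis inj_onI)
  have inv_eq: "inv_into U \<phi> z = \<gamma> z" if "z \<in> D" for z
    using that im inj inv tU tD holomorphic_map_in_topspace[OF \<gamma>] by (metis inv_into_f_f)
  have hom: "homeomorphic_map (subtopology (ctop X) U) (top_of_set D) \<phi>"
    unfolding homeomorphic_map_maps homeomorphic_maps_def
    using holomorphic_map_continuous[OF \<phi>] holomorphic_map_continuous[OF \<gamma>] inv by auto
  have "hol_at X f q \<longleftrightarrow> (f \<circ> inv_into U \<phi>) analytic_on {\<phi> q}" if q: "q \<in> U" for q f
  proof -
    have \<phi>q: "\<phi> q \<in> D" using q im by auto
    have "hol_at X f q \<longleftrightarrow> hol_at (sub_cspace U X) f q" using hol_at_sub_open[OF X U(1) q] by simp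
    also have "\<dots> \<longleftrightarrow> hol_at (sub_cspace D cplx) (f \<circ> \<gamma>) (\<phi> q)"
    proof
      assume "hol_at (sub_cspace U X) f q"
      then show "hol_at (sub_cspace D cplx) (f \<circ> \<gamma>) (\<phi> q)"
        using holomorphic_mapD[OF \<gamma>, of "\<phi> q"] \<phi>q inv q unfolding tU tD by auto
    next
      assume "hol_at (sub_cspace D cplx) (f \<circ> \<gamma>) (\<phi> q)"
      then have "hol_at (sub_cspace U X) (f \<circ> \<gamma> \<circ> \<phi>) q"
        using holomorphic_mapD[OF \<phi>, of q] q unfolding tU by auto
      then show "hol_at (sub_cspace U X) f q"
        by (rule sheaf_cspace_cong[OF sheaf_sub_cspace[OF X] openin_topspace, rotated -1])
           (use q inv tU in auto)
    qed
    also have "\<dots> \<longleftrightarrow> hol_at cplx (f \<circ> \<gamma>) (\<phi> q)"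
      by (rule hol_at_sub_open[OF sheaf_cplx]) (use D \<phi>q in auto)
    also have "\<dots> \<longleftrightarrow> (f \<circ> inv_into U \<phi>) analytic_on {\<phi> q}"
      unfolding hol_at_cplx
      using analytic_at_transform_open[OF _ D \<phi>q, of "f \<circ> \<gamma>" "f \<circ> inv_into U \<phi>"]
        analytic_at_transform_open[OF _ D \<phi>q, of "f \<circ> inv_into U \<phi>" "f \<circ> \<gamma>"] inv_eq
      by auto
    finally show ?thesis .
  qed
  then have "is_chart X U \<phi>"
    unfolding is_chart_def im using U D hom by auto
  then show ?thesis using U by blast
qed

section \<open>Transport of charts and of compactness along biholomorphisms\<close>

lemma biholomorphic_trans:
  assumes "biholomorphic X Y" "biholomorphic Y Z"
  shows "biholomorphic X Z"
proof -
  obtain F G where 1: "holomorphic_map X Y F" "holomorphic_map Y X G"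
    "\<forall>p\<in>topspace (ctop X). G (F p) = p" "\<forall>q\<in>topspace (ctop Y). F (G q) = q"
    using assms(1) unfolding biholomorphic_def by blast
  obtain F' G' where 2: "holomorphic_map Y Z F'" "holomorphic_map Z Y G'"
    "\<forall>p\<in>topspace (ctop Y). G' (F' p) = p" "\<forall>q\<in>topspace (ctop Z). F' (G' q) = q"
    using assms(2) unfolding biholomorphic_def by blast
  show ?thesis
    unfolding biholomorphic_def
  proof (intro exI conjI)
    show "holomorphic_map X Z (F' \<circ> F)" by (rule holomorphic_map_compose[OF 1(1) 2(1)])
    show "holomorphic_map Z X (G \<circ> G')" by (rule holomorphic_map_compose[OF 2(2) 1(2)])
  qed (use 1 2 holomorphic_map_in_topspace[OF 1(1)] holomorphic_map_in_topspace[OF 2(2)] in auto)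
qed

lemma biholomorphic_restrict:
  assumes X: "sheaf_cspace X" and Y: "sheaf_cspace Y"
    and F: "holomorphic_map X Y F" and G: "holomorphic_map Y X G"
    and inv: "\<forall>p\<in>topspace (ctop X). G (F p) = p" "\<forall>q\<in>topspace (ctop Y). F (G q) = q"
    and V: "V \<subseteq> topspace (ctop Y)"
  shows "biholomorphic (sub_cspace {p \<in> topspace (ctop X). F p \<in> V} X) (sub_cspace V Y)"
  unfolding biholomorphic_def
proof (intro exI conjI ballI)
  show "holomorphic_map (sub_cspace {p \<in> topspace (ctop X). F p \<in> V} X) (sub_cspace V Y) F"
    by (rule holomorphic_map_into_sub[OF sheaf_sub_cspace[OF X] holomorphic_map_from_sub[OF F]]) auto
  show "holomorphic_map (sub_cspace V Y) (sub_cspace {p \<in> topspace (ctop X). F p \<in> V} X) G"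
    by (rule holomorphic_map_into_sub[OF sheaf_sub_cspace[OF Y] holomorphic_map_from_sub[OF G]])
       (use inv holomorphic_map_in_topspace[OF G] in auto)
qed (use inv in auto)

lemma locally_cplx_biholomorphic:
  assumes X: "sheaf_cspace X" and Y: "sheaf_cspace Y"
    and F: "holomorphic_map X Y F" and G: "holomorphic_map Y X G"
    and inv: "\<forall>p\<in>topspace (ctop X). G (F p) = p" "\<forall>q\<in>topspace (ctop Y). F (G q) = q"
    and p: "p \<in> topspace (ctop X)" and lc: "locally_cplx Y (F p)"
  shows "locally_cplx X p"
proof -
  obtain V D where V: "openin (ctop Y) V" "F p \<in> V" "open D"
    "biholomorphic (sub_cspace V Y) (sub_cspace D cplx)"
    using lc unfolding locally_cplx_def by blast
  have "biholomorphic (sub_cspace {p \<in> topspace (ctop X). F p \<in> V} X) (sub_cspace V Y)"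
    by (rule biholomorphic_restrict[OF X Y F G inv openin_subset[OF V(1)]])
  from biholomorphic_trans[OF this V(4)] show ?thesis
    unfolding locally_cplx_def
    using V p openin_continuous_map_preimage[OF holomorphic_map_continuous[OF F] V(1)]
    by (intro exI[of _ "{p \<in> topspace (ctop X). F p \<in> V}"]) auto
qed

lemma biholomorphic_sub_sub:
  assumes X: "sheaf_cspace X" and UN: "U \<subseteq> N"
  shows "biholomorphic (sub_cspace U X) (sub_cspace U (sub_cspace N X))"
  unfolding biholomorphic_def
proof (intro exI conjI ballI)
  have id: "holomorphic_map X X id" by (simp add: holomorphic_map_def)
  show "holomorphic_map (sub_cspace U X) (sub_cspace U (sub_cspace N X)) id"
    by (intro holomorphic_map_into_sub sheaf_sub_cspace X holomorphic_map_from_sub id) (use UN in auto)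
  show "holomorphic_map (sub_cspace U (sub_cspace N X)) (sub_cspace U X) id"
    by (intro holomorphic_map_into_sub sheaf_sub_cspace X holomorphic_map_from_sub id) auto
qed auto

lemma locally_cplx_open_sub:
  assumes X: "sheaf_cspace X" and N: "openin (ctop X) N" and lc: "locally_cplx (sub_cspace N X) p"
  shows "locally_cplx X p"
proof -
  obtain U D where U: "openin (ctop (sub_cspace N X)) U" "p \<in> U" "open D"
    "biholomorphic (sub_cspace U (sub_cspace N X)) (sub_cspace D cplx)"
    using lc unfolding locally_cplx_def by blast
  have "openin (ctop X) U" "U \<subseteq> N"
    using U(1) N openin_trans_full openin_subset[OF U(1)] by (auto simp: )
  then show ?thesis
    unfolding locally_cplx_def using U biholomorphic_trans[OF biholomorphic_sub_sub[OF X] U(4)] by blast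
qed

text \<open>Quotient topologies need not be Hausdorff or second countable, so for an orbit space
  these properties are read off a homeomorphic model, together with its charts.\<close>

lemma compact_riemann_surface_biholomorphic:
  assumes X: "sheaf_cspace X" and Y: "sheaf_cspace Y" and bi: "biholomorphic X Y"
    and Yc: "compact_space (ctop Y)" "connected_space (ctop Y)" "Hausdorff_space (ctop Y)"
      "second_countable (ctop Y)" "topspace (ctop Y) \<noteq> {}"
    and lc: "\<And>q. q \<in> topspace (ctop Y) \<Longrightarrow> locally_cplx Y q"
  shows "compact_riemann_surface X"
proof -
  note hom = biholomorphic_imp_homeomorphic[OF bi]
  obtain F G where F: "holomorphic_map X Y F" and G: "holomorphic_map Y X G"
    and inv: "\<forall>p\<in>topspace (ctop X). G (F p) = p" "\<forall>q\<in>topspace (ctop Y). F (G q) = q"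
    using bi unfolding biholomorphic_def by blast
  have "\<exists>U \<phi>. p \<in> U \<and> is_chart X U \<phi>" if "p \<in> topspace (ctop X)" for p
    using that lc holomorphic_map_in_topspace[OF F that]
    by (intro locally_cplx_imp_chart[OF X] locally_cplx_biholomorphic[OF X Y F G inv]) auto
  moreover have "topspace (ctop X) \<noteq> {}"
    using Yc(5) holomorphic_map_in_topspace[OF G] by blast
  ultimately show ?thesis
    unfolding compact_riemann_surface_def riemann_surface_def
    using homeomorphic_compact_space[OF hom] homeomorphic_connected_space[OF hom]
      homeomorphic_Hausdorff_space[OF hom] homeomorphic_space_second_countability[OF hom] Yc by blast
qed

lemma biholomorphic_refl: "biholomorphic X X"
  unfolding biholomorphic_def by (intro exI[of _ id]) (simp add: holomorphic_map_def)

section \<open>Holomorphic functions on affine space\<close>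

text \<open>Complex differentiability at a single point, without the neighbourhood that
  \<open>hol_at\<close> adds, so that the usual differentiation rules can be stated
  pointwise.\<close>

definition cdiff :: "(complex ^ 'n::finite \<Rightarrow> complex) \<Rightarrow> complex ^ 'n \<Rightarrow> bool" where
  "cdiff f x \<longleftrightarrow> (\<exists>D. (f has_derivative D) (at x) \<and> (\<forall>c v. D (c *s v) = c * D v))"

lemma hol_at_affine_space:
  "hol_at affine_space f x \<longleftrightarrow> (\<exists>U. open U \<and> x \<in> U \<and> (\<forall>y\<in>U. cdiff f y))"
  by (simp add: affine_space_def cdiff_def)

lemma cdiff_const: "cdiff (\<lambda>x. c) x"
  unfolding cdiff_def by (intro exI[of _ "\<lambda>h. 0"]) auto

lemma cdiff_nth: "cdiff (\<lambda>x. x $ i) x"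
  unfolding cdiff_def
  by (intro exI[of _ "\<lambda>h. h $ i"]) (auto intro: bounded_linear_imp_has_derivative bounded_linear_vec_nth)

lemma cdiff_chain:
  assumes "cdiff f x" "(g has_field_derivative d) (at (f x))"
  shows "cdiff (\<lambda>x. g (f x)) x"
proof -
  obtain D where D: "(f has_derivative D) (at x)" "\<forall>c v. D (c *s v) = c * D v"
    using assms(1) unfolding cdiff_def by blast
  have "((\<lambda>x. g (f x)) has_derivative (\<lambda>h. d * D h)) (at x)"
    using has_derivative_compose[OF D(1)] assms(2) unfolding has_field_derivative_def by blast
  then show ?thesis
    unfolding cdiff_def using D(2) by (intro exI[of _ "\<lambda>h. d * D h"]) auto
qed

lemma cdiff_add:
  assumes "cdiff f x" "cdiff g x"
  shows "cdiff (\<lambda>x. f x + g x) x"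
proof -
  obtain D E where "(f has_derivative D) (at x)" "\<forall>c v. D (c *s v) = c * D v"
    "(g has_derivative E) (at x)" "\<forall>c v. E (c *s v) = c * E v"
    using assms unfolding cdiff_def by blast
  then show ?thesis
    unfolding cdiff_def
    by (intro exI[of _ "\<lambda>h. D h + E h"]) (auto intro!: derivative_intros simp: algebra_simps)
qed

lemma cdiff_mult:
  assumes "cdiff f x" "cdiff g x"
  shows "cdiff (\<lambda>x. f x * g x) x"
proof -
  obtain D E where "(f has_derivative D) (at x)" "\<forall>c v. D (c *s v) = c * D v"
    "(g has_derivative E) (at x)" "\<forall>c v. E (c *s v) = c * E v"
    using assms unfolding cdiff_def by blast
  then show ?thesis
    unfolding cdiff_def
    by (intro exI[of _ "\<lambda>h. f x * E h + D h * g x"] conjI has_derivative_mult)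
       (auto simp: algebra_simps)
qed

lemma cdiff_minus: "cdiff f x \<Longrightarrow> cdiff (\<lambda>x. - f x) x"
  using cdiff_mult[OF cdiff_const[of "-1"]] by simp

lemma cdiff_diff: "cdiff f x \<Longrightarrow> cdiff g x \<Longrightarrow> cdiff (\<lambda>x. f x - g x) x"
  using cdiff_add[OF _ cdiff_minus, of f x g] by simp

lemma cdiff_power: "cdiff f x \<Longrightarrow> cdiff (\<lambda>x. f x ^ n) x"
  by (induction n) (auto intro: cdiff_const cdiff_mult)

lemma cdiff_divide:
  assumes "cdiff f x" "cdiff g x" "g x \<noteq> 0"
  shows "cdiff (\<lambda>x. f x / g x) x"
proof -
  have "cdiff (\<lambda>x. inverse (g x)) x"
    by (rule cdiff_chain[OF assms(2)]) (rule DERIV_inverse[OF assms(3)])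
  from cdiff_mult[OF assms(1) this] show ?thesis by (simp add: divide_inverse)
qed

lemmas cdiff_intros = cdiff_const cdiff_nth cdiff_add cdiff_mult cdiff_minus cdiff_diff cdiff_power
  cdiff_divide

lemma has_derivative_vec_componentwise:
  fixes \<Phi> :: "'a::real_normed_vector \<Rightarrow> complex ^ 'm::finite"
  assumes "\<And>i. ((\<lambda>x. \<Phi> x $ i) has_derivative D i) (at x)"
  shows "(\<Phi> has_derivative (\<lambda>h. \<chi> i. D i h)) (at x)"
proof (subst has_derivative_componentwise_within, intro ballI)
  fix b :: "complex ^ 'm" assume "b \<in> Basis"
  then obtain i c where b: "b = axis i c" by (auto simp: Basis_vec_def)
  show "((\<lambda>x. \<Phi> x \<bullet> b) has_derivative (\<lambda>h. (\<chi> i. D i h) \<bullet> b)) (at x)"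
    unfolding b inner_axis by (auto intro!: assms has_derivative_inner_left)
qed

lemma cdiff_compose:
  fixes \<Phi> :: "complex ^ 'n::finite \<Rightarrow> complex ^ 'm::finite"
  assumes f: "cdiff f (\<Phi> x)" and \<Phi>: "\<And>i. cdiff (\<lambda>x. \<Phi> x $ i) x"
  shows "cdiff (f \<circ> \<Phi>) x"
proof -
  obtain E where E: "(f has_derivative E) (at (\<Phi> x))" "\<forall>c v. E (c *s v) = c * E v"
    using f unfolding cdiff_def by blast
  have "\<forall>i. \<exists>D. ((\<lambda>x. \<Phi> x $ i) has_derivative D) (at x) \<and> (\<forall>c v. D (c *s v) = c * D v)"
    using \<Phi> unfolding cdiff_def by blast
  then obtain D where D: "\<And>i. ((\<lambda>x. \<Phi> x $ i) has_derivative D i) (at x)"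
    "\<And>i c v. D i (c *s v) = c * D i v" by metis
  have "((\<lambda>x. f (\<Phi> x)) has_derivative (\<lambda>h. E (\<chi> i. D i h))) (at x)"
    by (rule has_derivative_compose[OF has_derivative_vec_componentwise[OF D(1)] E(1)])
  moreover have "E (\<chi> i. D i (c *s v)) = c * E (\<chi> i. D i v)" for c v
  proof -
    have "(\<chi> i. D i (c *s v)) = c *s (\<chi> i. D i v)" by (simp add: vec_eq_iff D(2))
    then show ?thesis using E(2) by simp
  qed
  ultimately show ?thesis unfolding cdiff_def o_def by blast
qed

lemma isCont_componentwise:
  fixes \<Phi> :: "'a::t2_space \<Rightarrow> complex ^ 'm::finite"
  assumes "\<And>i. isCont (\<lambda>x. \<Phi> x $ i) x"
  shows "isCont \<Phi> x"
  using assms unfolding isCont_def by (intro vec_tendstoI) auto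

lemma cdiff_isCont: "cdiff f x \<Longrightarrow> isCont f x"
  unfolding cdiff_def by (auto dest: has_derivative_continuous)

lemma holomorphic_map_affine:
  fixes \<Phi> :: "complex ^ 'n::finite \<Rightarrow> complex ^ 'm::finite"
  assumes N: "open N" and \<Phi>: "\<And>x i. x \<in> N \<Longrightarrow> cdiff (\<lambda>x. \<Phi> x $ i) x"
  shows "holomorphic_map (sub_cspace N affine_space) affine_space \<Phi>"
  unfolding holomorphic_map_def
proof (intro conjI ballI allI impI)
  have cont: "continuous_on N \<Phi>"
    using \<Phi> by (intro continuous_at_imp_continuous_on ballI isCont_componentwise cdiff_isCont)
  then show "continuous_map (ctop (sub_cspace N affine_space)) (ctop affine_space) \<Phi>" by simp
  fix p f assume p: "p \<in> topspace (ctop (sub_cspace N affine_space))"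
    and "hol_at affine_space f (\<Phi> p)"
  then obtain U where U: "open U" "\<Phi> p \<in> U" "\<And>y. y \<in> U \<Longrightarrow> cdiff f y"
    unfolding hol_at_affine_space by blast
  have "open (\<Phi> -` U \<inter> N)" using continuous_on_open_vimage[OF N] cont U(1) by blast
  then have "hol_at affine_space (f \<circ> \<Phi>) p"
    unfolding hol_at_affine_space using p U \<Phi> by (intro exI[of _ "\<Phi> -` U \<inter> N"]) (auto intro: cdiff_compose)
  then show "hol_at (sub_cspace N affine_space) (f \<circ> \<Phi>) p"
    using hol_at_sub_open[OF sheaf_affine_space, of N p] N p by auto
qed

lemma holomorphic_map_to_cplx:
  fixes \<phi> :: "complex ^ 'n::finite \<Rightarrow> complex"
  assumes N: "open N" and \<phi>: "\<And>x. x \<in> N \<Longrightarrow> cdiff \<phi> x"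
  shows "holomorphic_map (sub_cspace N affine_space) cplx \<phi>"
  unfolding holomorphic_map_def
proof (intro conjI ballI allI impI)
  have cont: "continuous_on N \<phi>"
    using \<phi> by (intro continuous_at_imp_continuous_on ballI cdiff_isCont)
  then show "continuous_map (ctop (sub_cspace N affine_space)) (ctop cplx) \<phi>" by simp
  fix p f assume p: "p \<in> topspace (ctop (sub_cspace N affine_space))" and "hol_at cplx f (\<phi> p)"
  then obtain U where U: "open U" "\<phi> p \<in> U" "f holomorphic_on U"
    by (auto simp: analytic_at)
  have "open (\<phi> -` U \<inter> N)" using continuous_on_open_vimage[OF N] cont U(1) by blast
  moreover have "cdiff (f \<circ> \<phi>) x" if "x \<in> \<phi> -` U \<inter> N" for x
    using cdiff_chain[OF \<phi>] that U holomorphic_derivI[OF U(3,1)] by (fastforce simp: o_def)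
  ultimately have "hol_at affine_space (f \<circ> \<phi>) p"
    unfolding hol_at_affine_space using p U by (intro exI[of _ "\<phi> -` U \<inter> N"]) auto
  then show "hol_at (sub_cspace N affine_space) (f \<circ> \<phi>) p"
    using hol_at_sub_open[OF sheaf_affine_space, of N p] N p by auto
qed

lemma holomorphic_map_from_cplx:
  fixes \<gamma> :: "complex \<Rightarrow> complex ^ 'n::finite"
  assumes D: "open D" and \<gamma>: "\<And>i. (\<lambda>z. \<gamma> z $ i) holomorphic_on D"
  shows "holomorphic_map (sub_cspace D cplx) affine_space \<gamma>"
  unfolding holomorphic_map_def
proof (intro conjI ballI allI impI)
  have comp: "((\<lambda>z. \<gamma> z $ i) has_field_derivative deriv (\<lambda>z. \<gamma> z $ i) z) (at z)" if "z \<in> D" for z i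
    using holomorphic_derivI[OF \<gamma> D that] by simp
  have "isCont \<gamma> z" if "z \<in> D" for z
    by (intro isCont_componentwise DERIV_isCont[OF comp[OF that]])
  then have cont: "continuous_on D \<gamma>" by (simp add: continuous_at_imp_continuous_on)
  then show "continuous_map (ctop (sub_cspace D cplx)) (ctop affine_space) \<gamma>" by simp
  fix p f assume p: "p \<in> topspace (ctop (sub_cspace D cplx))" and "hol_at affine_space f (\<gamma> p)"
  then obtain U where U: "open U" "\<gamma> p \<in> U" "\<And>y. y \<in> U \<Longrightarrow> cdiff f y"
    unfolding hol_at_affine_space by blast
  have oV: "open (\<gamma> -` U \<inter> D)" using continuous_on_open_vimage[OF D] cont U(1) by blast
  have "(f \<circ> \<gamma>) field_differentiable at z" if z: "z \<in> \<gamma> -` U \<inter> D" for z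
  proof -
    obtain E where E: "(f has_derivative E) (at (\<gamma> z))" "\<forall>c v. E (c *s v) = c * E v"
      using U(3) z unfolding cdiff_def by blast
    \<comment> \<open>The velocity vector of \<open>\<gamma>\<close>. Complex linearity of
      \<open>E\<close> turns \<open>E (h *s ?d)\<close> into \<open>E ?d * h\<close>, so the real
      derivative is a complex one.\<close>
    let ?d = "\<chi> i. deriv (\<lambda>z. \<gamma> z $ i) z"
    have "(\<gamma> has_derivative (\<lambda>h. \<chi> i. deriv (\<lambda>z. \<gamma> z $ i) z * h)) (at z)"
      by (rule has_derivative_vec_componentwise)
         (use comp z in \<open>auto simp: has_field_derivative_def\<close>)
    moreover have "(\<lambda>h. \<chi> i. deriv (\<lambda>z. \<gamma> z $ i) z * h) = (\<lambda>h. h *s ?d)"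
      by (simp add: vec_eq_iff fun_eq_iff)
    ultimately have "(\<gamma> has_derivative (\<lambda>h. h *s ?d)) (at z)" by simp
    from has_derivative_compose[OF this E(1)]
    have "((f \<circ> \<gamma>) has_derivative (\<lambda>h. E ?d * h)) (at z)" using E(2) by (simp add: o_def mult.commute)
    then show ?thesis unfolding field_differentiable_def has_field_derivative_def by blast
  qed
  then have "(f \<circ> \<gamma>) holomorphic_on (\<gamma> -` U \<inter> D)"
    by (meson field_differentiable_at_within holomorphic_on_def)
  then have "hol_at cplx (f \<circ> \<gamma>) p"
    using oV p U by (auto simp: analytic_at)
  then show "hol_at (sub_cspace D cplx) (f \<circ> \<gamma>) p"
    using hol_at_sub_open[OF sheaf_cplx, of D p] D p by auto
qed

section \<open>Projective space\<close>

lemma proj_pt_self [simp]: "x \<in> proj_pt x"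
  unfolding proj_pt_def by (auto intro: exI[of _ 1])

lemma proj_pt_eq_iff: "proj_pt x = proj_pt y \<longleftrightarrow> (\<exists>c. c \<noteq> 0 \<and> x = c *s y)"
proof
  assume "proj_pt x = proj_pt y"
  then have "x \<in> proj_pt y" using proj_pt_self by metis
  then show "\<exists>c. c \<noteq> 0 \<and> x = c *s y" unfolding proj_pt_def by auto
next
  assume "\<exists>c. c \<noteq> 0 \<and> x = c *s y"
  then obtain c where c: "c \<noteq> 0" "x = c *s y" by blast
  have "\<exists>e. d *s y = e *s x \<and> e \<noteq> 0" if "d \<noteq> 0" for d
    using that c by (intro exI[of _ "d / c"]) (auto simp: vector_smult_assoc)
  moreover have "\<exists>e. d *s x = e *s y \<and> e \<noteq> 0" if "d \<noteq> 0" for d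
    using that c by (intro exI[of _ "d * c"]) (auto simp: vector_smult_assoc)
  ultimately show "proj_pt x = proj_pt y" unfolding proj_pt_def by blast
qed

lemma proj_pt_scale: "c \<noteq> 0 \<Longrightarrow> proj_pt (c *s x) = proj_pt x"
  using proj_pt_eq_iff by blast

text \<open>Points of projective space are sets of vectors, so a function on them is evaluated at an
  arbitrary representative. The value is meaningful when \<open>h\<close> is invariant under nonzero
  scaling.\<close>

definition on_rep :: "(complex ^ 'n::finite \<Rightarrow> 'b) \<Rightarrow> (complex ^ 'n) set \<Rightarrow> 'b" where
  "on_rep h L = h (SOME v. v \<in> L)"

lemma on_rep_proj_pt:
  assumes "\<And>c. c \<noteq> 0 \<Longrightarrow> h (c *s v) = h v"
  shows "on_rep h (proj_pt v) = h v"
proof -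
  have "(SOME w. w \<in> proj_pt v) \<in> proj_pt v" by (rule someI[of _ v]) simp
  then show ?thesis unfolding on_rep_def using assms by (auto simp: proj_pt_def)
qed

text \<open>These are the saturated sets for \<open>proj_pt\<close>: each is the full preimage,
  among nonzero vectors, of its image, as descent to projective space demands.\<close>

definition punctured_cone :: "(complex ^ 'n::finite) set \<Rightarrow> bool" where
  "punctured_cone N \<longleftrightarrow> 0 \<notin> N \<and> (\<forall>x\<in>N. \<forall>c. c \<noteq> 0 \<longrightarrow> c *s x \<in> N)"

lemma proj_pt_in_image_cone: "punctured_cone N \<Longrightarrow> proj_pt x \<in> proj_pt ` N \<longleftrightarrow> x \<in> N"
  by (auto simp: proj_pt_eq_iff punctured_cone_def)

lemma topspace_proj_space: "topspace (ctop proj_space) = proj_pt ` (- {0})"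
  by (simp add: proj_space_def topspace_quotient_topology)

lemma holomorphic_map_proj_pt: "holomorphic_map (sub_cspace (- {0}) affine_space) proj_space proj_pt"
  unfolding proj_space_def by (rule holomorphic_map_quotient)

lemma quotient_map_proj_pt: "quotient_map (top_of_set (- {0})) (ctop proj_space) proj_pt"
  using quotient_map_quotient_topology[of "top_of_set (- {0})" proj_pt] by (simp add: proj_space_def)

lemma continuous_map_proj_pt: "continuous_map (top_of_set (- {0})) (ctop proj_space) proj_pt"
  by (rule quotient_imp_continuous_map[OF quotient_map_proj_pt])

lemma openin_proj_space:
  "openin (ctop proj_space) V \<longleftrightarrow> V \<subseteq> proj_pt ` (- {0}) \<and> open {x. x \<noteq> 0 \<and> proj_pt x \<in> V}"
proof -
  have "open (- {0 :: complex ^ 'a})" by auto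
  then have "openin (top_of_set (- {0})) {x. x \<noteq> 0 \<and> proj_pt x \<in> V} \<longleftrightarrow> open {x. x \<noteq> 0 \<and> proj_pt x \<in> V}"
    by (subst openin_open_eq) auto
  then show ?thesis
    by (simp add: proj_space_def openin_quotient_topology)
qed

text \<open>The saturation of \<open>U\<close> is the union of its rescalings, each the preimage of
  \<open>U\<close> under a continuous multiplication. So \<open>proj_pt\<close> is an open
  map.\<close>

lemma openin_proj_image:
  assumes "open U" "0 \<notin> U"
  shows "openin (ctop proj_space) (proj_pt ` U)"
proof -
  have "{x. x \<noteq> 0 \<and> proj_pt x \<in> proj_pt ` U} = (\<Union>c\<in>-{0}. (\<lambda>x. c *s x) -` U)"
  proof (intro subset_antisym subsetI)
    fix x assume "x \<in> {x. x \<noteq> 0 \<and> proj_pt x \<in> proj_pt ` U}"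
    then obtain u c where "u \<in> U" "c \<noteq> 0" "x = c *s u" by (auto simp: proj_pt_eq_iff)
    then have "inverse c \<in> - {0}" "inverse c *s x \<in> U" by (auto simp: vector_smult_assoc)
    then show "x \<in> (\<Union>c\<in>-{0}. (\<lambda>x. c *s x) -` U)" by blast
  next
    fix x assume "x \<in> (\<Union>c\<in>-{0}. (\<lambda>x. c *s x) -` U)"
    then obtain c where c: "c \<noteq> 0" "c *s x \<in> U" by auto
    then have "x \<noteq> 0" using assms(2) by (metis vector_smult_rzero)
    moreover have "proj_pt x \<in> proj_pt ` U" using c proj_pt_scale[OF c(1), of x] by (metis imageI)
    ultimately show "x \<in> {x. x \<noteq> 0 \<and> proj_pt x \<in> proj_pt ` U}" by simp
  qed
  moreover have "open ((\<lambda>x. c *s x) -` U)" for c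
    using assms(1) by (intro open_vimage) (auto simp: vector_scalar_mult_def intro!: continuous_intros)
  ultimately show ?thesis unfolding openin_proj_space using assms(2) by auto
qed

lemma second_countable_euclidean: "second_countable (euclidean :: 'a::second_countable_topology topology)"
proof -
  obtain \<B> :: "'a set set" where B: "countable \<B>" "\<And>C. C \<in> \<B> \<Longrightarrow> open C"
    "\<And>S. open S \<Longrightarrow> \<exists>U. U \<subseteq> \<B> \<and> S = \<Union>U" by (rule univ_second_countable) blast
  have "\<exists>V\<in>\<B>. x \<in> V \<and> V \<subseteq> U" if "open U" "x \<in> U" for U x
    using B(3)[OF that(1)] that(2) by blast
  then show ?thesis unfolding second_countable_def using B by (intro exI[of _ \<B>]) auto
qed

text \<open>Openness of \<open>proj_pt\<close> matters here: second countability passes to open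
  continuous images, but not to arbitrary quotients.\<close>

lemma second_countable_proj_space: "second_countable (ctop proj_space)"
proof (rule second_countable_open_map_image)
  show "second_countable (top_of_set (- {0 :: complex ^ 'a}))"
    by (intro second_countable_subtopology second_countable_euclidean)
  have "open (- {0 :: complex ^ 'a})" by auto
  then show "open_map (top_of_set (- {0 :: complex ^ 'a})) (ctop proj_space) proj_pt"
    unfolding open_map_def by (auto simp: openin_open_eq intro!: openin_proj_image)
qed (auto simp: continuous_map_proj_pt topspace_proj_space)

text \<open>The function \<open>m\<close> measures by 2 x 2 minors how far \<open>x\<close> is from
  the line through \<open>w\<close>; dividing by the norm \<open>n\<close> makes it invariant under
  scaling. It vanishes at \<open>M\<close> and is positive at \<open>L\<close>, so a threshold
  halfway separates them.\<close>

lemma Hausdorff_proj_space: "Hausdorff_space (ctop (proj_space :: (complex ^ 'n::finite) set cspace))"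
  unfolding Hausdorff_space_def
proof (intro allI impI)
  fix L M :: "(complex ^ 'n) set"
  assume LM: "L \<in> topspace (ctop proj_space) \<and> M \<in> topspace (ctop proj_space) \<and> L \<noteq> M"
  then obtain v w where v: "v \<noteq> 0" "L = proj_pt v" and w: "w \<noteq> 0" "M = proj_pt w"
    by (auto simp: topspace_proj_space)
  define n where "n x = (\<Sum>i\<in>UNIV. cmod (x $ i))" for x :: "complex ^ 'n"
  define m where "m x = (\<Sum>i\<in>UNIV. \<Sum>j\<in>UNIV. cmod (x $ i * w $ j - x $ j * w $ i)) / n x" for x
  have n: "n x > 0" if "x \<noteq> 0" for x
  proof -
    obtain i where "x $ i \<noteq> 0" using \<open>x \<noteq> 0\<close> by (auto simp: vec_eq_iff)
    then show ?thesis unfolding n_def by (intro sum_pos2[of _ i]) auto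
  qed
  have scale: "m (c *s x) = m x" if "c \<noteq> 0" for c x
  proof -
    have "n (c *s x) = cmod c * n x" by (simp add: n_def norm_mult sum_distrib_left)
    moreover have "cmod ((c *s x) $ i * w $ j - (c *s x) $ j * w $ i)
        = cmod c * cmod (x $ i * w $ j - x $ j * w $ i)" for i j
      by (simp add: norm_mult[symmetric] algebra_simps)
    ultimately show ?thesis using that by (simp add: m_def sum_distrib_left[symmetric])
  qed
  have mw: "m w = 0" by (simp add: m_def mult.commute)
  have mv: "m v > 0"
  proof (rule ccontr)
    assume "\<not> m v > 0"
    moreover have "m v \<ge> 0" using n[OF v(1)] by (simp add: m_def sum_nonneg)
    ultimately have "(\<Sum>i\<in>UNIV. \<Sum>j\<in>UNIV. cmod (v $ i * w $ j - v $ j * w $ i)) = 0"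
      using n[OF v(1)] by (simp add: m_def)
    then have eq: "v $ i * w $ j = v $ j * w $ i" for i j
      by (simp add: sum_nonneg_eq_0_iff sum_nonneg)
    obtain k where k: "w $ k \<noteq> 0" using w by (auto simp: vec_eq_iff)
    have vw: "v = (v $ k / w $ k) *s w" using eq[of _ k] k by (simp add: vec_eq_iff field_simps)
    then have "v $ k / w $ k \<noteq> 0" using v(1) by (metis vector_smult_lzero)
    then have "L = M" unfolding v w proj_pt_eq_iff using vw by blast
    then show False using LM by blast
  qed
  have "continuous_on (- {0}) m"
    unfolding m_def n_def
    by (intro continuous_intros) (use n in \<open>force simp: n_def\<close>)
  then have "continuous_map (top_of_set (- {0})) euclideanreal m" by simp
  then have "continuous_map (top_of_set (- {0})) euclideanreal (on_rep m \<circ> proj_pt)"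
    by (rule continuous_map_eq) (simp add: on_rep_proj_pt scale)
  then have cont: "continuous_map (ctop proj_space) euclideanreal (on_rep m)"
    by (rule continuous_compose_quotient_map[OF quotient_map_proj_pt])
  have val: "on_rep m L = m v" "on_rep m M = 0" by (simp_all add: v w on_rep_proj_pt scale mw)
  show "\<exists>U V. openin (ctop proj_space) U \<and> openin (ctop proj_space) V \<and> L \<in> U \<and> M \<in> V \<and> disjnt U V"
  proof (intro exI conjI)
    show "openin (ctop proj_space) {x \<in> topspace (ctop proj_space). on_rep m x \<in> {m v / 2<..}}"
      by (rule openin_continuous_map_preimage[OF cont]) (simp add: open_openin[symmetric])
    show "openin (ctop proj_space) {x \<in> topspace (ctop proj_space). on_rep m x \<in> {..<m v / 2}}"
      by (rule openin_continuous_map_preimage[OF cont]) (simp add: open_openin[symmetric])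
  qed (use LM val mv in \<open>auto simp: disjnt_def\<close>)
qed

lemma holomorphic_map_from_proj:
  assumes Y: "sheaf_cspace Y" and N: "open N" "punctured_cone N"
    and F: "holomorphic_map (sub_cspace N affine_space) Y (F \<circ> proj_pt)"
  shows "holomorphic_map (sub_cspace (proj_pt ` N) proj_space) Y F"
  unfolding proj_space_def
proof (rule holomorphic_map_from_quotient[OF sheaf_sub_cspace[OF sheaf_affine_space] Y])
  have N0: "0 \<notin> N" using N by (simp add: punctured_cone_def)
  show "openin (quotient_topology (ctop (sub_cspace (- {0}) affine_space)) proj_pt) (proj_pt ` N)"
    using openin_proj_image[OF N(1) N0] by (simp add: proj_space_def)
  show "N = {x \<in> topspace (ctop (sub_cspace (- {0}) affine_space)). proj_pt x \<in> proj_pt ` N}"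
    using N0 proj_pt_in_image_cone[OF N(2)] by auto
  have "(- {0}) \<inter> N = N" using N0 by auto
  then show "holomorphic_map (sub_cspace N (sub_cspace (- {0}) affine_space)) Y (F \<circ> proj_pt)"
    using F by (intro holomorphic_map_from_sub_sub) simp
qed

lemma compactin_proj_image:
  assumes "compact K" "0 \<notin> K"
  shows "compactin (ctop proj_space) (proj_pt ` K)"
  by (rule image_compactin[OF _ continuous_map_proj_pt])
     (use assms in \<open>auto simp: compactin_subtopology\<close>)

section \<open>Double covers of the complex plane\<close>

definition double_cover :: "(complex \<Rightarrow> complex) \<Rightarrow> (complex ^ 2) set" where
  "double_cover P = {v. (v $ 2)\<^sup>2 = P (v $ 1)}"

lemma affine_double_cover_eq: "affine_double_cover P = sub_cspace (double_cover P) affine_space"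
  by (simp add: affine_double_cover_def double_cover_def)

lemma vector_2_eta: "vector [v $ 1, v $ 2] = (v :: 'a::zero ^ 2)"
  by (simp add: vec_eq_iff forall_2)

text \<open>Holomorphy on a subset means local extension to the ambient space, so a coordinate
  \<open>\<phi>\<close> only has to be differentiable on \<open>N\<close>, and a parametrisation
  \<open>\<gamma>\<close> only has to have holomorphic components.\<close>

lemma locally_cplx_affine_sub:
  fixes S :: "(complex ^ 'n::finite) set"
  assumes N: "open N" "p \<in> S" "p \<in> N" and D: "open D"
    and \<phi>: "\<And>x. x \<in> N \<Longrightarrow> cdiff \<phi> x" "\<And>x. x \<in> S \<inter> N \<Longrightarrow> \<phi> x \<in> D \<and> \<gamma> (\<phi> x) = x"
    and \<gamma>: "\<And>i. (\<lambda>z. \<gamma> z $ i) holomorphic_on D" "\<And>z. z \<in> D \<Longrightarrow> \<gamma> z \<in> S \<inter> N \<and> \<phi> (\<gamma> z) = z"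
  shows "locally_cplx (sub_cspace S affine_space) p"
  unfolding locally_cplx_def biholomorphic_def
proof (intro exI conjI ballI)
  note sh = sheaf_sub_cspace[OF sheaf_affine_space] sheaf_sub_cspace[OF sheaf_cplx]
  show "openin (ctop (sub_cspace S affine_space)) (S \<inter> N)" using N by auto
  show "holomorphic_map (sub_cspace (S \<inter> N) (sub_cspace S affine_space)) (sub_cspace D cplx) \<phi>"
  proof (intro holomorphic_map_into_sub sheaf_sub_cspace sheaf_affine_space holomorphic_map_from_sub_sub)
    have "holomorphic_map (sub_cspace N affine_space) cplx \<phi>"
      by (rule holomorphic_map_to_cplx[OF N(1) \<phi>(1)])
    then show "holomorphic_map (sub_cspace (S \<inter> (S \<inter> N)) affine_space) cplx \<phi>"
      by (rule holomorphic_map_from_sub_mono) auto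
  qed (use \<phi> in auto)
  show "holomorphic_map (sub_cspace D cplx) (sub_cspace (S \<inter> N) (sub_cspace S affine_space)) \<gamma>"
    by (intro holomorphic_map_into_sub sh holomorphic_map_from_cplx D \<gamma>(1)) (use \<gamma>(2) in auto)
qed (use N D \<phi> \<gamma> in auto)

text \<open>Where y is nonzero, x is a coordinate and y is a branch of the square root. At a branch
  point y = 0 the root of \<open>P\<close> is simple, so \<open>P\<close> is locally invertible and
  y is a coordinate, with x the local inverse of \<open>P\<close> at y^2.\<close>

lemma locally_cplx_double_cover:
  assumes P: "P holomorphic_on UNIV" and sq: "\<And>x. P x = 0 \<Longrightarrow> deriv P x \<noteq> 0"
    and p: "p \<in> double_cover P"
  shows "locally_cplx (affine_double_cover P) p"
proof (cases "p $ 2 = 0")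
  case False
  define y where "y = p $ 2"
  have y: "y \<noteq> 0" "P (p $ 1) = y\<^sup>2" using False p by (auto simp: y_def double_cover_def)
  have contP: "continuous_on UNIV P" by (rule holomorphic_on_imp_continuous_on[OF P])
  \<comment> \<open>This half-plane keeps \<open>P x / y\<^sup>2\<close> off the branch cut of
    \<open>csqrt\<close>; the one in \<open>N\<close> selects the sheet containing
    \<open>p\<close>.\<close>
  define D where "D = {x. Re (P x / y\<^sup>2) > 0}"
  define N where "N = {v :: complex ^ 2. v $ 1 \<in> D \<and> Re (v $ 2 / y) > 0}"
  \<comment> \<open>Dividing by \<open>y\<^sup>2\<close> before taking the root yields the branch
    with value \<open>y\<close> at the base point.\<close>
  define r where "r x = y * csqrt (P x / y\<^sup>2)" for x
  have oD: "open D"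
    unfolding D_def using contP y by (intro open_Collect_less continuous_intros) auto
  have r_sq: "(r x)\<^sup>2 = P x" for x using y by (simp add: r_def power_mult_distrib)
  have r_re: "Re (r x / y) > 0" if "x \<in> D" for x
  proof -
    have "Re ((csqrt (P x / y\<^sup>2))\<^sup>2) > 0" using that by (simp add: D_def)
    moreover have "Re (w\<^sup>2) \<le> 0" if "Re w = 0" for w using that by (simp add: power2_eq_square)
    ultimately have "Re (csqrt (P x / y\<^sup>2)) \<noteq> 0" by (meson not_le)
    then have "Re (csqrt (P x / y\<^sup>2)) > 0" using csqrt_principal[of "P x / y\<^sup>2"] by auto
    then show ?thesis using y by (simp add: r_def)
  qed
  have r_hol: "r holomorphic_on D"
    unfolding r_def D_def
    by (intro holomorphic_intros holomorphic_on_compose_gen[OF _ holomorphic_on_csqrt, unfolded o_def])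
       (use y P in \<open>auto intro!: holomorphic_intros intro: holomorphic_on_subset simp: complex_nonpos_Reals_iff\<close>)
  have r_eq: "r x = z" if "x \<in> D" "z\<^sup>2 = P x" "Re (z / y) > 0" for x z
  proof -
    have "z = r x \<or> z = - r x" using that(2) r_sq[of x] by (metis power2_eq_iff)
    then show ?thesis using r_re[OF that(1)] that(3) by auto
  qed
  show ?thesis
    unfolding affine_double_cover_eq
  proof (rule locally_cplx_affine_sub[of N _ _ D "\<lambda>v. v $ 1" "\<lambda>x. vector [x, r x]"])
    have "open ((\<lambda>v :: complex ^ 2. v $ 1) -` D)" by (rule open_vimage_vec_nth[OF oD])
    moreover have "open {v :: complex ^ 2. Re (v $ 2 / y) > 0}"
      using y by (intro open_Collect_less continuous_intros) auto
    ultimately show "open N" unfolding N_def by (auto simp: vimage_def Collect_conj_eq)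
    show "p \<in> N" using y by (simp add: N_def D_def y_def[symmetric])
    show "(\<lambda>z. vector [z, r z] $ i) holomorphic_on D" for i :: 2
      using exhaust_2[of i] r_hol by auto
  qed (use p oD r_sq r_re in \<open>auto simp: N_def double_cover_def cdiff_nth r_eq vec_eq_iff forall_2\<close>)
next
  case True
  define x0 where "x0 = p $ 1"
  have "P x0 = 0" using p True by (simp add: double_cover_def x0_def)
  then obtain R where R: "R > 0" "open (P ` ball x0 R)" "inj_on P (ball x0 R)"
    using has_complex_derivative_locally_invertible[OF P _ open_UNIV sq, of x0] by auto
  have hol: "P holomorphic_on ball x0 R" using P by (rule holomorphic_on_subset) simp
  obtain g where g: "g holomorphic_on P ` ball x0 R" "\<And>z. z \<in> ball x0 R \<Longrightarrow> g (P z) = z"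
    using holomorphic_has_inverse[OF hol open_ball R(3)] by metis
  define D where "D = {y. y\<^sup>2 \<in> P ` ball x0 R}"
  define N where "N = {v :: complex ^ 2. v $ 1 \<in> ball x0 R}"
  have Pg: "P (g z) = z \<and> g z \<in> ball x0 R" if "z \<in> P ` ball x0 R" for z using that g(2) by auto
  have oD: "open D"
  proof -
    have "open ((\<lambda>y. y\<^sup>2) -` (P ` ball x0 R))" by (intro open_vimage R(2) continuous_intros)
    then show ?thesis by (simp add: D_def vimage_def)
  qed
  have gh: "(\<lambda>y. g (y\<^sup>2)) holomorphic_on D"
    by (rule holomorphic_on_compose_gen[OF _ g(1), unfolded o_def])
       (auto simp: D_def intro!: holomorphic_intros)
  show ?thesis
    unfolding affine_double_cover_eq
  proof (rule locally_cplx_affine_sub[of N _ _ D "\<lambda>v. v $ 2" "\<lambda>y. vector [g (y\<^sup>2), y]"])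
    show "open N" unfolding N_def using open_vimage_vec_nth[OF open_ball] by (auto simp: vimage_def)
    show "p \<in> N" using R by (simp add: N_def x0_def)
    show "(\<lambda>z. vector [g (z\<^sup>2), z] $ i) holomorphic_on D" for i :: 2
      using exhaust_2[of i] gh by auto
  qed (use p oD Pg g(2) in \<open>auto simp: N_def D_def double_cover_def cdiff_nth vec_eq_iff forall_2\<close>)
qed

section \<open>Connectedness of double covers\<close>

lemma cmod_minus_diff: "cmod (- y - z) = cmod (y + z)"
  using norm_minus_cancel[of "y + z"] by (simp del: norm_minus_cancel)

text \<open>This moves a sign from a point to its neighbour: the second alternative of
  \<open>double_cover_near\<close> then says that the point itself is close to the other point above
  \<open>x1\<close>.\<close>

lemma dist_vec_2_minus:
  "dist (vector [x, - y] :: complex ^ 2) (vector [x1, y1]) =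
   dist (vector [x, y] :: complex ^ 2) (vector [x1, - y1])"
  by (simp add: dist_vec_def sum_2 L2_set_def dist_norm cmod_minus_diff)

lemma dist_vec_2_le:
  fixes v w :: "complex ^ 2"
  shows "dist v w \<le> cmod (v $ 1 - w $ 1) + cmod (v $ 2 - w $ 2)"
  using L2_set_le_sum[of UNIV "\<lambda>i. dist (v $ i) (w $ i)"]
  by (simp add: dist_vec_def sum_2 dist_norm)

text \<open>
  If $y^2$ is close to $y_1^2$, then $y$ is close to $y_1$ or to $-y_1$, since
  $(y - y_1)(y + y_1) = y^2 - y_1^2$.
\<close>

lemma double_cover_near:
  assumes P: "continuous_on UNIV P" and e: "\<epsilon> > 0"
  obtains \<delta> where "\<delta> > 0" "\<And>x y y1. dist x x1 < \<delta> \<Longrightarrow> y\<^sup>2 = P x \<Longrightarrow> y1\<^sup>2 = P x1 \<Longrightarrow>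
    dist (vector [x, y] :: complex ^ 2) (vector [x1, y1]) < \<epsilon> \<or>
    dist (vector [x, - y] :: complex ^ 2) (vector [x1, y1]) < \<epsilon>"
proof -
  obtain \<delta> where d: "\<delta> > 0" "\<And>x. dist x x1 < \<delta> \<Longrightarrow> dist (P x) (P x1) < (\<epsilon> / 2)\<^sup>2"
    using P e unfolding continuous_on_iff by (metis UNIV_I half_gt_zero zero_less_power)
  show thesis
  proof (rule that[of "min \<delta> (\<epsilon> / 2)"])
    show "min \<delta> (\<epsilon> / 2) > 0" using d e by simp
    fix x y y1 assume x: "dist x x1 < min \<delta> (\<epsilon> / 2)" and y: "y\<^sup>2 = P x" "y1\<^sup>2 = P x1"
    have "cmod (y - y1) * cmod (y + y1) = cmod (P x - P x1)"
      by (simp add: norm_mult[symmetric] y[symmetric] power2_eq_square algebra_simps)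
    also have "\<dots> < (\<epsilon> / 2) * (\<epsilon> / 2)" using d(2)[of x] x by (simp add: dist_norm power2_eq_square)
    finally have "cmod (y - y1) < \<epsilon> / 2 \<or> cmod (y + y1) < \<epsilon> / 2"
      using e mult_mono[of "\<epsilon> / 2" "cmod (y - y1)" "\<epsilon> / 2" "cmod (y + y1)"] by force
    moreover have "cmod (- y - y1) = cmod (y + y1)" by (rule cmod_minus_diff)
    moreover have "cmod (x - x1) < \<epsilon> / 2" using x by (simp add: dist_norm)
    ultimately show "dist (vector [x, y] :: complex ^ 2) (vector [x1, y1]) < \<epsilon> \<or>
        dist (vector [x, - y] :: complex ^ 2) (vector [x1, y1]) < \<epsilon>"
      using dist_vec_2_le[of "vector [x, y]" "vector [x1, y1]"]
        dist_vec_2_le[of "vector [x, - y]" "vector [x1, y1]"] by (auto simp: )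
  qed
qed

text \<open>
  The projection to the $x$-axis is open and closed, so a nonempty clopen subset lies over the
  whole plane; two disjoint ones would meet in the only point over a zero of \<open>P\<close>.
\<close>

lemma connected_double_cover:
  assumes P: "continuous_on UNIV P" and root: "P x0 = 0"
  shows "connected (double_cover P)"
  unfolding connected_clopen
proof (intro allI impI)
  fix T assume T: "openin (top_of_set (double_cover P)) T \<and> closedin (top_of_set (double_cover P)) T"
  have onto: "x0 \<in> (\<lambda>v. v $ 1) ` T"
    if T: "openin (top_of_set (double_cover P)) T" "closedin (top_of_set (double_cover P)) T" "T \<noteq> {}" for T
  proof -
    have sub: "T \<subseteq> double_cover P" using openin_imp_subset[OF T(1)] .
    have "open ((\<lambda>v. v $ 1) ` T)"
      unfolding open_dist
    proof (intro ballI)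
      fix x1 assume "x1 \<in> (\<lambda>v. v $ 1) ` T"
      then obtain v where v: "v \<in> T" "v $ 1 = x1" by auto
      then obtain \<epsilon> where e: "\<epsilon> > 0" "\<And>w. w \<in> double_cover P \<Longrightarrow> dist w v < \<epsilon> \<Longrightarrow> w \<in> T"
        using T(1) unfolding openin_euclidean_subtopology_iff by metis
      obtain \<delta> where d: "\<delta> > 0" "\<And>x y y1. dist x x1 < \<delta> \<Longrightarrow> y\<^sup>2 = P x \<Longrightarrow> y1\<^sup>2 = P x1 \<Longrightarrow>
        dist (vector [x, y] :: complex ^ 2) (vector [x1, y1]) < \<epsilon> \<or>
        dist (vector [x, - y] :: complex ^ 2) (vector [x1, y1]) < \<epsilon>"
        using double_cover_near[OF P e(1)] by metis
      have "x \<in> (\<lambda>v. v $ 1) ` T" if x: "dist x x1 < \<delta>" for x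
      proof -
        have v2: "(v $ 2)\<^sup>2 = P x1" using v sub by (auto simp: double_cover_def)
        have ve: "vector [x1, v $ 2] = v" using v vector_2_eta[of v] by simp
        have "dist (vector [x, csqrt (P x)]) v < \<epsilon> \<or> dist (vector [x, - csqrt (P x)]) v < \<epsilon>"
          using d(2)[OF x power2_csqrt v2] unfolding ve .
        then have "vector [x, csqrt (P x)] \<in> T \<or> vector [x, - csqrt (P x)] \<in> T"
          using e(2) by (auto simp: double_cover_def)
        then show ?thesis by (auto intro: image_eqI[of _ _ "vector [x, _]"])
      qed
      then show "\<exists>e>0. \<forall>y. dist y x1 < e \<longrightarrow> y \<in> (\<lambda>v. v $ 1) ` T" using d(1) by blast
    qed
    moreover have "open (- ((\<lambda>v. v $ 1) ` T))"
      unfolding open_dist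
    proof (intro ballI)
      fix x1 assume x1: "x1 \<in> - ((\<lambda>v. v $ 1) ` T)"
      have oc: "openin (top_of_set (double_cover P)) (double_cover P - T)"
        using T(2) by (auto simp: closedin_def)
      have near: "\<exists>\<epsilon>>0. \<forall>w\<in>double_cover P. dist w (vector [x1, y1]) < \<epsilon> \<longrightarrow> w \<notin> T"
        if "y1\<^sup>2 = P x1" for y1
      proof -
        have "vector [x1, y1] \<in> double_cover P - T"
          using that x1 by (auto simp: double_cover_def image_iff)
        then show ?thesis using oc unfolding openin_euclidean_subtopology_iff by blast
      qed
      let ?y = "csqrt (P x1)"
      obtain \<epsilon>1 \<epsilon>2 where e1: "\<epsilon>1 > 0" "\<And>w. w \<in> double_cover P \<Longrightarrow> dist w (vector [x1, ?y]) < \<epsilon>1 \<Longrightarrow> w \<notin> T"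
        and e2: "\<epsilon>2 > 0" "\<And>w. w \<in> double_cover P \<Longrightarrow> dist w (vector [x1, - ?y]) < \<epsilon>2 \<Longrightarrow> w \<notin> T"
        using near[of ?y] near[of "- ?y"] by auto
      \<comment> \<open>A point of the cover above some x near \<open>x1\<close> is close to one of
        the points above \<open>x1\<close>. These have neighbourhoods avoiding \<open>T\<close>, and
        the smaller radius serves for both.\<close>
      obtain \<delta> where d: "\<delta> > 0" "\<And>x y y1. dist x x1 < \<delta> \<Longrightarrow> y\<^sup>2 = P x \<Longrightarrow> y1\<^sup>2 = P x1 \<Longrightarrow>
        dist (vector [x, y] :: complex ^ 2) (vector [x1, y1]) < min \<epsilon>1 \<epsilon>2 \<or>
        dist (vector [x, - y] :: complex ^ 2) (vector [x1, y1]) < min \<epsilon>1 \<epsilon>2"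
        using double_cover_near[OF P, of "min \<epsilon>1 \<epsilon>2"] e1 e2 by (metis min_less_iff_conj)
      have "x \<notin> (\<lambda>v. v $ 1) ` T" if x: "dist x x1 < \<delta>" for x
      proof
        assume "x \<in> (\<lambda>v. v $ 1) ` T"
        then obtain v where v: "v \<in> T" "v $ 1 = x" by auto
        have v2: "(v $ 2)\<^sup>2 = P x" using v sub by (auto simp: double_cover_def)
        have ve: "vector [x, v $ 2] = v" using v vector_2_eta[of v] by simp
        have "dist (vector [x, - (v $ 2)] :: complex ^ 2) (vector [x1, ?y]) = dist v (vector [x1, - ?y])"
          unfolding dist_vec_2_minus ve ..
        then have "dist v (vector [x1, ?y]) < \<epsilon>1 \<or> dist v (vector [x1, - ?y]) < \<epsilon>2"
          using d(2)[OF x v2 power2_csqrt] unfolding ve by auto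
        then show False using e1(2) e2(2) v sub by blast
      qed
      then show "\<exists>e>0. \<forall>y. dist y x1 < e \<longrightarrow> y \<in> - ((\<lambda>v. v $ 1) ` T)" using d(1) by blast
    qed
    ultimately have "(\<lambda>v. v $ 1) ` T = {} \<or> (\<lambda>v. v $ 1) ` T = UNIV"
      using clopen[of "(\<lambda>v. v $ 1) ` T"] by (simp add: closed_def)
    then show ?thesis using T(3) by auto
  qed
  have uniq: "vector [x0, 0] \<in> T"
    if T: "openin (top_of_set (double_cover P)) T" "closedin (top_of_set (double_cover P)) T" "T \<noteq> {}" for T
  proof -
    obtain v where v: "v \<in> T" "v $ 1 = x0" using onto[OF T] by auto
    then have "v $ 2 = 0" using openin_imp_subset[OF T(1)] root by (auto simp: double_cover_def)
    then show ?thesis using v vector_2_eta[of v] by simp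
  qed
  show "T = {} \<or> T = double_cover P"
  proof (rule ccontr)
    assume "\<not> (T = {} \<or> T = double_cover P)"
    moreover have "openin (top_of_set (double_cover P)) (double_cover P - T)"
      "closedin (top_of_set (double_cover P)) (double_cover P - T)"
      using T by (auto intro: openin_diff closedin_diff)
    ultimately show False
      using uniq[of T] uniq[of "double_cover P - T"] T openin_imp_subset[OF conjunct1[OF T]] by blast
  qed
qed

section \<open>Affine patches of projective curves\<close>

text \<open>Coordinate \<open>k\<close> is normalised to 1, and the ratios of coordinates
  \<open>l\<close> and \<open>m\<close> to it recover the plane point. Being invariant under
  scaling, these ratios define the holomorphic inverse on the open set where coordinate
  \<open>k\<close> is nonzero.\<close>

lemma affine_patch:
  fixes \<Phi> :: "complex ^ 2 \<Rightarrow> complex ^ 'n::finite" and k l m :: 'n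
  defines "N \<equiv> {v. v $ k \<noteq> 0}"
  assumes \<Phi>: "\<And>x i. cdiff (\<lambda>x. \<Phi> x $ i) x" "\<And>x. \<Phi> x $ k = 1" "\<And>x. \<Phi> x $ l = x $ 1" "\<And>x. \<Phi> x $ m = x $ 2"
    and Y: "Y \<inter> proj_pt ` N = (\<lambda>x. proj_pt (\<Phi> x)) ` E"
  obtains G where
    "holomorphic_map (sub_cspace E affine_space) (sub_cspace (Y \<inter> proj_pt ` N) (sub_cspace Y proj_space)) (\<lambda>x. proj_pt (\<Phi> x))"
    "holomorphic_map (sub_cspace (Y \<inter> proj_pt ` N) (sub_cspace Y proj_space)) (sub_cspace E affine_space) G"
    "\<And>x. G (proj_pt (\<Phi> x)) = x"
proof -
  define g where "g v = (vector [v $ l / v $ k, v $ m / v $ k] :: complex ^ 2)" for v :: "complex ^ 'n"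
  have oN: "open N" unfolding N_def by (intro open_Collect_neq continuous_intros)
  have cN: "punctured_cone N" by (auto simp: punctured_cone_def N_def)
  have gs: "on_rep g (proj_pt v) = g v" for v
    by (rule on_rep_proj_pt) (simp add: g_def)
  have inv: "on_rep g (proj_pt (\<Phi> x)) = x" for x
    unfolding gs by (simp add: g_def \<Phi> vector_2_eta)
  have nz: "\<Phi> x \<noteq> 0" for x using \<Phi>(2)[of x] by auto
  have "holomorphic_map (sub_cspace UNIV affine_space) (sub_cspace (- {0}) affine_space) \<Phi>"
    by (intro holomorphic_map_into_sub sheaf_sub_cspace sheaf_affine_space holomorphic_map_affine \<Phi>)
       (use nz in auto)
  from holomorphic_map_compose[OF this holomorphic_map_proj_pt]
  have F0: "holomorphic_map (sub_cspace UNIV affine_space) proj_space (proj_pt \<circ> \<Phi>)" .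
  have F: "holomorphic_map (sub_cspace E affine_space) (sub_cspace (Y \<inter> proj_pt ` N) (sub_cspace Y proj_space)) (proj_pt \<circ> \<Phi>)"
    by (intro holomorphic_map_into_sub sheaf_sub_cspace sheaf_affine_space
        holomorphic_map_from_sub_mono[OF F0]) (use Y in auto)
  have g: "holomorphic_map (sub_cspace N affine_space) affine_space g"
  proof (rule holomorphic_map_affine[OF oN])
    show "cdiff (\<lambda>v. g v $ i) v" if "v \<in> N" for v i
      using exhaust_2[of i] that by (auto simp: g_def N_def intro!: cdiff_intros)
  qed
  have "holomorphic_map (sub_cspace (proj_pt ` N) proj_space) affine_space (on_rep g)"
  proof (rule holomorphic_map_from_proj[OF sheaf_affine_space oN cN])
    show "holomorphic_map (sub_cspace N affine_space) affine_space (on_rep g \<circ> proj_pt)"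
      by (rule holomorphic_map_cong[OF sheaf_sub_cspace[OF sheaf_affine_space] g]) (simp add: gs)
  qed
  then have "holomorphic_map (sub_cspace (Y \<inter> (Y \<inter> proj_pt ` N)) proj_space) affine_space (on_rep g)"
    by (rule holomorphic_map_from_sub_mono) auto
  then have G: "holomorphic_map (sub_cspace (Y \<inter> proj_pt ` N) (sub_cspace Y proj_space)) (sub_cspace E affine_space) (on_rep g)"
    by (intro holomorphic_map_into_sub sheaf_sub_cspace sheaf_proj_space holomorphic_map_from_sub_sub)
       (auto simp: Y inv)
  show thesis using that[of "on_rep g"] F G inv by (simp add: o_def)
qed

section \<open>The sextic curve\<close>

lemma exhaust_5:
  fixes x :: 5
  shows "x = 1 \<or> x = 2 \<or> x = 3 \<or> x = 4 \<or> x = 5"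
proof (induct x)
  case (of_int z)
  then have "z = 0 \<or> z = 1 \<or> z = 2 \<or> z = 3 \<or> z = 4" by fastforce
  then show ?case by auto
qed

lemma vector_5 [simp]:
  "(vector [x, y, z, u, v] :: 'a::zero ^ 5) $ 1 = x"
  "(vector [x, y, z, u, v] :: 'a::zero ^ 5) $ 2 = y"
  "(vector [x, y, z, u, v] :: 'a::zero ^ 5) $ 3 = z"
  "(vector [x, y, z, u, v] :: 'a::zero ^ 5) $ 4 = u"
  "(vector [x, y, z, u, v] :: 'a::zero ^ 5) $ 5 = v"
  by (simp_all add: vector_def)

lemma vec_eq_iff_5: "(v :: 'a ^ 5) = w \<longleftrightarrow> v $ 1 = w $ 1 \<and> v $ 2 = w $ 2 \<and> v $ 3 = w $ 3 \<and> v $ 4 = w $ 4 \<and> v $ 5 = w $ 5"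
proof
  assume eq: "v $ 1 = w $ 1 \<and> v $ 2 = w $ 2 \<and> v $ 3 = w $ 3 \<and> v $ 4 = w $ 4 \<and> v $ 5 = w $ 5"
  have "v $ i = w $ i" for i using exhaust_5[of i] eq by auto
  then show "v = w" by (simp add: vec_eq_iff)
qed simp

text \<open>
  \<open>resA s t\<close> and \<open>resB s t\<close> are $2 e_1^3 - 9 e_1 e_2 + 27 e_3$ and $e_1^2 - 3 e_2$, where $e_i$ are the
  elementary symmetric functions of the three coordinates of a point of Bring's curve whose other
  two coordinates are $s$ and $t$.
\<close>

definition resA :: "complex \<Rightarrow> complex \<Rightarrow> complex" where
  "resA s t = - 20 * s ^ 3 - 15 * s\<^sup>2 * t - 15 * s * t\<^sup>2 - 20 * t ^ 3"

definition resB :: "complex \<Rightarrow> complex \<Rightarrow> complex" where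
  "resB s t = - 2 * s\<^sup>2 - s * t - 2 * t\<^sup>2"

text \<open>This is the value of (u^3 - w^3)^2, that is (u^3 + w^3)^2 - 4 (u w)^3, on Bring's
  curve.\<close>

definition sextic :: "complex \<Rightarrow> complex \<Rightarrow> complex" where
  "sextic s t = (resA s t)\<^sup>2 - 4 * resB s t ^ 3"

lemma sextic_eq:
  "sextic x 1 = 432 * x ^ 6 + 648 * x ^ 5 + 945 * x ^ 4 + 1350 * x ^ 3 + 945 * x\<^sup>2 + 648 * x + 432"
  unfolding sextic_def resA_def resB_def by (simp, algebra)

lemma sextic_commute: "sextic s t = sextic t s"
  unfolding sextic_def resA_def resB_def by algebra

lemma sextic_scale: "sextic (c * s) (c * t) = c ^ 6 * sextic s t"
  unfolding sextic_def resA_def resB_def by algebra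

lemma resA_commute: "resA s t = resA t s"
  unfolding resA_def by algebra

lemma resB_commute: "resB s t = resB t s"
  unfolding resB_def by algebra

section \<open>The branch points\<close>

lemma sextic_holomorphic: "(\<lambda>x. sextic x 1) holomorphic_on UNIV"
  unfolding sextic_eq by (intro holomorphic_intros)

lemma deriv_sextic:
  "deriv (\<lambda>x. sextic x 1) x = 2592 * x ^ 5 + 3240 * x ^ 4 + 3780 * x ^ 3 + 4050 * x\<^sup>2 + 1890 * x + 648"
  unfolding sextic_eq by (rule DERIV_imp_deriv) (auto intro!: derivative_eq_intros simp: algebra_simps)

lemma sextic_squarefree:
  assumes "sextic x 1 = 0"
  shows "deriv (\<lambda>x. sextic x 1) x \<noteq> 0"
proof
  assume "deriv (\<lambda>x. sextic x 1) x = 0"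
  \<comment> \<open>Bezout coefficients from the extended Euclidean algorithm\<close>
  moreover have "(2342 + 2182 * x + 2092 * x\<^sup>2 - 9288 * x ^ 3 - 9888 * x ^ 4) * sextic x 1
    + (- 1228 - 215 * x + 1310 * x\<^sup>2 + 725 * x ^ 3 + 1960 * x ^ 4 + 1648 * x ^ 5) * deriv (\<lambda>x. sextic x 1) x
    = 216000"
    unfolding deriv_sextic unfolding sextic_eq by (simp add: eval_nat_numeral algebra_simps)
  ultimately show False using assms by simp
qed

text \<open>A branch point joins the two sheets in the connectedness argument; it also shows that
  the curve is not empty.\<close>

lemma sextic_root: "\<exists>x. sextic x 1 = 0"
proof -
  have "\<exists>x. poly [:432, 648, 945, 1350, 945, 648, 432 :: complex:] x = 0"
    by (rule fundamental_theorem_of_algebra_alt) auto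
  then show ?thesis unfolding sextic_eq by (auto simp: algebra_simps power_numeral_reduce)
qed

text \<open>These are the monomials of degree 3 when s, t, y have weights 1, 1, 3. They embed the
  weighted projective plane P(1,1,3) and are the homogeneous form of
  [1 : x : x^2 : x^3 : y].\<close>

definition theta :: "complex \<Rightarrow> complex \<Rightarrow> complex \<Rightarrow> complex ^ 5" where
  "theta s t y = vector [t ^ 3, s * t\<^sup>2, s\<^sup>2 * t, s ^ 3, y]"

lemma theta_nth [simp]:
  "theta s t y $ 1 = t ^ 3" "theta s t y $ 2 = s * t\<^sup>2" "theta s t y $ 3 = s\<^sup>2 * t"
  "theta s t y $ 4 = s ^ 3" "theta s t y $ 5 = y"
  by (simp_all add: theta_def)

lemma theta_scale: "theta (c * s) (c * t) (c ^ 3 * y) = c ^ 3 *s theta s t y"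
  by (simp add: vec_eq_iff_5 power_mult_distrib power2_eq_square power3_eq_cube)

lemma cdiff_theta:
  assumes "cdiff f x" "cdiff g x" "cdiff h x"
  shows "cdiff (\<lambda>x. theta (f x) (g x) (h x) $ i) x"
  using exhaust_5[of i] assms by (auto intro!: cdiff_intros)

text \<open>The explicit candidate for the closure of the affine curve; t = 0 gives the points at
  infinity. Its identification with \<open>sextic_double_cover\<close> has to wait until this set is
  known to be closed.\<close>

definition sextic_curve :: "(complex ^ 5) set set" where
  "sextic_curve = {proj_pt (theta s t y) | s t y. (s \<noteq> 0 \<or> t \<noteq> 0) \<and> y\<^sup>2 = sextic s t}"

abbreviation sextic_cover :: "(complex ^ 2) set" where
  "sextic_cover \<equiv> double_cover (\<lambda>x. sextic x 1)"

definition patch0 :: "complex ^ 2 \<Rightarrow> complex ^ 5" where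
  "patch0 v = theta (v $ 1) 1 (v $ 2)"

text \<open>The chart around infinity, with coordinates t / s and y / s^3. Since
  \<open>sextic\<close> is symmetric, the part of the curve that it covers is again parametrised by
  \<open>sextic_cover\<close>.\<close>

definition patch1 :: "complex ^ 2 \<Rightarrow> complex ^ 5" where
  "patch1 v = theta 1 (v $ 1) (v $ 2)"

lemma punctured_cone_coord: "punctured_cone {v. v $ k \<noteq> 0}"
  by (auto simp: punctured_cone_def)

lemma proj_theta_affine:
  assumes "t \<noteq> 0"
  shows "proj_pt (theta s t y) = proj_pt (theta (s / t) 1 (y / t ^ 3))"
  using theta_scale[of t "s / t" 1 "y / t ^ 3"] proj_pt_scale[of "t ^ 3"] assms by simp

lemma proj_theta_infinity:
  assumes "s \<noteq> 0"
  shows "proj_pt (theta s t y) = proj_pt (theta 1 (t / s) (y / s ^ 3))"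
  using theta_scale[of s 1 "t / s" "y / s ^ 3"] proj_pt_scale[of "s ^ 3"] assms by simp

lemma sextic_affine:
  assumes "t \<noteq> 0" "y\<^sup>2 = sextic s t"
  shows "(y / t ^ 3)\<^sup>2 = sextic (s / t) 1"
proof -
  have "sextic s t = t ^ 6 * sextic (s / t) 1" using sextic_scale[of t "s / t" 1] assms by simp
  then show ?thesis using assms by (simp add: power_divide field_simps)
qed

lemma patch0_image:
  "sextic_curve \<inter> proj_pt ` {v. v $ 1 \<noteq> 0} = (\<lambda>v. proj_pt (patch0 v)) ` sextic_cover"
proof (intro subset_antisym subsetI)
  fix L assume "L \<in> sextic_curve \<inter> proj_pt ` {v. v $ 1 \<noteq> 0}"
  then obtain s t y where L: "L = proj_pt (theta s t y)" "y\<^sup>2 = sextic s t" "theta s t y $ 1 \<noteq> 0"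
    using proj_pt_in_image_cone[OF punctured_cone_coord] unfolding sextic_curve_def by blast
  then have t: "t \<noteq> 0" by simp
  show "L \<in> (\<lambda>v. proj_pt (patch0 v)) ` sextic_cover"
    by (rule image_eqI[of _ _ "vector [s / t, y / t ^ 3]"])
       (use L sextic_affine[OF t L(2)] proj_theta_affine[OF t] in \<open>auto simp: patch0_def double_cover_def\<close>)
next
  fix L assume "L \<in> (\<lambda>v. proj_pt (patch0 v)) ` sextic_cover"
  then show "L \<in> sextic_curve \<inter> proj_pt ` {v. v $ 1 \<noteq> 0}"
    unfolding sextic_curve_def double_cover_def patch0_def by fastforce
qed

lemma patch1_image:
  "sextic_curve \<inter> proj_pt ` {v. v $ 4 \<noteq> 0} = (\<lambda>v. proj_pt (patch1 v)) ` sextic_cover"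
proof (intro subset_antisym subsetI)
  fix L assume "L \<in> sextic_curve \<inter> proj_pt ` {v. v $ 4 \<noteq> 0}"
  then obtain s t y where L: "L = proj_pt (theta s t y)" "y\<^sup>2 = sextic s t" "theta s t y $ 4 \<noteq> 0"
    using proj_pt_in_image_cone[OF punctured_cone_coord] unfolding sextic_curve_def by blast
  then have s: "s \<noteq> 0" by simp
  show "L \<in> (\<lambda>v. proj_pt (patch1 v)) ` sextic_cover"
    by (rule image_eqI[of _ _ "vector [t / s, y / s ^ 3]"])
       (use L s sextic_affine[OF s, of y t] proj_theta_infinity[OF s] sextic_commute[of s t]
         in \<open>auto simp: patch1_def double_cover_def\<close>)
next
  fix L assume "L \<in> (\<lambda>v. proj_pt (patch1 v)) ` sextic_cover"
  then show "L \<in> sextic_curve \<inter> proj_pt ` {v. v $ 4 \<noteq> 0}"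
    unfolding sextic_curve_def double_cover_def patch1_def using sextic_commute by fastforce
qed

lemma sextic_curve_patches:
  "sextic_curve = (\<lambda>v. proj_pt (patch0 v)) ` sextic_cover \<union> (\<lambda>v. proj_pt (patch1 v)) ` sextic_cover"
proof -
  have "sextic_curve \<subseteq> proj_pt ` {v. v $ 1 \<noteq> 0} \<union> proj_pt ` {v. v $ 4 \<noteq> 0}"
  proof
    fix L assume "L \<in> sextic_curve"
    then obtain s t y where L: "L = proj_pt (theta s t y)" "s \<noteq> 0 \<or> t \<noteq> 0"
      unfolding sextic_curve_def by blast
    then have "theta s t y \<in> {v. v $ 1 \<noteq> 0} \<or> theta s t y \<in> {v. v $ 4 \<noteq> 0}" by auto
    then show "L \<in> proj_pt ` {v. v $ 1 \<noteq> 0} \<union> proj_pt ` {v. v $ 4 \<noteq> 0}" unfolding L(1) by blast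
  qed
  then have "sextic_curve = sextic_curve \<inter> (proj_pt ` {v. v $ 1 \<noteq> 0} \<union> proj_pt ` {v. v $ 4 \<noteq> 0})"
    by (rule Int_absorb2[symmetric])
  also have "\<dots> = (\<lambda>v. proj_pt (patch0 v)) ` sextic_cover \<union> (\<lambda>v. proj_pt (patch1 v)) ` sextic_cover"
    unfolding Int_Un_distrib patch0_image patch1_image ..
  finally show ?thesis .
qed

lemma sextic_curve_in_proj_space: "sextic_curve \<subseteq> topspace (ctop proj_space)"
proof -
  have "theta s t y \<noteq> 0" if "s \<noteq> 0 \<or> t \<noteq> 0" for s t y
    using that by (auto simp: vec_eq_iff_5)
  then show ?thesis unfolding sextic_curve_def topspace_proj_space by blast
qed

lemma cdiff_patch0: "cdiff (\<lambda>x. patch0 x $ i) x"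
  unfolding patch0_def by (intro cdiff_theta cdiff_intros)

lemma cdiff_patch1: "cdiff (\<lambda>x. patch1 x $ i) x"
  unfolding patch1_def by (intro cdiff_theta cdiff_intros)

lemma sextic_patch0:
  obtains G where
    "holomorphic_map (sub_cspace sextic_cover affine_space)
       (sub_cspace ((\<lambda>v. proj_pt (patch0 v)) ` sextic_cover) (sub_cspace sextic_curve proj_space)) (\<lambda>x. proj_pt (patch0 x))"
    "holomorphic_map (sub_cspace ((\<lambda>v. proj_pt (patch0 v)) ` sextic_cover) (sub_cspace sextic_curve proj_space))
       (sub_cspace sextic_cover affine_space) G"
    "\<And>x. G (proj_pt (patch0 x)) = x"
proof -
  have nth: "patch0 x $ 1 = 1" "patch0 x $ 2 = x $ 1" "patch0 x $ 5 = x $ 2" for x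
    by (simp_all add: patch0_def)
  show thesis
    by (rule affine_patch[OF cdiff_patch0 nth patch0_image, unfolded patch0_image]) (rule that)
qed

lemma sextic_patch1:
  obtains G where
    "holomorphic_map (sub_cspace sextic_cover affine_space)
       (sub_cspace ((\<lambda>v. proj_pt (patch1 v)) ` sextic_cover) (sub_cspace sextic_curve proj_space)) (\<lambda>x. proj_pt (patch1 x))"
    "holomorphic_map (sub_cspace ((\<lambda>v. proj_pt (patch1 v)) ` sextic_cover) (sub_cspace sextic_curve proj_space))
       (sub_cspace sextic_cover affine_space) G"
    "\<And>x. G (proj_pt (patch1 x)) = x"
proof -
  have nth: "patch1 x $ 4 = 1" "patch1 x $ 3 = x $ 1" "patch1 x $ 5 = x $ 2" for x
    by (simp_all add: patch1_def)
  show thesis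
    by (rule affine_patch[OF cdiff_patch1 nth patch1_image, unfolded patch1_image]) (rule that)
qed

section \<open>Lagrange resolvents on Bring's curve\<close>

definition bring_cone :: "(complex ^ 5) set" where
  "bring_cone = {x. x \<noteq> 0 \<and> (\<Sum>i\<in>UNIV. x $ i) = 0 \<and> (\<Sum>i\<in>UNIV. (x $ i)\<^sup>2) = 0 \<and> (\<Sum>i\<in>UNIV. (x $ i) ^ 3) = 0}"

lemma bring_curve_eq: "bring_curve = sub_cspace (proj_pt ` bring_cone) proj_space"
  by (simp add: bring_curve_def bring_cone_def)

lemma bring_cone_scale:
  assumes "v \<in> bring_cone" "m \<noteq> 0"
  shows "m *s v \<in> bring_cone"
proof -
  have "m *s v \<noteq> 0" using assms unfolding bring_cone_def by (auto simp: vec_eq_iff)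
  moreover have "(\<Sum>i\<in>UNIV. m * v $ i) = m * (\<Sum>i\<in>UNIV. v $ i)"
    "(\<Sum>i\<in>UNIV. (m * v $ i)\<^sup>2) = m\<^sup>2 * (\<Sum>i\<in>UNIV. (v $ i)\<^sup>2)"
    "(\<Sum>i\<in>UNIV. (m * v $ i) ^ 3) = m ^ 3 * (\<Sum>i\<in>UNIV. (v $ i) ^ 3)"
    by (simp_all add: sum_distrib_left power_mult_distrib)
  ultimately show ?thesis using assms(1) unfolding bring_cone_def by simp
qed

text \<open>The labelling of the coordinates is arbitrary, so that the computations cover all
  3-cycles at once.\<close>

locale resolvents =
  fixes a b c d e :: 5 and \<omega> :: complex
  assumes distinct: "distinct [a, b, c, d, e]" and omega: "\<omega>\<^sup>2 + \<omega> + 1 = 0"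
begin

lemma UNIV_eq: "UNIV = {a, b, c, d, e}"
proof -
  have "card {a, b, c, d, e} = CARD(5)" using distinct by simp
  then show ?thesis by (metis card_subset_eq finite_code subset_UNIV)
qed

lemma sum_UNIV: "(\<Sum>i\<in>UNIV. f i) = f a + f b + f c + f d + (f e :: complex)"
  unfolding UNIV_eq using distinct by (simp add: algebra_simps)

lemma vec_eq: "(v :: complex ^ 5) = w \<longleftrightarrow> v $ a = w $ a \<and> v $ b = w $ b \<and> v $ c = w $ c \<and> v $ d = w $ d \<and> v $ e = w $ e"
proof -
  have "(\<forall>i. v $ i = w $ i) \<longleftrightarrow> (\<forall>i\<in>{a, b, c, d, e}. v $ i = w $ i)" unfolding UNIV_eq[symmetric] by simp
  then show ?thesis by (simp add: vec_eq_iff)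
qed

lemma omega_cube: "\<omega> ^ 3 = 1"
  using omega by algebra

definition uu :: "complex ^ 5 \<Rightarrow> complex" where
  "uu v = v $ a + \<omega> * v $ b + \<omega>\<^sup>2 * v $ c"

definition ww :: "complex ^ 5 \<Rightarrow> complex" where
  "ww v = v $ a + \<omega>\<^sup>2 * v $ b + \<omega> * v $ c"

text \<open>This is u w = e_1^2 - 3 e_2, rewritten in power sums because Bring's equations are given
  by power sums; the factor 2 clears the denominator. The next identity treats 2 e_1^3 - 9 e_1 e_2 +
  27 e_3 in the same way.\<close>

lemma resolvent_product:
  "2 * (uu v * ww v) = 3 * ((v $ a)\<^sup>2 + (v $ b)\<^sup>2 + (v $ c)\<^sup>2) - (v $ a + v $ b + v $ c)\<^sup>2"
  using omega unfolding uu_def ww_def by algebra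

lemma resolvent_cubes:
  "uu v ^ 3 + ww v ^ 3 = 9 * ((v $ a) ^ 3 + (v $ b) ^ 3 + (v $ c) ^ 3)
     - 9 * ((v $ a)\<^sup>2 + (v $ b)\<^sup>2 + (v $ c)\<^sup>2) * (v $ a + v $ b + v $ c) + 2 * (v $ a + v $ b + v $ c) ^ 3"
  using omega unfolding uu_def ww_def by algebra

text \<open>The passage from power sums to resolvents is triangular: given the earlier equations,
  the defect of the next one is a nonzero constant times the defect of its counterpart.\<close>

lemma bring_cone_iff:
  "v \<in> bring_cone \<longleftrightarrow> v \<noteq> 0 \<and> v $ a + v $ b + v $ c = - (v $ d + v $ e) \<and>
     uu v * ww v = resB (v $ d) (v $ e) \<and> uu v ^ 3 + ww v ^ 3 = resA (v $ d) (v $ e)"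
proof -
  define s t where "s = v $ d" and "t = v $ e"
  define S2 S3 e1 where "S2 = (v $ a)\<^sup>2 + (v $ b)\<^sup>2 + (v $ c)\<^sup>2"
    and "S3 = (v $ a) ^ 3 + (v $ b) ^ 3 + (v $ c) ^ 3" and "e1 = v $ a + v $ b + v $ c"
  have u: "2 * (uu v * ww v) = 3 * S2 - e1\<^sup>2" "uu v ^ 3 + ww v ^ 3 = 9 * S3 - 9 * S2 * e1 + 2 * e1 ^ 3"
    using resolvent_product resolvent_cubes by (simp_all add: S2_def S3_def e1_def)
  have 1: "e1 + s + t = 0 \<longleftrightarrow> e1 = - (s + t)"
    unfolding eq_neg_iff_add_eq_0 by (simp add: add.assoc)
  have 2: "S2 + s\<^sup>2 + t\<^sup>2 = 0 \<longleftrightarrow> uu v * ww v = resB s t" if e: "e1 = - (s + t)"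
  proof -
    have "2 * (uu v * ww v - resB s t) = 3 * (S2 + s\<^sup>2 + t\<^sup>2)"
      unfolding right_diff_distrib u(1) e resB_def by algebra
    then show ?thesis by (metis eq_iff_diff_eq_0 mult_eq_0_iff zero_neq_numeral)
  qed
  have 3: "S3 + s ^ 3 + t ^ 3 = 0 \<longleftrightarrow> uu v ^ 3 + ww v ^ 3 = resA s t"
    if e: "e1 = - (s + t)" "S2 + s\<^sup>2 + t\<^sup>2 = 0"
  proof -
    have S2: "S2 = - (s\<^sup>2 + t\<^sup>2)" unfolding eq_neg_iff_add_eq_0 using e(2) by (simp add: add.assoc)
    have "uu v ^ 3 + ww v ^ 3 - resA s t = 9 * (S3 + s ^ 3 + t ^ 3)"
      unfolding u(2) resA_def e(1) S2 by algebra
    then show ?thesis by (metis eq_iff_diff_eq_0 mult_eq_0_iff zero_neq_numeral)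
  qed
  have "v \<in> bring_cone \<longleftrightarrow> v \<noteq> 0 \<and> e1 + s + t = 0 \<and> S2 + s\<^sup>2 + t\<^sup>2 = 0 \<and> S3 + s ^ 3 + t ^ 3 = 0"
    unfolding bring_cone_def sum_UNIV by (simp add: S2_def S3_def e1_def s_def t_def)
  then show ?thesis using 1 2 3 unfolding s_def[symmetric] t_def[symmetric] e1_def[symmetric] by blast
qed

text \<open>The inverse discrete Fourier transform on three points, with components u, w for the two
  nontrivial characters and - (s + t) for the trivial one.\<close>

definition of_resolvents :: "complex \<Rightarrow> complex \<Rightarrow> complex \<Rightarrow> complex \<Rightarrow> complex ^ 5" where
  "of_resolvents s t u w = (\<chi> i. if i = a then (u + w - s - t) / 3
     else if i = b then (\<omega>\<^sup>2 * u + \<omega> * w - s - t) / 3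
     else if i = c then (\<omega> * u + \<omega>\<^sup>2 * w - s - t) / 3
     else if i = d then s else t)"

lemma of_resolvents_nth:
  "of_resolvents s t u w $ a = (u + w - s - t) / 3"
  "of_resolvents s t u w $ b = (\<omega>\<^sup>2 * u + \<omega> * w - s - t) / 3"
  "of_resolvents s t u w $ c = (\<omega> * u + \<omega>\<^sup>2 * w - s - t) / 3"
  "of_resolvents s t u w $ d = s"
  "of_resolvents s t u w $ e = t"
  using distinct by (auto simp: of_resolvents_def)

lemma uu_of_resolvents: "uu (of_resolvents s t u w) = u"
proof -
  have "3 * uu (of_resolvents s t u w) = 3 * u"
    using omega unfolding uu_def of_resolvents_nth by (simp add: field_simps) algebra
  then show ?thesis by simp
qed

lemma ww_of_resolvents: "ww (of_resolvents s t u w) = w"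
proof -
  have "3 * ww (of_resolvents s t u w) = 3 * w"
    using omega unfolding ww_def of_resolvents_nth by (simp add: field_simps) algebra
  then show ?thesis by simp
qed

lemma of_resolvents_sum:
  "of_resolvents s t u w $ a + of_resolvents s t u w $ b + of_resolvents s t u w $ c = - (s + t)"
proof -
  have "3 * (of_resolvents s t u w $ a + of_resolvents s t u w $ b + of_resolvents s t u w $ c) = 3 * - (s + t)"
    using omega unfolding of_resolvents_nth by (simp add: field_simps) algebra
  then show ?thesis by (metis mult_cancel_left zero_neq_numeral)
qed

lemma of_resolvents_in_bring_cone:
  assumes "s \<noteq> 0 \<or> t \<noteq> 0" "u * w = resB s t" "u ^ 3 + w ^ 3 = resA s t"
  shows "of_resolvents s t u w \<in> bring_cone"
proof -
  have "of_resolvents s t u w \<noteq> 0"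
    using assms(1) of_resolvents_nth(4,5)[of s t u w] by (metis zero_index)
  then show ?thesis
    unfolding bring_cone_iff uu_of_resolvents ww_of_resolvents of_resolvents_sum
    using assms by (simp add: of_resolvents_nth)
qed

lemma of_resolvents_eq:
  assumes "v $ a + v $ b + v $ c = - (v $ d + v $ e)"
  shows "v = of_resolvents (v $ d) (v $ e) (uu v) (ww v)"
proof -
  have "3 * v $ a = uu v + ww v - v $ d - v $ e"
    "3 * v $ b = \<omega>\<^sup>2 * uu v + \<omega> * ww v - v $ d - v $ e"
    "3 * v $ c = \<omega> * uu v + \<omega>\<^sup>2 * ww v - v $ d - v $ e"
    using assms omega unfolding uu_def ww_def by algebra+
  then show ?thesis unfolding vec_eq of_resolvents_nth by (simp add: field_simps)
qed

text \<open>If s = t = 0, then u w = 0 and u^3 + w^3 = 0 force u = w = 0, and all coordinates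
  vanish. Hence \<open>psi\<close> has no base points on Bring's curve.\<close>

lemma bring_cone_coord_nonzero:
  assumes "v \<in> bring_cone"
  shows "v $ d \<noteq> 0 \<or> v $ e \<noteq> 0"
proof (rule ccontr)
  assume "\<not> (v $ d \<noteq> 0 \<or> v $ e \<noteq> 0)"
  then have de: "v $ d = 0" "v $ e = 0" by auto
  have v: "v \<noteq> 0" "v $ a + v $ b + v $ c = - (v $ d + v $ e)" "uu v * ww v = 0" "uu v ^ 3 + ww v ^ 3 = 0"
    using assms unfolding bring_cone_iff by (auto simp: de resA_def resB_def)
  then have "uu v = 0" "ww v = 0" by auto
  then have "v = 0" using of_resolvents_eq[OF v(2)] de unfolding vec_eq by (simp add: of_resolvents_nth)
  then show False using v(1) by simp
qed

section \<open>The invariant map to the sextic curve\<close>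

definition psi :: "complex ^ 5 \<Rightarrow> complex ^ 5" where
  "psi v = theta (v $ d) (v $ e) (uu v ^ 3 - ww v ^ 3)"

lemma psi_scale: "psi (k *s v) = k ^ 3 *s psi v"
proof -
  have "uu (k *s v) = k * uu v" "ww (k *s v) = k * ww v"
    by (simp_all add: uu_def ww_def algebra_simps)
  then show ?thesis
    unfolding psi_def theta_scale[symmetric] by (simp add: power_mult_distrib algebra_simps)
qed

lemma psi_of_resolvents: "psi (of_resolvents s t u w) = theta s t (u ^ 3 - w ^ 3)"
  by (simp add: psi_def uu_of_resolvents ww_of_resolvents of_resolvents_nth)

lemma psi_in_sextic_curve:
  assumes "v \<in> bring_cone"
  shows "proj_pt (psi v) \<in> sextic_curve"
proof -
  have "(uu v ^ 3 - ww v ^ 3)\<^sup>2 = sextic (v $ d) (v $ e)"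
  proof -
    have "(uu v ^ 3 - ww v ^ 3)\<^sup>2 = (uu v ^ 3 + ww v ^ 3)\<^sup>2 - 4 * (uu v * ww v) ^ 3" by algebra
    then show ?thesis using assms by (simp add: bring_cone_iff sextic_def)
  qed
  then show ?thesis
    unfolding sextic_curve_def psi_def using bring_cone_coord_nonzero[OF assms] by blast
qed

section \<open>Fibres of the invariant map\<close>

lemma cube_roots:
  assumes "u ^ 3 = v ^ 3"
  shows "u = v \<or> u = \<omega> * v \<or> u = \<omega>\<^sup>2 * (v :: complex)"
proof -
  have "(u - v) * (u - \<omega> * v) * (u - \<omega>\<^sup>2 * v) = u ^ 3 - v ^ 3" using omega by algebra
  then show ?thesis using assms by auto
qed

lemma resolvent_pairs:
  assumes u: "u ^ 3 = u' ^ 3" and w: "w ^ 3 = w' ^ 3" and p: "u * w = u' * (w' :: complex)"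
  shows "u = u' \<and> w = w' \<or> u = \<omega> * u' \<and> w = \<omega>\<^sup>2 * w' \<or> u = \<omega>\<^sup>2 * u' \<and> w = \<omega> * w'"
proof (cases "u' = 0")
  \<comment> \<open>With \<open>u' = 0\<close> the product carries no information, but then the
    three alternatives differ only in \<open>w\<close>, and any cube root will do.\<close>
  case True
  then have "u = 0" using u by simp
  then show ?thesis using True cube_roots[OF w] by auto
next
  case False
  consider "u = u'" | "u = \<omega> * u'" | "u = \<omega>\<^sup>2 * u'" using cube_roots[OF u] by blast
  then show ?thesis
  proof cases
    case 1
    then show ?thesis using p False by auto
  next
    case 2
    then have "u' * (w - \<omega>\<^sup>2 * w') = 0" using p omega_cube by algebra
    then show ?thesis using 2 False by auto
  next
    case 3
    then have "u' * (w - \<omega> * w') = 0" using p omega_cube by algebra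
    then show ?thesis using 3 False by auto
  qed
qed

text \<open>The direction matches \<open>permute_coords\<close>, which uses the inverse permutation:
  under a -> b -> c -> a, the entry at \<open>a\<close> moves to \<open>b\<close>.\<close>

definition rot :: "complex ^ 5 \<Rightarrow> complex ^ 5" where
  "rot v = (\<chi> i. if i = a then v $ c else if i = b then v $ a else if i = c then v $ b else v $ i)"

lemma rot_nth:
  "rot v $ a = v $ c" "rot v $ b = v $ a" "rot v $ c = v $ b" "rot v $ d = v $ d" "rot v $ e = v $ e"
  using distinct by (auto simp: rot_def)

lemma rot_scale: "rot (k *s v) = k *s rot v"
  unfolding vec_eq rot_nth by (simp add: rot_nth)

lemma rot_rot_rot: "rot (rot (rot v)) = v"
  unfolding vec_eq rot_nth by simp

lemma uu_rot: "uu (rot v) = \<omega> * uu v"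
  unfolding uu_def rot_nth using omega_cube by algebra

lemma ww_rot: "ww (rot v) = \<omega>\<^sup>2 * ww v"
  unfolding ww_def rot_nth using omega_cube by algebra

lemma psi_rot: "psi (rot v) = psi v"
proof -
  have "(\<omega> * uu v) ^ 3 - (\<omega>\<^sup>2 * ww v) ^ 3 = uu v ^ 3 - ww v ^ 3" using omega_cube by algebra
  then show ?thesis by (simp add: psi_def uu_rot ww_rot rot_nth)
qed

text \<open>The cubic monomials determine the ratio of s to t, as on the twisted cubic. The factor
  \<open>k\<close> is then the cube of the scaling \<open>m\<close> of s and t, in accordance with
  the weights.\<close>

lemma theta_proportional:
  assumes eq: "theta s t y = k *s theta s' t' y'" and nz: "s \<noteq> 0 \<or> t \<noteq> 0" and k: "k \<noteq> 0"
  obtains m where "m \<noteq> 0" "s = m * s'" "t = m * t'" "k = m ^ 3"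
proof -
  have c: "t ^ 3 = k * t' ^ 3" "s * t\<^sup>2 = k * (s' * t'\<^sup>2)" "s\<^sup>2 * t = k * (s'\<^sup>2 * t')" "s ^ 3 = k * s' ^ 3"
    using eq by (simp_all add: vec_eq_iff_5)
  show thesis
  proof (cases "t = 0")
    case False
    then have t': "t' \<noteq> 0" using c(1) by auto
    show ?thesis
    proof (rule that[of "t / t'"])
      have "t\<^sup>2 * (s * t' - t * s') = 0" using c(1,2) by algebra
      then show "s = t / t' * s'" using False t' by (simp add: field_simps)
      show "k = (t / t') ^ 3" using c(1) t' by (simp add: field_simps)
    qed (use False t' in auto)
  next
    case True
    then have s: "s \<noteq> 0" "s' \<noteq> 0" "t' = 0" using nz c k by auto
    show ?thesis
      by (rule that[of "s / s'"]) (use s True c(4) in \<open>auto simp: field_simps\<close>)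
  qed
qed

lemma psi_fibre:
  assumes v: "v \<in> bring_cone" and v': "v' \<in> bring_cone"
    and eq: "proj_pt (psi v) = proj_pt (psi v')"
  obtains m where "m \<noteq> 0" "v = m *s v' \<or> v = m *s rot v' \<or> v = m *s rot (rot v')"
proof -
  obtain k where k: "k \<noteq> 0" "psi v = k *s psi v'" using eq proj_pt_eq_iff by blast
  obtain m where m: "m \<noteq> 0" "v $ d = m * v' $ d" "v $ e = m * v' $ e" "k = m ^ 3"
    using theta_proportional[OF k(2)[unfolded psi_def] bring_cone_coord_nonzero[OF v] k(1)] by metis
  \<comment> \<open>Rescaling makes s, t and u^3 - w^3 agree exactly, not just projectively. Bring's
    equations then give equal u^3 + w^3 and equal u w as well.\<close>
  define x where "x = m *s v'"
  have "psi v = psi x" using k(2) m(4) by (simp add: x_def psi_scale)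
  then have y: "uu v ^ 3 - ww v ^ 3 = uu x ^ 3 - ww x ^ 3" by (simp add: psi_def vec_eq_iff_5)
  have "x \<in> bring_cone" unfolding x_def by (rule bring_cone_scale[OF v' m(1)])
  note x = this[unfolded bring_cone_iff]
  note v = v[unfolded bring_cone_iff]
  have de: "x $ d = v $ d" "x $ e = v $ e" using m by (simp_all add: x_def)
  have s: "uu v ^ 3 + ww v ^ 3 = uu x ^ 3 + ww x ^ 3" and p: "uu v * ww v = uu x * ww x"
    using x v de by simp_all
  have u3: "uu v ^ 3 = uu x ^ 3" and w3: "ww v ^ 3 = ww x ^ 3"
  proof -
    have "2 * uu v ^ 3 = 2 * uu x ^ 3" "2 * ww v ^ 3 = 2 * ww x ^ 3" using s y by algebra+
    then show "uu v ^ 3 = uu x ^ 3" "ww v ^ 3 = ww x ^ 3" by simp_all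
  qed
  have sums: "v $ a + v $ b + v $ c = - (v $ d + v $ e)"
    "rot x $ a + rot x $ b + rot x $ c = - (rot x $ d + rot x $ e)"
    "rot (rot x) $ a + rot (rot x) $ b + rot (rot x) $ c = - (rot (rot x) $ d + rot (rot x) $ e)"
    "x $ a + x $ b + x $ c = - (x $ d + x $ e)"
    using x v by (simp_all add: rot_nth algebra_simps)
  have vx: "v = z" if "z $ a + z $ b + z $ c = - (z $ d + z $ e)" "z $ d = v $ d" "z $ e = v $ e"
    "uu v = uu z" "ww v = ww z" for z
  proof -
    have "v = of_resolvents (v $ d) (v $ e) (uu v) (ww v)" by (rule of_resolvents_eq[OF sums(1)])
    also have "\<dots> = of_resolvents (z $ d) (z $ e) (uu z) (ww z)" using that by (simp only:)
    also have "\<dots> = z" by (rule of_resolvents_eq[OF that(1), symmetric])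
    finally show ?thesis .
  qed
  \<comment> \<open>Rotating twice multiplies u by \<open>\<omega>\<^sup>2\<close> and w by
    \<open>\<omega> ^ 4 = \<omega>\<close>.\<close>
  have o4: "\<omega>\<^sup>2 * (\<omega>\<^sup>2 * z) = \<omega> * z" "\<omega> * (\<omega> * z) = \<omega>\<^sup>2 * z" for z
    using omega_cube by (algebra, simp add: power2_eq_square)
  have "v = x" if "uu v = uu x \<and> ww v = ww x"
    by (rule vx[OF sums(4)]) (use that de in auto)
  moreover have "v = rot x" if "uu v = \<omega> * uu x \<and> ww v = \<omega>\<^sup>2 * ww x"
    by (rule vx[OF sums(2)]) (use that de in \<open>auto simp: uu_rot ww_rot rot_nth\<close>)
  moreover have "v = rot (rot x)" if "uu v = \<omega>\<^sup>2 * uu x \<and> ww v = \<omega> * ww x"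
    by (rule vx[OF sums(3)]) (use that de o4 in \<open>auto simp: uu_rot ww_rot rot_nth\<close>)
  ultimately have "v = x \<or> v = rot x \<or> v = rot (rot x)"
    using resolvent_pairs[OF u3 w3 p] by blast
  then have "v = m *s v' \<or> v = m *s rot v' \<or> v = m *s rot (rot v')" by (simp add: x_def rot_scale)
  then show thesis using that m(1) by blast
qed

end

section \<open>Local holomorphic resolvents\<close>

text \<open>Dividing twice the cubic by the quadratic leaves the remainder 15 (x - 2), so 2 is the
  only possible common root, but the quadratic takes the value -12 there.\<close>

lemma resA_resB_nonzero: "resA x 1 \<noteq> 0 \<or> resB x 1 \<noteq> 0"
proof (rule ccontr)
  assume "\<not> (resA x 1 \<noteq> 0 \<or> resB x 1 \<noteq> 0)"
  then have AB: "resA x 1 = 0" "resB x 1 = 0" by auto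
  have "15 * (x - 2) = 2 * resA x 1 - (20 * x + 5) * resB x 1"
    unfolding resA_def resB_def by (simp, algebra)
  then have "x = 2" using AB by simp
  then show False using AB(2) by (simp add: resB_def)
qed

lemma cdiff_resA: "cdiff f p \<Longrightarrow> cdiff g p \<Longrightarrow> cdiff (\<lambda>p. resA (f p) (g p)) p"
  unfolding resA_def by (intro cdiff_intros)

lemma cdiff_resB: "cdiff f p \<Longrightarrow> cdiff g p \<Longrightarrow> cdiff (\<lambda>p. resB (f p) (g p)) p"
  unfolding resB_def by (intro cdiff_intros)

text \<open>The sign \<open>\<sigma>\<close> selects which resolvent is obtained as a cube root:
  \<open>U\<close> is u for 1 and w for -1. The other one is a quotient by \<open>U\<close>, so it
  stays holomorphic even where it vanishes.\<close>

lemma local_resolvents_sign: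
  fixes p0 :: "complex ^ 2"
  assumes \<sigma>: "\<sigma>\<^sup>2 = 1" and nz: "resA (p0 $ 1) 1 + \<sigma> * p0 $ 2 \<noteq> 0"
  obtains N U W where "open N" "p0 \<in> N" "\<And>p. p \<in> N \<Longrightarrow> cdiff U p" "\<And>p. p \<in> N \<Longrightarrow> cdiff W p"
    "\<And>p. p \<in> N \<Longrightarrow> p \<in> sextic_cover \<Longrightarrow> U p ^ 3 = (resA (p $ 1) 1 + \<sigma> * p $ 2) / 2 \<and>
       W p ^ 3 = (resA (p $ 1) 1 - \<sigma> * p $ 2) / 2 \<and> U p * W p = resB (p $ 1) 1"
proof -
  define \<alpha> where "\<alpha> p = (resA (p $ 1) 1 + \<sigma> * p $ 2) / 2" for p :: "complex ^ 2"
  have \<alpha>0: "\<alpha> p0 \<noteq> 0" using nz by (simp add: \<alpha>_def)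
  \<comment> \<open>On this half-plane the principal logarithm of
    \<open>\<alpha> p / \<alpha> p0\<close> is holomorphic.\<close>
  define N where "N = {p. Re (\<alpha> p / \<alpha> p0) > 0}"
  \<comment> \<open>A fixed cube root of \<open>\<alpha> p0\<close> times the branch that is 1 at
    \<open>p0\<close>. Written with exponentials, \<open>U\<close> has no zeros, so division by it
    is always allowed.\<close>
  define U where "U p = exp (Ln (\<alpha> p0) / 3) * exp (Ln (\<alpha> p / \<alpha> p0) / 3)" for p
  define W where "W p = resB (p $ 1) 1 / U p" for p
  have \<alpha>_diff: "cdiff \<alpha> p" for p
    unfolding \<alpha>_def by (intro cdiff_intros cdiff_resA) auto
  have \<alpha>N: "\<alpha> p \<noteq> 0" if "p \<in> N" for p using that by (auto simp: N_def)
  have exp_third: "exp (z / 3) ^ 3 = exp z" for z :: complex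
    using exp_of_nat_mult[of 3 "z / 3"] by simp
  have U3: "U p ^ 3 = \<alpha> p" if "p \<in> N" for p
    using \<alpha>N[OF that] \<alpha>0 by (simp add: U_def power_mult_distrib exp_third exp_Ln)
  have U_diff: "cdiff U p" if p: "p \<in> N" for p
  proof -
    have "\<alpha> p / \<alpha> p0 \<notin> \<real>\<^sub>\<le>\<^sub>0" using p by (auto simp: N_def complex_nonpos_Reals_iff)
    then have "cdiff (\<lambda>p. Ln (\<alpha> p / \<alpha> p0)) p"
      by (intro cdiff_chain[OF _ has_field_derivative_Ln] cdiff_intros \<alpha>_diff \<alpha>0)
    then have "cdiff (\<lambda>p. exp (Ln (\<alpha> p / \<alpha> p0) / 3)) p"
      by (intro cdiff_chain[OF _ DERIV_exp] cdiff_intros) auto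
    then show ?thesis unfolding U_def by (intro cdiff_intros)
  qed
  show thesis
  proof (rule that)
    have "continuous_on UNIV \<alpha>"
      by (intro continuous_at_imp_continuous_on ballI cdiff_isCont \<alpha>_diff)
    then show "open N" unfolding N_def using \<alpha>0 by (intro open_Collect_less continuous_intros) auto
    show "p0 \<in> N" using \<alpha>0 by (simp add: N_def)
    show "cdiff U p" if "p \<in> N" for p by (rule U_diff[OF that])
    have Unz: "U p \<noteq> 0" for p by (simp add: U_def)
    show "cdiff W p" if "p \<in> N" for p
      unfolding W_def by (intro cdiff_intros cdiff_resB U_diff that Unz)
    show "U p ^ 3 = (resA (p $ 1) 1 + \<sigma> * p $ 2) / 2 \<and>
       W p ^ 3 = (resA (p $ 1) 1 - \<sigma> * p $ 2) / 2 \<and> U p * W p = resB (p $ 1) 1"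
      if p: "p \<in> N" "p \<in> sextic_cover" for p
    proof (intro conjI)
      show 1: "U p ^ 3 = (resA (p $ 1) 1 + \<sigma> * p $ 2) / 2" using U3[OF p(1)] by (simp add: \<alpha>_def)
      show "U p * W p = resB (p $ 1) 1" using Unz by (simp add: W_def)
      \<comment> \<open>The curve equation is a norm equation: (A - y)(A + y) = 4 B^3. Given U^3 and
        U W = B, it determines W^3.\<close>
      have "(p $ 2)\<^sup>2 = sextic (p $ 1) 1" using p(2) by (simp add: double_cover_def)
      then have "(resA (p $ 1) 1 - \<sigma> * p $ 2) * (resA (p $ 1) 1 + \<sigma> * p $ 2) = 4 * resB (p $ 1) 1 ^ 3"
        using \<sigma> unfolding sextic_def by algebra
      then have "(resA (p $ 1) 1 - \<sigma> * p $ 2) / 2 * U p ^ 3 = resB (p $ 1) 1 ^ 3"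
        unfolding 1 by simp
      then show "W p ^ 3 = (resA (p $ 1) 1 - \<sigma> * p $ 2) / 2"
        using Unz[of p] by (simp add: W_def power_divide field_simps)
    qed
  qed
qed

lemma local_resolvents:
  assumes p0: "p0 \<in> sextic_cover"
  obtains N U W where "open N" "p0 \<in> N" "\<And>p. p \<in> N \<Longrightarrow> cdiff U p" "\<And>p. p \<in> N \<Longrightarrow> cdiff W p"
    "\<And>p. p \<in> N \<Longrightarrow> p \<in> sextic_cover \<Longrightarrow> U p ^ 3 + W p ^ 3 = resA (p $ 1) 1 \<and>
       U p ^ 3 - W p ^ 3 = p $ 2 \<and> U p * W p = resB (p $ 1) 1"
proof (cases "resA (p0 $ 1) 1 + p0 $ 2 = 0")
  case False
  have "resA (p0 $ 1) 1 + 1 * p0 $ 2 \<noteq> 0" using False by simp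
  from local_resolvents_sign[OF _ this] obtain N U W where
    *: "open N" "p0 \<in> N" "\<And>p. p \<in> N \<Longrightarrow> cdiff U p" "\<And>p. p \<in> N \<Longrightarrow> cdiff W p"
    "\<And>p. p \<in> N \<Longrightarrow> p \<in> sextic_cover \<Longrightarrow> U p ^ 3 = (resA (p $ 1) 1 + 1 * p $ 2) / 2 \<and>
       W p ^ 3 = (resA (p $ 1) 1 - 1 * p $ 2) / 2 \<and> U p * W p = resB (p $ 1) 1"
    by (metis power_one)
  show thesis
  proof (rule that[OF *(1-4)])
    show "U p ^ 3 + W p ^ 3 = resA (p $ 1) 1 \<and> U p ^ 3 - W p ^ 3 = p $ 2 \<and> U p * W p = resB (p $ 1) 1"
      if "p \<in> N" "p \<in> sextic_cover" for p
      using *(5)[OF that] by (elim conjE, simp only:) (simp add: field_simps)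
  qed
next
  case True
  \<comment> \<open>If A + y and A - y both vanished, then A = y = 0, and the curve equation would
    give B = 0 too.\<close>
  have "resA (p0 $ 1) 1 + (- 1) * p0 $ 2 \<noteq> 0"
  proof
    assume "resA (p0 $ 1) 1 + (- 1) * p0 $ 2 = 0"
    then have A: "resA (p0 $ 1) 1 = p0 $ 2" by simp
    then have "p0 $ 2 = 0" using True by simp
    then have "resA (p0 $ 1) 1 = 0" "p0 $ 2 = 0" using A by simp_all
    moreover from this have "resB (p0 $ 1) 1 = 0"
      using p0 by (simp add: double_cover_def sextic_def)
    ultimately show False using resA_resB_nonzero by blast
  qed
  from local_resolvents_sign[OF _ this] obtain N U W where
    *: "open N" "p0 \<in> N" "\<And>p. p \<in> N \<Longrightarrow> cdiff U p" "\<And>p. p \<in> N \<Longrightarrow> cdiff W p"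
    "\<And>p. p \<in> N \<Longrightarrow> p \<in> sextic_cover \<Longrightarrow> U p ^ 3 = (resA (p $ 1) 1 + (- 1) * p $ 2) / 2 \<and>
       W p ^ 3 = (resA (p $ 1) 1 - (- 1) * p $ 2) / 2 \<and> U p * W p = resB (p $ 1) 1"
    by (metis power2_minus power_one)
  \<comment> \<open>For the sign -1 the cube root found is w, so the two functions change
    places.\<close>
  show thesis
  proof (rule that[OF *(1,2,4,3)])
    show "W p ^ 3 + U p ^ 3 = resA (p $ 1) 1 \<and> W p ^ 3 - U p ^ 3 = p $ 2 \<and> W p * U p = resB (p $ 1) 1"
      if "p \<in> N" "p \<in> sextic_cover" for p
      using *(5)[OF that] by (elim conjE, simp only: mult.commute[of "W p"]) (simp add: field_simps)
  qed
qed

section \<open>The sextic curve as a compact Riemann surface\<close>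

abbreviation sextic_surface :: "(complex ^ 5) set cspace" where
  "sextic_surface \<equiv> sub_cspace sextic_curve proj_space"

lemma sheaf_sextic_surface: "sheaf_cspace sextic_surface"
  by (intro sheaf_sub_cspace sheaf_proj_space)

lemma topspace_sextic_surface: "topspace (ctop sextic_surface) = sextic_curve"
  using sextic_curve_in_proj_space by auto

lemma openin_patch_image:
  "openin (ctop sextic_surface) ((\<lambda>v. proj_pt (patch0 v)) ` sextic_cover)"
  "openin (ctop sextic_surface) ((\<lambda>v. proj_pt (patch1 v)) ` sextic_cover)"
proof -
  have "openin (ctop proj_space) (proj_pt ` {v :: complex ^ 5. v $ k \<noteq> 0})" for k
    by (rule openin_proj_image) (auto intro!: open_Collect_neq continuous_intros)
  then show "openin (ctop sextic_surface) ((\<lambda>v. proj_pt (patch0 v)) ` sextic_cover)"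
    "openin (ctop sextic_surface) ((\<lambda>v. proj_pt (patch1 v)) ` sextic_cover)"
    unfolding patch0_image[symmetric] patch1_image[symmetric] by (auto intro: openin_subtopology_Int2)
qed

lemma locally_cplx_patch:
  assumes op: "openin (ctop sextic_surface) (F ` sextic_cover)"
    and F: "holomorphic_map (sub_cspace sextic_cover affine_space) (sub_cspace (F ` sextic_cover) sextic_surface) F"
    and G: "holomorphic_map (sub_cspace (F ` sextic_cover) sextic_surface) (sub_cspace sextic_cover affine_space) G"
    and GF: "\<And>x. G (F x) = x"
    and L: "L \<in> F ` sextic_cover"
  shows "locally_cplx sextic_surface L"
proof (rule locally_cplx_open_sub[OF sheaf_sextic_surface op])
  have top: "topspace (ctop (sub_cspace (F ` sextic_cover) sextic_surface)) = F ` sextic_cover"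
    using openin_subset[OF op] by auto
  show "locally_cplx (sub_cspace (F ` sextic_cover) sextic_surface) L"
  proof (rule locally_cplx_biholomorphic[OF sheaf_sub_cspace[OF sheaf_sextic_surface]
        sheaf_sub_cspace[OF sheaf_affine_space] G F])
    have "G L \<in> sextic_cover" using L GF by auto
    then show "locally_cplx (sub_cspace sextic_cover affine_space) (G L)"
      using locally_cplx_double_cover[OF sextic_holomorphic sextic_squarefree]
      unfolding affine_double_cover_eq by blast
  qed (use top GF L in auto)
qed

lemma locally_cplx_sextic_surface:
  assumes "L \<in> sextic_curve"
  shows "locally_cplx sextic_surface L"
proof -
  obtain G0 where G0: "holomorphic_map (sub_cspace sextic_cover affine_space)
       (sub_cspace ((\<lambda>v. proj_pt (patch0 v)) ` sextic_cover) sextic_surface) (\<lambda>x. proj_pt (patch0 x))"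
    "holomorphic_map (sub_cspace ((\<lambda>v. proj_pt (patch0 v)) ` sextic_cover) sextic_surface)
       (sub_cspace sextic_cover affine_space) G0"
    "\<And>x. G0 (proj_pt (patch0 x)) = x" using sextic_patch0 by blast
  obtain G1 where G1: "holomorphic_map (sub_cspace sextic_cover affine_space)
       (sub_cspace ((\<lambda>v. proj_pt (patch1 v)) ` sextic_cover) sextic_surface) (\<lambda>x. proj_pt (patch1 x))"
    "holomorphic_map (sub_cspace ((\<lambda>v. proj_pt (patch1 v)) ` sextic_cover) sextic_surface)
       (sub_cspace sextic_cover affine_space) G1"
    "\<And>x. G1 (proj_pt (patch1 x)) = x" using sextic_patch1 by blast
  from assms consider "L \<in> (\<lambda>v. proj_pt (patch0 v)) ` sextic_cover" | "L \<in> (\<lambda>v. proj_pt (patch1 v)) ` sextic_cover"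
    unfolding sextic_curve_patches by blast
  then show ?thesis
    by cases (rule locally_cplx_patch[OF openin_patch_image(1) G0], assumption,
        rule locally_cplx_patch[OF openin_patch_image(2) G1], assumption)
qed

section \<open>Points at infinity and the closure of the affine curve\<close>

lemma continuous_map_patch:
  "continuous_map (top_of_set sextic_cover) (ctop proj_space) (\<lambda>v. proj_pt (patch0 v))"
  "continuous_map (top_of_set sextic_cover) (ctop proj_space) (\<lambda>v. proj_pt (patch1 v))"
proof -
  obtain G where "holomorphic_map (sub_cspace sextic_cover affine_space)
       (sub_cspace ((\<lambda>v. proj_pt (patch0 v)) ` sextic_cover) sextic_surface) (\<lambda>x. proj_pt (patch0 x))"
    using sextic_patch0 by blast
  from holomorphic_map_continuous[OF this]
  show "continuous_map (top_of_set sextic_cover) (ctop proj_space) (\<lambda>v. proj_pt (patch0 v))"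
    by (simp add: continuous_map_in_subtopology)
  obtain G where "holomorphic_map (sub_cspace sextic_cover affine_space)
       (sub_cspace ((\<lambda>v. proj_pt (patch1 v)) ` sextic_cover) sextic_surface) (\<lambda>x. proj_pt (patch1 x))"
    using sextic_patch1 by blast
  from holomorphic_map_continuous[OF this]
  show "continuous_map (top_of_set sextic_cover) (ctop proj_space) (\<lambda>v. proj_pt (patch1 v))"
    by (simp add: continuous_map_in_subtopology)
qed

lemma patch1_affine:
  assumes "v \<in> sextic_cover" "v $ 1 \<noteq> 0"
  shows "proj_pt (patch1 v) \<in> (\<lambda>v. proj_pt (patch0 v)) ` sextic_cover"
proof -
  have "(v $ 2)\<^sup>2 = sextic 1 (v $ 1)" using assms(1) by (simp add: double_cover_def sextic_commute)
  then have "proj_pt (patch1 v) \<in> sextic_curve" unfolding sextic_curve_def patch1_def by fastforce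
  moreover have "patch1 v $ 1 \<noteq> 0" using assms(2) by (simp add: patch1_def)
  ultimately show ?thesis unfolding patch0_image[symmetric] by blast
qed

text \<open>A point outside the affine patch has s = 1 and t = 0, which leaves only the two square
  roots of \<open>sextic 0 1\<close> = 432 for y.\<close>

lemma sextic_infinity_finite:
  "finite (sextic_curve - (\<lambda>v. proj_pt (patch0 v)) ` sextic_cover)"
proof (rule finite_subset)
  let ?y = "csqrt (sextic 0 1)"
  show "sextic_curve - (\<lambda>v. proj_pt (patch0 v)) ` sextic_cover
      \<subseteq> (\<lambda>v. proj_pt (patch1 v)) ` {vector [0, ?y], vector [0, - ?y]}"
  proof
    fix L assume L: "L \<in> sextic_curve - (\<lambda>v. proj_pt (patch0 v)) ` sextic_cover"
    then obtain v where v: "v \<in> sextic_cover" "L = proj_pt (patch1 v)"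
      unfolding sextic_curve_patches by blast
    have v1: "v $ 1 = 0" using patch1_affine[OF v(1)] L v(2) by blast
    then have "(v $ 2)\<^sup>2 = ?y\<^sup>2" using v(1) unfolding double_cover_def by simp
    then have "v $ 2 = ?y \<or> v $ 2 = - ?y" by (simp only: power2_eq_iff)
    then have "v = vector [0, ?y] \<or> v = vector [0, - ?y]"
      using v1 by (auto simp: vec_eq_iff forall_2)
    then show "L \<in> (\<lambda>v. proj_pt (patch1 v)) ` {vector [0, ?y], vector [0, - ?y]}" using v(2) by blast
  qed
qed simp

text \<open>Moving the coordinate of the chart at infinity slightly away from 0 leads into the
  affine patch, and \<open>double_cover_near\<close> provides a second coordinate that stays
  close.\<close>

lemma sextic_curve_subset_closure:
  "sextic_curve \<subseteq> ctop proj_space closure_of ((\<lambda>v. proj_pt (patch0 v)) ` sextic_cover)"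
proof
  fix L assume L: "L \<in> sextic_curve"
  show "L \<in> ctop proj_space closure_of ((\<lambda>v. proj_pt (patch0 v)) ` sextic_cover)"
  proof (cases "L \<in> (\<lambda>v. proj_pt (patch0 v)) ` sextic_cover")
    case True
    have "(\<lambda>v. proj_pt (patch0 v)) ` sextic_cover \<subseteq> topspace (ctop proj_space)"
      using sextic_curve_in_proj_space unfolding sextic_curve_patches by blast
    then show ?thesis using True closure_of_subset by blast
  next
    case False
    then obtain v where v: "v \<in> sextic_cover" "L = proj_pt (patch1 v)"
      using L unfolding sextic_curve_patches by blast
    show ?thesis
      unfolding in_closure_of
    proof (intro conjI allI impI)
      show "L \<in> topspace (ctop proj_space)" using L sextic_curve_in_proj_space by blast
      fix T assume T: "L \<in> T \<and> openin (ctop proj_space) T"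
      have "openin (top_of_set sextic_cover) {x \<in> topspace (top_of_set sextic_cover). proj_pt (patch1 x) \<in> T}"
        using openin_continuous_map_preimage[OF continuous_map_patch(2)] T by blast
      then obtain \<epsilon> where e: "\<epsilon> > 0" "\<And>w. w \<in> sextic_cover \<Longrightarrow> dist w v < \<epsilon> \<Longrightarrow> proj_pt (patch1 w) \<in> T"
        unfolding openin_euclidean_subtopology_iff using v T by auto
      have cont: "continuous_on UNIV (\<lambda>x. sextic x 1)"
        by (rule holomorphic_on_imp_continuous_on[OF sextic_holomorphic])
      obtain \<delta> where d: "\<delta> > 0" "\<And>x y y1. dist x (v $ 1) < \<delta> \<Longrightarrow> y\<^sup>2 = sextic x 1 \<Longrightarrow> y1\<^sup>2 = sextic (v $ 1) 1 \<Longrightarrow>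
        dist (vector [x, y] :: complex ^ 2) (vector [v $ 1, y1]) < \<epsilon> \<or>
        dist (vector [x, - y] :: complex ^ 2) (vector [v $ 1, y1]) < \<epsilon>"
        using double_cover_near[OF cont e(1), of "v $ 1"] by metis
      \<comment> \<open>Nonzero \<open>x\<close> in the chart at infinity means t nonzero, hence a
        point of the affine patch.\<close>
      obtain x where x: "x \<noteq> 0" "dist x (v $ 1) < \<delta>"
      proof (cases "v $ 1 = 0")
        case True
        show ?thesis by (rule that[of "of_real (\<delta> / 2)"]) (use d(1) True in auto)
      next
        case False
        show ?thesis by (rule that[of "v $ 1"]) (use d(1) False in auto)
      qed
      have "(v $ 2)\<^sup>2 = sextic (v $ 1) 1" using v(1) by (simp add: double_cover_def)
      from d(2)[OF x(2) power2_csqrt this] obtain y where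
        y: "y\<^sup>2 = sextic x 1" "dist (vector [x, y]) v < \<epsilon>"
        unfolding vector_2_eta by (metis power2_csqrt power2_minus)
      have E: "vector [x, y] \<in> sextic_cover" using y(1) by (simp add: double_cover_def)
      have "proj_pt (patch1 (vector [x, y])) \<in> (\<lambda>v. proj_pt (patch0 v)) ` sextic_cover"
        by (rule patch1_affine[OF E]) (use x in auto)
      then show "\<exists>y. y \<in> (\<lambda>v. proj_pt (patch0 v)) ` sextic_cover \<and> y \<in> T"
        using e(2)[OF E y(2)] by blast
    qed
  qed
qed

text \<open>Closedness is an assumption at this stage: it comes from compactness of Bring's curve
  through \<open>psi_map\<close>. Given it, the curve is the closure of the connected affine
  part.\<close>

lemma connectedin_sextic_curve:
  assumes "closedin (ctop proj_space) sextic_curve"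
  shows "connectedin (ctop proj_space) sextic_curve"
    and "ctop proj_space closure_of ((\<lambda>v. proj_pt (patch0 v)) ` sextic_cover) = sextic_curve"
proof -
  have "(\<lambda>v. proj_pt (patch0 v)) ` sextic_cover \<subseteq> sextic_curve"
    unfolding sextic_curve_patches by blast
  then show cl: "ctop proj_space closure_of ((\<lambda>v. proj_pt (patch0 v)) ` sextic_cover) = sextic_curve"
    using sextic_curve_subset_closure closure_of_minimal[OF _ assms] by blast
  have "connected sextic_cover"
    using connected_double_cover[OF holomorphic_on_imp_continuous_on[OF sextic_holomorphic]] sextic_root by blast
  then have "connectedin (top_of_set sextic_cover) sextic_cover"
    by (simp add: connectedin_subtopology)
  then have "connectedin (ctop proj_space) ((\<lambda>v. proj_pt (patch0 v)) ` sextic_cover)"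
    by (rule connectedin_continuous_map_image[OF continuous_map_patch(1)])
  then show "connectedin (ctop proj_space) sextic_curve"
    using connectedin_closure_of unfolding cl[symmetric] by blast
qed

lemma compact_riemann_surface_biholomorphic_sextic:
  assumes X: "sheaf_cspace X" and bi: "biholomorphic X sextic_surface"
    and comp: "compactin (ctop proj_space) sextic_curve"
  shows "compact_riemann_surface X"
proof (rule compact_riemann_surface_biholomorphic[OF X sheaf_sextic_surface bi])
  have "closedin (ctop proj_space) sextic_curve"
    by (rule compactin_imp_closedin[OF Hausdorff_proj_space comp])
  from connectedin_sextic_curve(1)[OF this]
  show "connected_space (ctop sextic_surface)" by (simp add: connectedin_def)
  show "compact_space (ctop sextic_surface)" using comp by (simp add: compact_space_subtopology)
  show "Hausdorff_space (ctop sextic_surface)"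
    by (simp add: Hausdorff_space_subtopology Hausdorff_proj_space)
  show "second_countable (ctop sextic_surface)"
    by (simp add: second_countable_subtopology second_countable_proj_space)
  obtain x where "sextic x 1 = 0" using sextic_root by blast
  then have "proj_pt (theta x 1 0) \<in> sextic_curve" unfolding sextic_curve_def by fastforce
  then show "topspace (ctop sextic_surface) \<noteq> {}" unfolding topspace_sextic_surface by blast
  show "locally_cplx sextic_surface q" if "q \<in> topspace (ctop sextic_surface)" for q
    using that locally_cplx_sextic_surface unfolding topspace_sextic_surface by blast
qed

section \<open>The quotient of Bring's curve\<close>

text \<open>Every line has a representative on the unit sphere, where Bring's equations cut out a
  compact set.\<close>

lemma compactin_bring: "compactin (ctop proj_space) (proj_pt ` bring_cone)"
proof -
  have "proj_pt ` bring_cone = proj_pt ` (bring_cone \<inter> sphere 0 1)"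
  proof (intro subset_antisym subsetI)
    fix L assume "L \<in> proj_pt ` bring_cone"
    then obtain v where v: "v \<in> bring_cone" "L = proj_pt v" by blast
    define k where "k = complex_of_real (1 / norm v)"
    have nz: "v \<noteq> 0" using v by (simp add: bring_cone_def)
    then have k: "k \<noteq> 0" by (simp add: k_def)
    have "k *s v = (1 / norm v) *\<^sub>R v"
      by (simp add: k_def vec_eq_iff scaleR_conv_of_real[where 'a = complex])
    then have "norm (k *s v) = 1" using nz by simp
    then have "k *s v \<in> bring_cone \<inter> sphere 0 1" using bring_cone_scale[OF v(1) k] by simp
    moreover have "L = proj_pt (k *s v)" unfolding v(2) proj_pt_scale[OF k] ..
    ultimately show "L \<in> proj_pt ` (bring_cone \<inter> sphere 0 1)" by blast
  qed auto
  moreover have "bring_cone \<inter> sphere 0 1 = sphere 0 1 \<inter> {x. (\<Sum>i\<in>UNIV. x $ i) = 0}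
      \<inter> {x. (\<Sum>i\<in>UNIV. (x $ i)\<^sup>2) = 0} \<inter> {x. (\<Sum>i\<in>UNIV. (x $ i) ^ 3) = 0}"
    by (auto simp: bring_cone_def)
  moreover have "compact \<dots>"
    by (intro compact_Int_closed compact_sphere closed_Collect_eq continuous_intros)
  ultimately show ?thesis by (simp add: compactin_proj_image)
qed

lemma topspace_bring_curve: "topspace (ctop bring_curve) = proj_pt ` bring_cone"
  using compactin_subset_topspace[OF compactin_bring] by (auto simp: bring_curve_eq)

lemma sheaf_bring_curve: "sheaf_cspace bring_curve"
  unfolding bring_curve_eq by (intro sheaf_sub_cspace sheaf_proj_space)

context resolvents
begin

section \<open>The map between the curves and its local sections\<close>

definition psi_map :: "(complex ^ 5) set \<Rightarrow> (complex ^ 5) set" where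
  "psi_map = on_rep (\<lambda>v. proj_pt (psi v))"

lemma psi_map_proj_pt: "psi_map (proj_pt v) = proj_pt (psi v)"
  unfolding psi_map_def by (rule on_rep_proj_pt) (simp add: psi_scale proj_pt_scale)

lemma holomorphic_psi_map: "holomorphic_map bring_curve sextic_surface psi_map"
proof -
  \<comment> \<open>An open cone on which \<open>psi\<close> does not vanish and which contains
    \<open>bring_cone\<close>, so \<open>psi\<close> descends to a neighbourhood of Bring's curve in
    projective space.\<close>
  define N where "N = {v :: complex ^ 5. v $ d \<noteq> 0 \<or> v $ e \<noteq> 0}"
  have oN: "open N"
    unfolding N_def by (intro open_Collect_disj open_Collect_neq continuous_intros)
  have cN: "punctured_cone N" by (auto simp: N_def punctured_cone_def)
  have uw: "cdiff uu v" "cdiff ww v" for v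
    unfolding uu_def ww_def by (intro cdiff_intros)+
  have "cdiff (\<lambda>v. psi v $ i) v" for v i
    unfolding psi_def by (intro cdiff_theta cdiff_intros uw)
  then have "holomorphic_map (sub_cspace N affine_space) (sub_cspace (- {0}) affine_space) psi"
    by (intro holomorphic_map_into_sub sheaf_sub_cspace sheaf_affine_space holomorphic_map_affine oN)
       (auto simp: N_def psi_def vec_eq_iff_5)
  from holomorphic_map_compose[OF this holomorphic_map_proj_pt]
  have "holomorphic_map (sub_cspace N affine_space) proj_space (psi_map \<circ> proj_pt)"
    by (rule holomorphic_map_cong[OF sheaf_sub_cspace[OF sheaf_affine_space]]) (simp add: psi_map_proj_pt)
  from holomorphic_map_from_proj[OF sheaf_proj_space oN cN this]
  have "holomorphic_map (sub_cspace (proj_pt ` N) proj_space) proj_space psi_map" .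
  then have "holomorphic_map bring_curve proj_space psi_map"
    unfolding bring_curve_eq
    by (rule holomorphic_map_from_sub_mono) (use bring_cone_coord_nonzero in \<open>auto simp: N_def\<close>)
  then show ?thesis
    by (rule holomorphic_map_into_sub[OF sheaf_bring_curve])
       (use psi_in_sextic_curve in \<open>auto simp: topspace_bring_curve psi_map_proj_pt\<close>)
qed

lemma local_section:
  assumes p0: "p0 \<in> sextic_cover" and \<Phi>: "\<Phi> = patch0 \<or> \<Phi> = patch1"
  obtains N \<zeta> where "open N" "p0 \<in> N"
    "holomorphic_map (sub_cspace (N \<inter> sextic_cover) affine_space) bring_curve \<zeta>"
    "\<And>p. p \<in> N \<inter> sextic_cover \<Longrightarrow> psi_map (\<zeta> p) = proj_pt (\<Phi> p)"
proof -
  obtain N U W where N: "open N" "p0 \<in> N" "\<And>p. p \<in> N \<Longrightarrow> cdiff U p" "\<And>p. p \<in> N \<Longrightarrow> cdiff W p"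
    and UW: "\<And>p. p \<in> N \<Longrightarrow> p \<in> sextic_cover \<Longrightarrow> U p ^ 3 + W p ^ 3 = resA (p $ 1) 1 \<and>
       U p ^ 3 - W p ^ 3 = p $ 2 \<and> U p * W p = resB (p $ 1) 1"
    using local_resolvents[OF p0] by metis
  \<comment> \<open>The homogeneous coordinates are (x, 1) in one patch and (1, x) in the other. By
    symmetry of \<open>resA\<close> and \<open>resB\<close>, the same local resolvents serve
    both.\<close>
  obtain s t :: "complex ^ 2 \<Rightarrow> complex" where st: "\<And>p. cdiff s p" "\<And>p. cdiff t p"
    "\<And>p. s p \<noteq> 0 \<or> t p \<noteq> 0" "\<And>p. \<Phi> p = theta (s p) (t p) (p $ 2)"
    "\<And>p. resA (s p) (t p) = resA (p $ 1) 1" "\<And>p. resB (s p) (t p) = resB (p $ 1) 1"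
  proof -
    from \<Phi> consider "\<Phi> = patch0" | "\<Phi> = patch1" by blast
    then show thesis
    proof cases
      case 1
      show thesis by (rule that[of "\<lambda>p. p $ 1" "\<lambda>p. 1"]) (auto simp: 1 patch0_def intro: cdiff_intros)
    next
      case 2
      show thesis
        by (rule that[of "\<lambda>p. 1" "\<lambda>p. p $ 1"])
           (auto simp: 2 patch1_def resA_commute[of 1] resB_commute[of 1] intro: cdiff_intros)
    qed
  qed
  define z where "z p = of_resolvents (s p) (t p) (U p) (W p)" for p
  have z_diff: "cdiff (\<lambda>p. z p $ i) p" if p: "p \<in> N" for p i
  proof -
    have "i \<in> {a, b, c, d, e}" using UNIV_eq by blast
    then show ?thesis
      unfolding z_def using N(3,4)[OF p] st(1,2)
      by (auto simp: of_resolvents_nth intro!: cdiff_intros)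
  qed
  have z_nz: "z p \<noteq> 0" for p
    using st(3)[of p] of_resolvents_nth(4,5)[of "s p" "t p" "U p" "W p"] by (auto simp: z_def)
  have z_cone: "z p \<in> bring_cone" if "p \<in> N \<inter> sextic_cover" for p
    unfolding z_def by (rule of_resolvents_in_bring_cone) (use st UW that in auto)
  have "holomorphic_map (sub_cspace N affine_space) (sub_cspace (- {0}) affine_space) z"
    by (intro holomorphic_map_into_sub sheaf_sub_cspace sheaf_affine_space holomorphic_map_affine N(1) z_diff)
       (use z_nz in auto)
  from holomorphic_map_compose[OF this holomorphic_map_proj_pt]
  have "holomorphic_map (sub_cspace (N \<inter> sextic_cover) affine_space) proj_space (proj_pt \<circ> z)"
    by (rule holomorphic_map_from_sub_mono) auto
  then have hol: "holomorphic_map (sub_cspace (N \<inter> sextic_cover) affine_space) bring_curve (proj_pt \<circ> z)"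
    unfolding bring_curve_eq
    by (rule holomorphic_map_into_sub[OF sheaf_sub_cspace[OF sheaf_affine_space]]) (use z_cone in auto)
  show thesis
  proof (rule that[OF N(1,2) hol])
    fix p assume "p \<in> N \<inter> sextic_cover"
    then show "psi_map ((proj_pt \<circ> z) p) = proj_pt (\<Phi> p)"
      using UW by (simp add: psi_map_proj_pt z_def psi_of_resolvents st(4))
  qed
qed

text \<open>Every point of the sextic curve is hit by a local section through it.\<close>

lemma psi_map_surj: "psi_map ` (proj_pt ` bring_cone) = sextic_curve"
proof (intro subset_antisym subsetI)
  fix L assume "L \<in> psi_map ` (proj_pt ` bring_cone)"
  then show "L \<in> sextic_curve" using psi_in_sextic_curve by (auto simp: psi_map_proj_pt)
next
  fix L assume "L \<in> sextic_curve"
  then obtain p \<Phi> where p: "p \<in> sextic_cover" "\<Phi> = patch0 \<or> \<Phi> = patch1" "L = proj_pt (\<Phi> p)"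
    unfolding sextic_curve_patches by blast
  obtain N \<zeta> where z: "open N" "p \<in> N"
    "holomorphic_map (sub_cspace (N \<inter> sextic_cover) affine_space) bring_curve \<zeta>"
    "\<And>p. p \<in> N \<inter> sextic_cover \<Longrightarrow> psi_map (\<zeta> p) = proj_pt (\<Phi> p)"
    using local_section[OF p(1,2)] by metis
  have "\<zeta> p \<in> proj_pt ` bring_cone"
    using holomorphic_map_in_topspace[OF z(3)] z(2) p(1) by (simp add: topspace_bring_curve)
  then show "L \<in> psi_map ` (proj_pt ` bring_cone)" using z(4)[of p] z(2) p by (auto intro: rev_image_eqI)
qed

lemma compactin_sextic_curve: "compactin (ctop proj_space) sextic_curve"
proof -
  have "continuous_map (ctop bring_curve) (ctop sextic_surface) psi_map"
    by (rule holomorphic_map_continuous[OF holomorphic_psi_map])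
  then have "continuous_map (ctop bring_curve) (ctop proj_space) psi_map"
    by (simp add: continuous_map_in_subtopology)
  moreover have "compactin (ctop bring_curve) (proj_pt ` bring_cone)"
    using compactin_bring by (simp add: bring_curve_eq compactin_subtopology)
  ultimately have "compactin (ctop proj_space) (psi_map ` (proj_pt ` bring_cone))"
    by (rule image_compactin[rotated])
  then show ?thesis by (simp add: psi_map_surj)
qed

lemma quotient_map_psi_map: "quotient_map (ctop bring_curve) (ctop sextic_surface) psi_map"
proof (rule continuous_closed_imp_quotient_map)
  show cont: "continuous_map (ctop bring_curve) (ctop sextic_surface) psi_map"
    by (rule holomorphic_map_continuous[OF holomorphic_psi_map])
  show "closed_map (ctop bring_curve) (ctop sextic_surface) psi_map"
  proof (rule continuous_imp_closed_map[OF cont])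
    show "compact_space (ctop bring_curve)"
      using compactin_bring by (simp add: bring_curve_eq compact_space_subtopology)
    show "Hausdorff_space (ctop sextic_surface)"
      by (simp add: Hausdorff_space_subtopology Hausdorff_proj_space)
  qed
  show "psi_map ` topspace (ctop bring_curve) = topspace (ctop sextic_surface)"
    unfolding topspace_bring_curve topspace_sextic_surface by (rule psi_map_surj)
qed

text \<open>In the patch coordinate, \<open>f\<close> is locally
  \<open>f \<circ> psi_map \<circ> \<zeta>\<close> for a section \<open>\<zeta>\<close>, and so
  holomorphic as the pullback by \<open>\<zeta>\<close> of a holomorphic function on Bring's curve.
  Composing with \<open>G\<close> returns to the surface.\<close>

lemma hol_at_descends_patch:
  assumes op: "openin (ctop sextic_surface) ((\<lambda>v. proj_pt (\<Phi> v)) ` sextic_cover)"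
    and G: "holomorphic_map (sub_cspace ((\<lambda>v. proj_pt (\<Phi> v)) ` sextic_cover) sextic_surface)
       (sub_cspace sextic_cover affine_space) G"
    and GF: "\<And>x. G (proj_pt (\<Phi> x)) = x"
    and \<Phi>: "\<Phi> = patch0 \<or> \<Phi> = patch1"
    and p0: "p0 \<in> sextic_cover" "proj_pt (\<Phi> p0) \<in> V"
    and f: "\<And>p. p \<in> topspace (ctop bring_curve) \<Longrightarrow> psi_map p \<in> V \<Longrightarrow> hol_at bring_curve (f \<circ> psi_map) p"
  shows "hol_at sextic_surface f (proj_pt (\<Phi> p0))"
proof -
  define F where "F = (\<lambda>v. proj_pt (\<Phi> v))"
  obtain N \<zeta> where z: "open N" "p0 \<in> N"
    "holomorphic_map (sub_cspace (N \<inter> sextic_cover) affine_space) bring_curve \<zeta>"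
    "\<And>p. p \<in> N \<inter> sextic_cover \<Longrightarrow> psi_map (\<zeta> p) = F p"
    using local_section[OF p0(1) \<Phi>] unfolding F_def by metis
  have top: "p0 \<in> topspace (ctop (sub_cspace (N \<inter> sextic_cover) affine_space))" using z(2) p0 by simp
  have "hol_at bring_curve (f \<circ> psi_map) (\<zeta> p0)"
    by (rule f[OF holomorphic_map_in_topspace[OF z(3) top]]) (use z p0 in \<open>auto simp: F_def\<close>)
  from holomorphic_mapD[OF z(3) top this]
  have "hol_at (sub_cspace (N \<inter> sextic_cover) affine_space) (f \<circ> psi_map \<circ> \<zeta>) p0" .
  then obtain W g where g: "open W" "p0 \<in> W" "\<forall>q\<in>W \<inter> (N \<inter> sextic_cover). (f \<circ> psi_map \<circ> \<zeta>) q = g q"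
    "hol_at affine_space g p0"
    unfolding hol_at_sub_cspace by auto
  have "hol_at (sub_cspace sextic_cover affine_space) (f \<circ> F) p0"
    unfolding hol_at_sub_cspace
  proof (intro exI conjI ballI)
    show "openin (ctop affine_space) (W \<inter> N)" "p0 \<in> W \<inter> N" using g z by auto
    show "(f \<circ> F) q = g q" if "q \<in> W \<inter> N \<inter> sextic_cover" for q
      using bspec[OF g(3), of q] z(4)[of q] that by simp
  qed (fact g(4))
  moreover have Y: "F p0 \<in> topspace (ctop (sub_cspace (F ` sextic_cover) sextic_surface))"
    using p0 openin_subset[OF op] unfolding F_def by auto
  ultimately have "hol_at (sub_cspace (F ` sextic_cover) sextic_surface) (f \<circ> F \<circ> G) (F p0)"
    using holomorphic_mapD[OF G, of "F p0" "f \<circ> F"] GF[of p0] unfolding F_def by simp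
  then have "hol_at (sub_cspace (F ` sextic_cover) sextic_surface) f (F p0)"
    by (rule sheaf_cspace_cong[OF sheaf_sub_cspace[OF sheaf_sextic_surface] openin_topspace Y, rotated])
       (auto simp: F_def GF)
  then have "hol_at sextic_surface f (F p0)"
    using hol_at_sub_open[OF sheaf_sextic_surface op[folded F_def]] p0(1) by blast
  then show ?thesis by (simp add: F_def)
qed

lemma hol_at_descends:
  assumes V: "y \<in> V" "y \<in> sextic_curve"
    and f: "\<And>p. p \<in> topspace (ctop bring_curve) \<Longrightarrow> psi_map p \<in> V \<Longrightarrow> hol_at bring_curve (f \<circ> psi_map) p"
  shows "hol_at sextic_surface f y"
proof -
  obtain G0 where G0: "holomorphic_map (sub_cspace ((\<lambda>v. proj_pt (patch0 v)) ` sextic_cover) sextic_surface)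
       (sub_cspace sextic_cover affine_space) G0" "\<And>x. G0 (proj_pt (patch0 x)) = x"
    using sextic_patch0 by blast
  obtain G1 where G1: "holomorphic_map (sub_cspace ((\<lambda>v. proj_pt (patch1 v)) ` sextic_cover) sextic_surface)
       (sub_cspace sextic_cover affine_space) G1" "\<And>x. G1 (proj_pt (patch1 x)) = x"
    using sextic_patch1 by blast
  from V(2) consider p where "p \<in> sextic_cover" "y = proj_pt (patch0 p)"
    | p where "p \<in> sextic_cover" "y = proj_pt (patch1 p)"
    unfolding sextic_curve_patches by blast
  then show ?thesis
  proof cases
    case 1
    show ?thesis
      unfolding 1(2)
      by (rule hol_at_descends_patch[OF openin_patch_image(1) G0 _ 1(1) _ f]) (use 1 V in auto)
  next
    case 2
    show ?thesis
      unfolding 2(2)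
      by (rule hol_at_descends_patch[OF openin_patch_image(2) G1 _ 2(1) _ f]) (use 2 V in auto)
  qed
qed

section \<open>Orbits as fibres\<close>

lemma permute_coords_proj_pt: "permute_coords \<sigma> ` proj_pt v = proj_pt (permute_coords \<sigma> v)"
proof -
  have "permute_coords \<sigma> (k *s v) = k *s permute_coords \<sigma> v" for k
    by (simp add: permute_coords_def vec_eq_iff)
  moreover have "permute_coords \<sigma> ` proj_pt v = {permute_coords \<sigma> (k *s v) | k. k \<noteq> 0}"
    unfolding proj_pt_def by blast
  ultimately show ?thesis unfolding proj_pt_def by simp
qed

lemma orbit_eq:
  assumes \<tau>: "bij \<tau>" "\<tau> a = b" "\<tau> b = c" "\<tau> c = a" "\<tau> d = d" "\<tau> e = e"
  shows "(\<lambda>\<sigma>. permute_coords \<sigma> ` proj_pt v) ` {id, \<tau>, \<tau> \<circ> \<tau>} = {proj_pt v, proj_pt (rot v), proj_pt (rot (rot v))}"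
proof -
  have inv: "inv_into UNIV \<tau> b = a" "inv_into UNIV \<tau> c = b" "inv_into UNIV \<tau> a = c" "inv_into UNIV \<tau> d = d" "inv_into UNIV \<tau> e = e"
    using \<tau> by (auto intro: inv_f_eq bij_is_inj)
  have 1: "permute_coords \<tau> x = rot x" for x
    unfolding vec_eq rot_nth by (simp add: permute_coords_def inv)
  have "permute_coords (\<tau> \<circ> \<tau>) x = rot (rot x)" for x
    unfolding vec_eq rot_nth by (simp add: permute_coords_def o_inv_distrib \<tau>(1) inv)
  moreover have "permute_coords id x = x" for x :: "complex ^ 5"
    by (simp add: permute_coords_def vec_eq_iff)
  ultimately show ?thesis using 1 by (simp add: permute_coords_proj_pt)
qed

lemma psi_map_fibres:
  assumes "p \<in> proj_pt ` bring_cone" "p' \<in> proj_pt ` bring_cone"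
    and \<tau>: "bij \<tau>" "\<tau> a = b" "\<tau> b = c" "\<tau> c = a" "\<tau> d = d" "\<tau> e = e"
  shows "psi_map p = psi_map p' \<longleftrightarrow>
    (\<lambda>\<sigma>. permute_coords \<sigma> ` p) ` {id, \<tau>, \<tau> \<circ> \<tau>} = (\<lambda>\<sigma>. permute_coords \<sigma> ` p') ` {id, \<tau>, \<tau> \<circ> \<tau>}"
proof -
  obtain v v' where v: "v \<in> bring_cone" "p = proj_pt v" and v': "v' \<in> bring_cone" "p' = proj_pt v'"
    using assms by blast
  show ?thesis
    unfolding v(2) v'(2) orbit_eq[OF \<tau>] psi_map_proj_pt
  proof
    assume "proj_pt (psi v) = proj_pt (psi v')"
    then obtain m where m: "m \<noteq> 0" "v = m *s v' \<or> v = m *s rot v' \<or> v = m *s rot (rot v')"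
      using psi_fibre[OF v(1) v'(1)] by metis
    then show "{proj_pt v, proj_pt (rot v), proj_pt (rot (rot v))} =
        {proj_pt v', proj_pt (rot v'), proj_pt (rot (rot v'))}"
      by (elim disjE) (auto simp: rot_scale proj_pt_scale rot_rot_rot)
  next
    assume "{proj_pt v, proj_pt (rot v), proj_pt (rot (rot v))} =
        {proj_pt v', proj_pt (rot v'), proj_pt (rot (rot v'))}"
    then have "proj_pt v \<in> {proj_pt v', proj_pt (rot v'), proj_pt (rot (rot v'))}" by blast
    then have "psi_map (proj_pt v) \<in> psi_map ` {proj_pt v', proj_pt (rot v'), proj_pt (rot (rot v'))}"
      by (rule imageI)
    then show "proj_pt (psi v) = proj_pt (psi v')" by (simp add: psi_map_proj_pt psi_rot)
  qed
qed

lemma biholomorphic_orbit_sextic: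
  assumes \<tau>: "bij \<tau>" "\<tau> a = b" "\<tau> b = c" "\<tau> c = a" "\<tau> d = d" "\<tau> e = e"
  shows "biholomorphic (orbit_cspace bring_curve {id, \<tau>, \<tau> \<circ> \<tau>}) sextic_surface"
  unfolding orbit_cspace_def
proof (rule biholomorphic_quotient[OF sheaf_bring_curve sheaf_sextic_surface holomorphic_psi_map quotient_map_psi_map])
  show "psi_map p = psi_map p' \<longleftrightarrow>
    (\<lambda>\<sigma>. permute_coords \<sigma> ` p) ` {id, \<tau>, \<tau> \<circ> \<tau>} = (\<lambda>\<sigma>. permute_coords \<sigma> ` p') ` {id, \<tau>, \<tau> \<circ> \<tau>}"
    if "p \<in> topspace (ctop bring_curve)" "p' \<in> topspace (ctop bring_curve)" for p p'
    by (rule psi_map_fibres[OF that[unfolded topspace_bring_curve] \<tau>])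
  show "hol_at sextic_surface f y"
    if "openin (ctop sextic_surface) V" "y \<in> V"
      "\<And>p. p \<in> topspace (ctop bring_curve) \<Longrightarrow> psi_map p \<in> V \<Longrightarrow> hol_at bring_curve (f \<circ> psi_map) p" for f y V
  proof (rule hol_at_descends[OF that(2) _ that(3)])
    show "y \<in> sextic_curve" using that(2) openin_subset[OF that(1)] unfolding topspace_sextic_surface by blast
  qed
qed

end

section \<open>Subgroups of order three\<close>

lemma order_three_subgroup:
  assumes Z: "subgroup Z (alternating_group UNIV)" and card: "card Z = 3"
  obtains \<tau> where "bij \<tau>" "\<tau> \<noteq> id" "\<tau> \<circ> \<tau> \<circ> \<tau> = id" "Z = {id, \<tau>, \<tau> \<circ> \<tau>}"
proof -
  have one: "id \<in> Z" using subgroup.one_closed[OF Z] by (simp add: alternating_group_def)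
  have mult: "f \<circ> g \<in> Z" if "f \<in> Z" "g \<in> Z" for f g
    using subgroup.m_closed[OF Z that] by (simp add: alternating_group_def)
  have bij: "bij f" if "f \<in> Z" for f
    using subgroup.mem_carrier[OF Z that] by (auto simp: alternating_group_def intro: permutes_bij)
  have canc: "g = h" if "f \<in> Z" "f \<circ> g = f \<circ> h" for f g h :: "'a \<Rightarrow> 'a"
  proof
    fix x
    show "g x = h x" using injD[OF bij_is_inj[OF bij[OF that(1)]]] fun_cong[OF that(2), of x] by simp
  qed
  have fin: "finite Z" using card by (metis card.infinite zero_neq_numeral)
  have "Z \<noteq> {id}" using card by auto
  then obtain \<tau> where t: "\<tau> \<in> Z" "\<tau> \<noteq> id" using one by blast
  have tt: "\<tau> \<circ> \<tau> \<in> Z" by (rule mult[OF t(1) t(1)])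
  have n1: "\<tau> \<circ> \<tau> \<noteq> \<tau>" using canc[OF t(1), of \<tau> id] t(2) by auto
  \<comment> \<open>If \<open>\<tau>\<close> were an involution, its product with the remaining
    element \<open>\<rho>\<close> could be none of the three elements of \<open>Z\<close>.\<close>
  have n2: "\<tau> \<circ> \<tau> \<noteq> id"
  proof
    assume inv: "\<tau> \<circ> \<tau> = id"
    have "\<not> Z \<subseteq> {id, \<tau>}" using card_mono[of "{id, \<tau>}" Z] card t(2) by auto
    then obtain \<rho> where r: "\<rho> \<in> Z" "\<rho> \<noteq> id" "\<rho> \<noteq> \<tau>" by blast
    have Zr: "Z = {id, \<tau>, \<rho>}"
      by (rule sym, rule card_subset_eq[OF fin]) (use r t one card in auto)
    have "\<tau> \<circ> \<rho> \<in> Z" by (rule mult[OF t(1) r(1)])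
    moreover have "\<tau> \<circ> \<rho> \<noteq> id" using canc[OF t(1), of \<rho> \<tau>] inv r(3) by auto
    moreover have "\<tau> \<circ> \<rho> \<noteq> \<tau>" using canc[OF t(1), of \<rho> id] r(2) by auto
    moreover have "\<tau> \<circ> \<rho> \<noteq> \<rho>"
    proof
      assume "\<tau> \<circ> \<rho> = \<rho>"
      then have "\<tau> (\<rho> x) = \<rho> x" for x by (metis comp_apply)
      then have "\<tau> x = x" for x using bij_is_surj[OF bij[OF r(1)]] by (metis surjD)
      then show False using t(2) by auto
    qed
    ultimately show False using Zr by blast
  qed
  have Zt: "Z = {id, \<tau>, \<tau> \<circ> \<tau>}"
    by (rule sym, rule card_subset_eq[OF fin]) (use t tt one n1 n2 card in auto)
  have "\<tau> \<circ> (\<tau> \<circ> \<tau>) \<in> Z" by (rule mult[OF t(1) tt])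
  moreover have "\<tau> \<circ> (\<tau> \<circ> \<tau>) \<noteq> \<tau>" using canc[OF t(1), of "\<tau> \<circ> \<tau>" id] n2 by auto
  moreover have "\<tau> \<circ> (\<tau> \<circ> \<tau>) \<noteq> \<tau> \<circ> \<tau>" using canc[OF t(1), of "\<tau> \<circ> \<tau>" \<tau>] n1 by auto
  ultimately have "\<tau> \<circ> (\<tau> \<circ> \<tau>) = id" using Zt by blast
  then show thesis using that[OF bij[OF t(1)] t(2) _ Zt] by (simp add: o_assoc)
qed

text \<open>A moved point generates an orbit of length three. The two points left over cannot be
  swapped, because the cube of a swap is again a swap.\<close>

lemma three_cycle:
  fixes \<tau> :: "5 \<Rightarrow> 5"
  assumes \<tau>: "bij \<tau>" "\<tau> \<noteq> id" "\<tau> \<circ> \<tau> \<circ> \<tau> = id"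
  obtains a b c d e where "distinct [a, b, c, d, e]"
    "\<tau> a = b" "\<tau> b = c" "\<tau> c = a" "\<tau> d = d" "\<tau> e = e"
proof -
  have cube: "\<tau> (\<tau> (\<tau> x)) = x" for x using \<tau>(3) by (metis comp_apply id_apply)
  have inj: "\<tau> x = \<tau> y \<longleftrightarrow> x = y" for x y using bij_is_inj[OF \<tau>(1)] by (auto simp: inj_def)
  obtain a where a: "\<tau> a \<noteq> a" using \<tau>(2) by (metis ext id_apply)
  define b c where "b = \<tau> a" and "c = \<tau> b"
  have ca: "\<tau> c = a" using cube by (simp add: b_def c_def)
  have dist: "a \<noteq> b" "b \<noteq> c" "a \<noteq> c" using a inj ca by (auto simp: b_def c_def)
  have "card (UNIV - {a, b, c}) = 2" using dist by (simp add: card_Diff_subset)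
  then obtain d e where de: "UNIV - {a, b, c} = {d, e}" "d \<noteq> e" by (auto simp: card_2_iff)
  have dn: "d \<notin> {a, b, c}" "e \<notin> {a, b, c}" using de by blast+
  have stay: "\<tau> x \<in> {d, e}" if "x \<notin> {a, b, c}" for x
  proof -
    have "\<tau> x \<notin> {a, b, c}" using that inj ca b_def c_def by (metis insert_iff empty_iff)
    then show ?thesis using de(1) by blast
  qed
  have "\<tau> d = d"
  proof (rule ccontr)
    assume "\<tau> d \<noteq> d"
    then have "\<tau> d = e" using stay[OF dn(1)] by auto
    moreover from this have "\<tau> e = d" using stay[OF dn(2)] inj[of d e] de(2) by auto
    ultimately show False using cube[of d] de(2) by simp
  qed
  moreover from this have "\<tau> e = e" using stay[OF dn(2)] inj[of d e] de(2) by auto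
  ultimately show thesis
    using that[of a b c d e] dist dn de(2) ca by (auto simp: b_def[symmetric] c_def[symmetric])
qed

lemma primitive_cube_root: obtains \<omega> :: complex where "\<omega>\<^sup>2 + \<omega> + 1 = 0"
proof (rule that[of "Complex (- 1 / 2) (sqrt 3 / 2)"])
  show "(Complex (- 1 / 2) (sqrt 3 / 2))\<^sup>2 + Complex (- 1 / 2) (sqrt 3 / 2) + 1 = 0"
    by (simp add: complex_eq_iff power2_eq_square)
qed

lemma sextic_double_cover_eq:
  assumes "compactin (ctop proj_space) sextic_curve"
  shows "sextic_double_cover (\<lambda>x. sextic x 1) = sextic_surface"
proof -
  have "{proj_pt (vector [1, x, x\<^sup>2, x ^ 3, y]) | x y. y\<^sup>2 = sextic x 1} = (\<lambda>v. proj_pt (patch0 v)) ` sextic_cover"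
    (is "?A = ?B")
  proof (intro subset_antisym subsetI)
    fix L assume "L \<in> ?A"
    then obtain x y where "L = proj_pt (vector [1, x, x\<^sup>2, x ^ 3, y])" "y\<^sup>2 = sextic x 1" by blast
    then show "L \<in> ?B"
      by (intro image_eqI[of _ _ "vector [x, y]"]) (auto simp: patch0_def theta_def double_cover_def)
  next
    fix L assume "L \<in> ?B"
    then show "L \<in> ?A" by (auto simp: patch0_def theta_def double_cover_def)
  qed
  then show ?thesis
    unfolding sextic_double_cover_def
    using connectedin_sextic_curve(2)[OF compactin_imp_closedin[OF Hausdorff_proj_space assms]] by simp
qed

lemma smooth_completion_sextic:
  assumes comp: "compactin (ctop proj_space) sextic_curve"
  shows "smooth_completion (affine_double_cover (\<lambda>x. sextic x 1)) sextic_surface"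
  unfolding smooth_completion_def
proof (intro conjI exI)
  show "compact_riemann_surface sextic_surface"
    by (rule compact_riemann_surface_biholomorphic_sextic[OF sheaf_sextic_surface biholomorphic_refl comp])
  let ?U = "(\<lambda>v. proj_pt (patch0 v)) ` sextic_cover"
  show "openin (ctop sextic_surface) ?U" by (rule openin_patch_image(1))
  show "finite (topspace (ctop sextic_surface) - ?U)"
    unfolding topspace_sextic_surface by (rule sextic_infinity_finite)
  obtain G where G: "holomorphic_map (sub_cspace sextic_cover affine_space) (sub_cspace ?U sextic_surface) (\<lambda>x. proj_pt (patch0 x))"
    "holomorphic_map (sub_cspace ?U sextic_surface) (sub_cspace sextic_cover affine_space) G"
    "\<And>x. G (proj_pt (patch0 x)) = x" using sextic_patch0 by blast
  show "biholomorphic (affine_double_cover (\<lambda>x. sextic x 1)) (sub_cspace ?U sextic_surface)"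
    unfolding biholomorphic_def affine_double_cover_eq
    by (intro exI conjI, rule G(1), rule G(2)) (use G(3) in auto)
qed

theorem proposition6p1:
  fixes Z3 :: "(5 \<Rightarrow> 5) set" and P :: "complex \<Rightarrow> complex"
  assumes "subgroup Z3 (alternating_group UNIV)"
    and "cyclic_group ((alternating_group UNIV)\<lparr>carrier := Z3\<rparr>)"
    and "card Z3 = 3"
    and "P = (\<lambda>x. 432 * x ^ 6 + 648 * x ^ 5 + 945 * x ^ 4 + 1350 * x ^ 3 + 945 * x\<^sup>2 + 648 * x + 432)"
  shows "compact_riemann_surface (orbit_cspace bring_curve Z3) \<and>
         smooth_completion (affine_double_cover P) (sextic_double_cover P) \<and>
         biholomorphic (orbit_cspace bring_curve Z3) (sextic_double_cover P)"
proof -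
  have P: "P = (\<lambda>x. sextic x 1)" using assms(4) by (simp add: sextic_eq)
  obtain \<tau> where t: "bij \<tau>" "\<tau> \<noteq> id" "\<tau> \<circ> \<tau> \<circ> \<tau> = id" and Z3: "Z3 = {id, \<tau>, \<tau> \<circ> \<tau>}"
    using order_three_subgroup[OF assms(1,3)] by metis
  obtain a b c d e where dist: "distinct [a, b, c, d, e]"
    and cyc: "\<tau> a = b" "\<tau> b = c" "\<tau> c = a" "\<tau> d = d" "\<tau> e = e"
    using three_cycle[OF t] by metis
  obtain \<omega> :: complex where "\<omega>\<^sup>2 + \<omega> + 1 = 0" using primitive_cube_root by blast
  \<comment> \<open>The cycle of \<open>\<tau>\<close> labels the coordinates that enter the
    resolvents; its two fixed points supply s and t.\<close>
  with dist interpret resolvents a b c d e \<omega> by unfold_locales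
  have bi: "biholomorphic (orbit_cspace bring_curve Z3) sextic_surface"
    unfolding Z3 by (rule biholomorphic_orbit_sextic[OF t(1) cyc])
  have "sheaf_cspace (orbit_cspace bring_curve Z3)"
    unfolding orbit_cspace_def by (rule sheaf_quotient_cspace[OF sheaf_bring_curve])
  then have "compact_riemann_surface (orbit_cspace bring_curve Z3)"
    by (rule compact_riemann_surface_biholomorphic_sextic[OF _ bi compactin_sextic_curve])
  then show ?thesis
    unfolding P sextic_double_cover_eq[OF compactin_sextic_curve]
    using smooth_completion_sextic[OF compactin_sextic_curve] bi by blast
qed

end
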